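(* Let $(l,Q,\omega,\varphi)$ be regular data (see context) and assume that $\Phi:(0,1)\to(0,\infty)$ is strictly decreasing. Then: (i) $s_{\mathrm{frac}}=\sup\Phi=\Phi(0^+)$. (ii) $g(s)=\bar\varsigma s$ for every $s\in[0,\inf\Phi]$. Moreover, for every $s\in(\inf\Phi,s_{\mathrm{frac}})$, setting $m_s:=\Phi^{-1}(s)$, one has $w_{m_s,s}\in W^{1,1}((2m_s-1,1))$, $\lambda_{m_s,s}=\vartheta^{1/2}(m_s)$ and $g(s)=\mathfrak G_s(m_s)$, and $m_s$ is the unique value $m\in(0,1)$ such that $g(s)=\mathfrak G_s(m)$. (iii) $g\in C^1([0,\infty))$ if $\vartheta(1^-)<\infty$, and $g\in C^1((0,\infty))\cap C^0([0,\infty))$ if $\vartheta(1^-)=\infty$, with $g'(s)=\vartheta^{1/2}(m_s)$ for $s\in[\inf\Phi,s_{\mathrm{frac}}]$ (with $m_{\inf\Phi}:=1$, $m_{s_{\mathrm{frac}}}:=0$), $g'(s)=\bar\varsigma$ for $s\in[0,\inf\Phi]$, and $g'(s)=0$ for $s\ge s_{\mathrm{frac}}$. (If $\vartheta(1^-)=\infty$, the formulas at $s=0$ are understood as $g'(0^+)=\infty$.) In particular $g$ is concave, and strictly concave on $[\inf\Phi,s_{\mathrm{frac}}]$. Moreover, $\bar\varsigma\, s_{\mathrm{frac}}\ge 2\Psi(1)$ if $\vartheta(1^-)<\infty$.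
   Context: Convention: $0\cdot\infty=0$. Regular data: $l,Q\in C^0([0,1],[0,\infty))$ with $l(1)=1$, $l^{-1}(\{0\})=Q^{-1}(\{0\})=\{0\}$, $Q$ increasing in a right neighbourhood of $0$, and $t\mapsto (l(t)/Q(1-t))^{1/2}$ (on $[0,1)$) increasing in a right neighbourhood of $0$; $\omega\in C^0([0,1],[0,\infty))$ with $\omega^{-1}(\{0\})=\{0\}$ such that the limit $\bar\varsigma:=\lim_{t\to0^+}(\omega(t)/Q(t))^{1/2}\in[0,\infty]$ exists; $\varphi\in C^0([0,\infty),[0,\infty))$ non-decreasing with $\lim_{t\to\infty}\varphi(t)\in(0,\infty)$, $\varphi^{-1}(0)=\{0\}$, right-differentiable at $0$ with $\varphi'(0^+)=1$; and the function $\vartheta(t):=\frac{\omega(1-t)}{Q(1-t)}l(t)$, $t\in[0,1)$, belongs to $C^1((0,1))$ with $\vartheta'>0$ on $(0,1)$. Then $\vartheta(0)=0$ and $\vartheta(1^-)=\bar\varsigma^2\in(0,\infty]$; set $\vartheta(1):=\vartheta(1^-)$. $\Psi(t):=\int_0^t\omega^{1/2}(1-\tau)\,d\tau$. For $s\ge0$, $$g(s):=\inf\int_0^1\big(\vartheta(v)|u'|^2+\omega(1-v)|v'|^2\big)^{1/2}dx$$ over $u,v\in H^1((0,1))$ with $u(0)=0$, $u(1)=s$, $0\le v\le1$, $v(0)=v(1)=1$. $s_{\mathrm{frac}}:=\sup\{s\in[0,\infty): g(s)<2\Psi(1)\}\in(0,\infty]$. For $m\in(0,1)$, $t\in[2m-1,1]$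 let $\vartheta_m(t):=\vartheta(m+|t-m|)$ and $\omega_m(1-t):=\omega(1-m-|t-m|)$. For $s>0$ and $w\in BV((2m-1,1))$ let $$sc^-G_{m,s}(w):=\int_{2m-1}^1\big(\vartheta_m(t)|w'|^2+\omega_m(1-t)\big)^{1/2}dt+\int_{2m-1}^1\vartheta_m^{1/2}\,d|D^sw|+\vartheta^{1/2}(1^-)|w((2m-1)^+)|+\vartheta^{1/2}(1^-)|w(1^-)-s|,$$ and $+\infty$ on $L^1\setminus BV$. This functional has a unique minimizer $w_{m,s}$ on $L^1((2m-1,1))$; it satisfies, for a unique $\lambda_{m,s}\in(0,\vartheta^{1/2}(m)]$, $w_{m,s}'(t)=\Big(\frac{\lambda_{m,s}^2\,\omega_m(1-t)}{\vartheta_m(t)(\vartheta_m(t)-\lambda_{m,s}^2)}\Big)^{1/2}$ for a.e. $t$. Set $\mathfrak G_s(m):=sc^-G_{m,s}(w_{m,s})$. $\Phi(x):=2\int_x^1\Big(\frac{\vartheta(x)\,\omega(1-t)}{\vartheta(t)(\vartheta(t)-\vartheta(x))}\Big)^{1/2}dt$ for $x\in(0,1)$. *)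

theory Defs
  imports "HOL-Analysis.Analysis"
begin

section \<open>Function spaces on an interval\<close>

definition L1_on :: "real \<Rightarrow> real \<Rightarrow> (real \<Rightarrow> real) \<Rightarrow> bool" where
  "L1_on a b u \<longleftrightarrow> integrable (lebesgue_on {a<..<b}) u"

definition L2_on :: "real \<Rightarrow> real \<Rightarrow> (real \<Rightarrow> real) \<Rightarrow> bool" where
  "L2_on a b u \<longleftrightarrow> u \<in> borel_measurable (lebesgue_on {a<..<b})
     \<and> integrable (lebesgue_on {a<..<b}) (\<lambda>x. (u x)\<^sup>2)"

text \<open>The test functions $C^1_c((a,b))$.\<close>

definition test_fun :: "real \<Rightarrow> real \<Rightarrow> (real \<Rightarrow> real) \<Rightarrow> bool" where
  "test_fun a b \<psi> \<longleftrightarrow> \<psi> C1_differentiable_on UNIV \<and> closure {x. \<psi> x \<noteq> 0} \<subseteq> {a<..<b}"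

definition weak_deriv :: "real \<Rightarrow> real \<Rightarrow> (real \<Rightarrow> real) \<Rightarrow> (real \<Rightarrow> real) \<Rightarrow> bool" where
  "weak_deriv a b u u' \<longleftrightarrow> (\<forall>\<psi>. test_fun a b \<psi> \<longrightarrow>
     (\<integral>x. u x * deriv \<psi> x \<partial>lebesgue_on {a<..<b}) = - (\<integral>x. u' x * \<psi> x \<partial>lebesgue_on {a<..<b}))"

definition W11 :: "real \<Rightarrow> real \<Rightarrow> (real \<Rightarrow> real) \<Rightarrow> bool" where
  "W11 a b u \<longleftrightarrow> L1_on a b u \<and> (\<exists>u'. L1_on a b u' \<and> weak_deriv a b u u')"

text \<open>\<open>H1 a b u u'\<close>: \<open>u\<close> is the representative of an element of $H^1((a,b))$ that is continuous
  up to the boundary, and \<open>u'\<close> is its weak derivative. Boundary values and pointwise bounds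
  refer to this representative.\<close>

definition H1 :: "real \<Rightarrow> real \<Rightarrow> (real \<Rightarrow> real) \<Rightarrow> (real \<Rightarrow> real) \<Rightarrow> bool" where
  "H1 a b u u' \<longleftrightarrow> continuous_on {a..b} u \<and> L2_on a b u \<and> L2_on a b u' \<and> weak_deriv a b u u'"

definition finite_borel_measure_on :: "real \<Rightarrow> real \<Rightarrow> real measure \<Rightarrow> bool" where
  "finite_borel_measure_on a b \<mu> \<longleftrightarrow>
     finite_measure \<mu> \<and> sets \<mu> = sets (restrict_space borel {a<..<b})"

text \<open>There is no type of signed measures, so the distributional derivative \<open>D w\<close> is written as a
  difference of two finite positive measures.\<close>

definition BV :: "real \<Rightarrow> real \<Rightarrow> (real \<Rightarrow> real) \<Rightarrow> bool" where
  "BV a b w \<longleftrightarrow> L1_on a b w \<and>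
     (\<exists>\<mu> \<nu>. finite_borel_measure_on a b \<mu> \<and> finite_borel_measure_on a b \<nu> \<and>
        (\<forall>\<psi>. test_fun a b \<psi> \<longrightarrow>
           (\<integral>x. w x * deriv \<psi> x \<partial>lebesgue_on {a<..<b}) = - ((\<integral>x. \<psi> x \<partial>\<mu>) - (\<integral>x. \<psi> x \<partial>\<nu>))))"

definition mutually_singular :: "'a measure \<Rightarrow> 'a measure \<Rightarrow> bool" where
  "mutually_singular \<mu> \<nu> \<longleftrightarrow> (\<exists>A\<in>sets \<mu>. emeasure \<mu> A = 0 \<and> emeasure \<nu> (space \<nu> - A) = 0)"

text \<open>The Lebesgue decomposition \<open>D w = f dx + D\<^sup>s w\<close> together with the Jordan decomposition
  \<open>D\<^sup>s w = \<sigma> - \<tau>\<close> of the singular part; thus $|D^s w| = \sigma + \tau$. The function \<open>f\<close> is unique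
  almost everywhere, \<open>\<sigma>\<close> and \<open>\<tau>\<close> are unique.\<close>

definition bv_decomp ::
  "real \<Rightarrow> real \<Rightarrow> (real \<Rightarrow> real) \<Rightarrow> (real \<Rightarrow> real) \<Rightarrow> real measure \<Rightarrow> real measure \<Rightarrow> bool" where
  "bv_decomp a b w f \<sigma> \<tau> \<longleftrightarrow>
     L1_on a b f \<and> finite_borel_measure_on a b \<sigma> \<and> finite_borel_measure_on a b \<tau> \<and>
     mutually_singular \<sigma> (restrict_space lborel {a<..<b}) \<and>
     mutually_singular \<tau> (restrict_space lborel {a<..<b}) \<and>
     mutually_singular \<sigma> \<tau> \<and>
     (\<forall>\<psi>. test_fun a b \<psi> \<longrightarrow>
        (\<integral>x. w x * deriv \<psi> x \<partial>lebesgue_on {a<..<b}) =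
          - ((\<integral>x. f x * \<psi> x \<partial>lebesgue_on {a<..<b}) + ((\<integral>x. \<psi> x \<partial>\<sigma>) - (\<integral>x. \<psi> x \<partial>\<tau>))))"

definition bv_density :: "real \<Rightarrow> real \<Rightarrow> (real \<Rightarrow> real) \<Rightarrow> real \<Rightarrow> real" where
  "bv_density a b w = (SOME f. \<exists>\<sigma> \<tau>. bv_decomp a b w f \<sigma> \<tau>)"

definition bv_sing_pos :: "real \<Rightarrow> real \<Rightarrow> (real \<Rightarrow> real) \<Rightarrow> real measure" where
  "bv_sing_pos a b w = (THE \<sigma>. \<exists>f \<tau>. bv_decomp a b w f \<sigma> \<tau>)"

definition bv_sing_neg :: "real \<Rightarrow> real \<Rightarrow> (real \<Rightarrow> real) \<Rightarrow> real measure" where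
  "bv_sing_neg a b w = (THE \<tau>. \<exists>f \<sigma>. bv_decomp a b w f \<sigma> \<tau>)"

definition sing_integral :: "real \<Rightarrow> real \<Rightarrow> (real \<Rightarrow> real) \<Rightarrow> (real \<Rightarrow> ennreal) \<Rightarrow> ennreal" where
  "sing_integral a b w h =
     (\<integral>\<^sup>+ t. h t \<partial>bv_sing_pos a b w) + (\<integral>\<^sup>+ t. h t \<partial>bv_sing_neg a b w)"

text \<open>One-sided traces, as essential one-sided limits: the limit is taken along the one-sided
  neighbourhoods up to Lebesgue null sets, hence depends only on the a.e. class of \<open>w\<close>.\<close>

definition trace_right :: "(real \<Rightarrow> real) \<Rightarrow> real \<Rightarrow> real" where
  "trace_right w a = Lim (inf (at_right a) (ae_filter lebesgue)) w"

definition trace_left :: "(real \<Rightarrow> real) \<Rightarrow> real \<Rightarrow> real" where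
  "trace_left w b = Lim (inf (at_left b) (ae_filter lebesgue)) w"

definition strictly_concave_on :: "real set \<Rightarrow> (real \<Rightarrow> real) \<Rightarrow> bool" where
  "strictly_concave_on S f \<longleftrightarrow> (\<forall>x\<in>S. \<forall>y\<in>S. \<forall>t. x \<noteq> y \<and> 0 < t \<and> t < 1 \<longrightarrow>
     (1 - t) * f x + t * f y < f ((1 - t) * x + t * y))"

section \<open>The data\<close>

text \<open>Extended non-negative reals carry the convention $0\cdot\infty = 0$.\<close>

definition ennsqrt :: "ennreal \<Rightarrow> ennreal" where
  "ennsqrt x = (if x = top then top else ennreal (sqrt (enn2real x)))"

definition theta :: "(real \<Rightarrow> real) \<Rightarrow> (real \<Rightarrow> real) \<Rightarrow> (real \<Rightarrow> real) \<Rightarrow> real \<Rightarrow> real" where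
  "theta l Q \<omega> t = \<omega> (1 - t) / Q (1 - t) * l t"

text \<open>$\vartheta$ on $[0,1]$, with $\vartheta(1) := \vartheta(1^-)$ possibly infinite.\<close>

definition theta_ext :: "(real \<Rightarrow> real) \<Rightarrow> (real \<Rightarrow> real) \<Rightarrow> (real \<Rightarrow> real) \<Rightarrow> real \<Rightarrow> ennreal" where
  "theta_ext l Q \<omega> t = (if t < 1 then ennreal (theta l Q \<omega> t)
     else Lim (at_left 1) (\<lambda>\<tau>. ennreal (theta l Q \<omega> \<tau>)))"

definition varsigma_bar :: "(real \<Rightarrow> real) \<Rightarrow> (real \<Rightarrow> real) \<Rightarrow> ennreal" where
  "varsigma_bar Q \<omega> = Lim (at_right 0) (\<lambda>t. ennreal (sqrt (\<omega> t / Q t)))"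

text \<open>``Increasing'' is read in the weak sense here.\<close>

definition regular_data ::
  "(real \<Rightarrow> real) \<Rightarrow> (real \<Rightarrow> real) \<Rightarrow> (real \<Rightarrow> real) \<Rightarrow> (real \<Rightarrow> real) \<Rightarrow> bool" where
  "regular_data l Q \<omega> \<phi> \<longleftrightarrow>
     continuous_on {0..1} l \<and> (\<forall>t\<in>{0..1}. 0 \<le> l t) \<and>
     continuous_on {0..1} Q \<and> (\<forall>t\<in>{0..1}. 0 \<le> Q t) \<and>
     l 1 = 1 \<and> (\<forall>t\<in>{0..1}. l t = 0 \<longleftrightarrow> t = 0) \<and> (\<forall>t\<in>{0..1}. Q t = 0 \<longleftrightarrow> t = 0) \<and>
     (\<exists>\<delta>>0. mono_on {0..<\<delta>} Q) \<and>
     (\<exists>\<delta>>0. mono_on {0..<\<delta>} (\<lambda>t. sqrt (l t / Q (1 - t)))) \<and>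
     continuous_on {0..1} \<omega> \<and> (\<forall>t\<in>{0..1}. 0 \<le> \<omega> t) \<and> (\<forall>t\<in>{0..1}. \<omega> t = 0 \<longleftrightarrow> t = 0) \<and>
     (\<exists>L::ennreal. ((\<lambda>t. ennreal (sqrt (\<omega> t / Q t))) \<longlongrightarrow> L) (at_right 0)) \<and>
     continuous_on {0..} \<phi> \<and> (\<forall>t\<ge>0. 0 \<le> \<phi> t) \<and> mono_on {0..} \<phi> \<and>
     (\<exists>L>0. (\<phi> \<longlongrightarrow> L) at_top) \<and> (\<forall>t\<ge>0. \<phi> t = 0 \<longleftrightarrow> t = 0) \<and>
     (\<phi> has_real_derivative 1) (at_right 0) \<and>
     theta l Q \<omega> C1_differentiable_on {0<..<1} \<and> (\<forall>t\<in>{0<..<1}. 0 < deriv (theta l Q \<omega>) t)"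

definition Psi :: "(real \<Rightarrow> real) \<Rightarrow> real \<Rightarrow> real" where
  "Psi \<omega> t = integral {0..t} (\<lambda>\<tau>. sqrt (\<omega> (1 - \<tau>)))"

section \<open>The cohesive surface energy\<close>

definition g_energy ::
  "(real \<Rightarrow> real) \<Rightarrow> (real \<Rightarrow> real) \<Rightarrow> (real \<Rightarrow> real) \<Rightarrow>
   (real \<Rightarrow> real) \<Rightarrow> (real \<Rightarrow> real) \<Rightarrow> (real \<Rightarrow> real) \<Rightarrow> ennreal" where
  "g_energy l Q \<omega> v u' v' = (\<integral>\<^sup>+ x.
     ennsqrt (theta_ext l Q \<omega> (v x) * ennreal ((u' x)\<^sup>2) + ennreal (\<omega> (1 - v x) * (v' x)\<^sup>2))
     \<partial>lebesgue_on {0<..<1})"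

definition g :: "(real \<Rightarrow> real) \<Rightarrow> (real \<Rightarrow> real) \<Rightarrow> (real \<Rightarrow> real) \<Rightarrow> real \<Rightarrow> ennreal" where
  "g l Q \<omega> s = Inf {g_energy l Q \<omega> v u' v' | u v u' v'.
     H1 0 1 u u' \<and> H1 0 1 v v' \<and> u 0 = 0 \<and> u 1 = s \<and>
     (\<forall>x\<in>{0..1}. 0 \<le> v x \<and> v x \<le> 1) \<and> v 0 = 1 \<and> v 1 = 1}"

definition g_real :: "(real \<Rightarrow> real) \<Rightarrow> (real \<Rightarrow> real) \<Rightarrow> (real \<Rightarrow> real) \<Rightarrow> real \<Rightarrow> real" where
  "g_real l Q \<omega> s = enn2real (g l Q \<omega> s)"

definition s_frac :: "(real \<Rightarrow> real) \<Rightarrow> (real \<Rightarrow> real) \<Rightarrow> (real \<Rightarrow> real) \<Rightarrow> ennreal" where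
  "s_frac l Q \<omega> = Sup {ennreal s | s. 0 \<le> s \<and> g l Q \<omega> s < ennreal (2 * Psi \<omega> 1)}"

section \<open>The auxiliary one-dimensional problem\<close>

definition theta_m ::
  "(real \<Rightarrow> real) \<Rightarrow> (real \<Rightarrow> real) \<Rightarrow> (real \<Rightarrow> real) \<Rightarrow> real \<Rightarrow> real \<Rightarrow> real" where
  "theta_m l Q \<omega> m t = theta l Q \<omega> (m + \<bar>t - m\<bar>)"

text \<open>\<open>omega_m \<omega> m t\<close> stands for $\omega_m(1-t)$.\<close>

definition omega_m :: "(real \<Rightarrow> real) \<Rightarrow> real \<Rightarrow> real \<Rightarrow> real" where
  "omega_m \<omega> m t = \<omega> (1 - m - \<bar>t - m\<bar>)"

definition scG ::
  "(real \<Rightarrow> real) \<Rightarrow> (real \<Rightarrow> real) \<Rightarrow> (real \<Rightarrow> real) \<Rightarrow> real \<Rightarrow> real \<Rightarrow> (real \<Rightarrow> real) \<Rightarrow> ennreal" where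
  "scG l Q \<omega> m s w = (if BV (2 * m - 1) 1 w then
     (\<integral>\<^sup>+ t. ennreal (sqrt (theta_m l Q \<omega> m t * (bv_density (2 * m - 1) 1 w t)\<^sup>2 + omega_m \<omega> m t))
        \<partial>lebesgue_on {2 * m - 1<..<1})
     + sing_integral (2 * m - 1) 1 w (\<lambda>t. ennreal (sqrt (theta_m l Q \<omega> m t)))
     + ennsqrt (theta_ext l Q \<omega> 1) * ennreal \<bar>trace_right w (2 * m - 1)\<bar>
     + ennsqrt (theta_ext l Q \<omega> 1) * ennreal \<bar>trace_left w 1 - s\<bar>
   else top)"

definition w_min ::
  "(real \<Rightarrow> real) \<Rightarrow> (real \<Rightarrow> real) \<Rightarrow> (real \<Rightarrow> real) \<Rightarrow> real \<Rightarrow> real \<Rightarrow> real \<Rightarrow> real" where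
  "w_min l Q \<omega> m s = (SOME w. L1_on (2 * m - 1) 1 w \<and>
     (\<forall>z. L1_on (2 * m - 1) 1 z \<longrightarrow> scG l Q \<omega> m s w \<le> scG l Q \<omega> m s z))"

definition lambda_min ::
  "(real \<Rightarrow> real) \<Rightarrow> (real \<Rightarrow> real) \<Rightarrow> (real \<Rightarrow> real) \<Rightarrow> real \<Rightarrow> real \<Rightarrow> real" where
  "lambda_min l Q \<omega> m s = (THE lam. 0 < lam \<and> lam \<le> sqrt (theta l Q \<omega> m) \<and>
     (AE t in lebesgue_on {2 * m - 1<..<1}.
        bv_density (2 * m - 1) 1 (w_min l Q \<omega> m s) t =
          sqrt (lam\<^sup>2 * omega_m \<omega> m t / (theta_m l Q \<omega> m t * (theta_m l Q \<omega> m t - lam\<^sup>2)))))"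

definition G_min :: "(real \<Rightarrow> real) \<Rightarrow> (real \<Rightarrow> real) \<Rightarrow> (real \<Rightarrow> real) \<Rightarrow> real \<Rightarrow> real \<Rightarrow> ennreal" where
  "G_min l Q \<omega> s m = scG l Q \<omega> m s (w_min l Q \<omega> m s)"

definition Phi :: "(real \<Rightarrow> real) \<Rightarrow> (real \<Rightarrow> real) \<Rightarrow> (real \<Rightarrow> real) \<Rightarrow> real \<Rightarrow> ennreal" where
  "Phi l Q \<omega> x = 2 * (\<integral>\<^sup>+ t.
     ennreal (sqrt (theta l Q \<omega> x * \<omega> (1 - t) / (theta l Q \<omega> t * (theta l Q \<omega> t - theta l Q \<omega> x))))
     \<partial>lebesgue_on {x<..<1})"

definition inf_Phi :: "(real \<Rightarrow> real) \<Rightarrow> (real \<Rightarrow> real) \<Rightarrow> (real \<Rightarrow> real) \<Rightarrow> ennreal" where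
  "inf_Phi l Q \<omega> = (INF x\<in>{0<..<1}. Phi l Q \<omega> x)"

definition sup_Phi :: "(real \<Rightarrow> real) \<Rightarrow> (real \<Rightarrow> real) \<Rightarrow> (real \<Rightarrow> real) \<Rightarrow> ennreal" where
  "sup_Phi l Q \<omega> = (SUP x\<in>{0<..<1}. Phi l Q \<omega> x)"

text \<open>$m_s = \Phi^{-1}(s)$, extended to the end points of $[\inf\Phi, s_{\mathrm{frac}}]$.\<close>

definition m_of :: "(real \<Rightarrow> real) \<Rightarrow> (real \<Rightarrow> real) \<Rightarrow> (real \<Rightarrow> real) \<Rightarrow> real \<Rightarrow> real" where
  "m_of l Q \<omega> s = (if ennreal s = inf_Phi l Q \<omega> then 1
     else if ennreal s = s_frac l Q \<omega> then 0
     else the_inv_into {0<..<1} (Phi l Q \<omega>) (ennreal s))"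

text \<open>The asserted values of \<open>g'\<close> at a point \<open>s\<close>, as an equation between extended reals.\<close>

definition g_deriv_values ::
  "(real \<Rightarrow> real) \<Rightarrow> (real \<Rightarrow> real) \<Rightarrow> (real \<Rightarrow> real) \<Rightarrow> (real \<Rightarrow> real) \<Rightarrow> real \<Rightarrow> bool" where
  "g_deriv_values l Q \<omega> g' s \<longleftrightarrow>
     (inf_Phi l Q \<omega> \<le> ennreal s \<and> ennreal s \<le> s_frac l Q \<omega> \<longrightarrow>
        ereal (g' s) = enn2ereal (ennsqrt (theta_ext l Q \<omega> (m_of l Q \<omega> s)))) \<and>
     (ennreal s \<le> inf_Phi l Q \<omega> \<longrightarrow> ereal (g' s) = enn2ereal (varsigma_bar Q \<omega>)) \<and>
     (s_frac l Q \<omega> \<le> ennreal s \<longrightarrow> g' s = 0)"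

end

theory Submission
  imports Defs
begin

text \<open>
  Write \<open>W v = \<omega> (1 - v)\<close>. For every \<open>\<lambda>\<close> with \<open>\<lambda>\<^sup>2 \<le> \<theta> v\<close> the Cauchy-Schwarz inequality gives
  \<open>sqrt (\<theta> v * u'\<^sup>2 + W v * v'\<^sup>2) \<ge> \<lambda> * u' + sqrt (W v * (1 - \<lambda>\<^sup>2 / \<theta> v)) * \<bar>v'\<bar>\<close>.
  If \<open>v\<close> descends from \<open>1\<close> to its minimum \<open>m\<close> and comes back, the choice \<open>\<lambda>\<^sup>2 = \<theta> m\<close> bounds the energy
  from below by the affine function \<open>H m s = sqrt (\<theta> m) * s + A m\<close> of the opening \<open>s\<close>, where \<open>A m\<close> is twice the
  integral of \<open>sqrt (W t * (1 - \<theta> m / \<theta> t))\<close> over \<open>[m, 1]\<close>, and the curve for which Cauchy-Schwarz is an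
  equality has opening \<open>\<Phi> m\<close>. Exchanging the order of integration shows that the derivative of \<open>A\<close> is
  \<open>- \<Phi>\<close> times that of \<open>sqrt \<circ> \<theta>\<close>. So if \<open>\<Phi>\<close> decreases strictly, then \<open>m \<mapsto> H m s\<close> has its strict minimum at
  \<open>\<Phi> m = s\<close>, and \<open>g\<close> is the infimum of the functions \<open>H m\<close>: it is concave, \<open>sqrt (\<theta> m\<^sub>s)\<close> is a supergradient
  at \<open>s\<close>, and since this slope depends continuously on \<open>s\<close>, it is the derivative. The same inequality bounds the
  functional of the auxiliary problem from below by \<open>H m s\<close>, and its equality case forces the minimiser for
  \<open>m = m\<^sub>s\<close> to have no singular part and the asserted density.
\<close>

section \<open>Weak derivatives and the lemma of du Bois-Reymond\<close>

text \<open>Sobolev and BV functions are given only through test functions, so representatives,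
  traces and the uniqueness of Dw = f dx + \<sigma> - \<tau> are all extracted from one tool, the
  lemma of du Bois-Reymond applied to a function minus the distribution function of its derivative.
  A competitor for the surface energy must have a slope in L^2, whereas the optimal slope du/dv
  blows up like (v - m)^(-1/2) at the minimum m. Letting v run along a parabola cancels this
  singularity and makes the slope bounded. The infimum over m of \<open>H m s\<close> need not be
  attained in (0, 1). For s \<le> inf \<Phi> it is approached as m tends to 1, which gives the
  linear regime, possibly with infinite slope; for s \<ge> sup \<Phi> it is approached as m tends to
  0, which gives the constant 2 \<Psi>(1). If \<theta>(1-) is infinite, boundedness of g forces inf
  \<Phi> = 0, so that the origin is the only point with an infinite slope. Continuity of the slope
  is proved by order alone: the slope decreases and its values leave no gaps.\<close>

lemma test_funD:
  assumes "test_fun a b \<psi>"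
  shows "(\<psi> has_real_derivative deriv \<psi> x) (at x)" and "continuous_on UNIV (deriv \<psi>)"
    and "x \<notin> {a<..<b} \<Longrightarrow> \<psi> x = 0"
proof -
  obtain D where D: "\<And>x. (\<psi> has_vector_derivative D x) (at x)" "continuous_on UNIV D"
    using assms unfolding test_fun_def C1_differentiable_on_def by auto
  have *: "(\<psi> has_real_derivative D x) (at x)" for x
    using D(1)[of x] by (simp add: has_real_derivative_iff_has_vector_derivative)
  then have "deriv \<psi> = D" by (auto intro: DERIV_imp_deriv)
  with * D(2) show "(\<psi> has_real_derivative deriv \<psi> x) (at x)" "continuous_on UNIV (deriv \<psi>)" by auto
  have "{x. \<psi> x \<noteq> 0} \<subseteq> {a<..<b}"
    using assms closure_subset[of "{x. \<psi> x \<noteq> 0}"] unfolding test_fun_def by (meson order_trans)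
  then show "x \<notin> {a<..<b} \<Longrightarrow> \<psi> x = 0" by auto
qed

lemma finite_measure_lebesgue_on_Ioo: "finite_measure (lebesgue_on {a<..<b::real})"
proof (rule finite_measureI)
  have "emeasure lborel {a<..<b} < \<infinity>" by (rule emeasure_bounded_finite) simp
  then show "emeasure (lebesgue_on {a<..<b}) (space (lebesgue_on {a<..<b})) \<noteq> \<infinity>"
    by (simp add: emeasure_restrict_space less_top)
qed

lemma borel_measurable_lebesgue_on_continuous:
  fixes f :: "real \<Rightarrow> real"
  assumes "continuous_on UNIV f"
  shows "f \<in> borel_measurable (lebesgue_on S)"
  using borel_measurable_continuous_onI[OF assms]
  by (intro measurable_restrict_space1 measurable_completion) simp

lemma integrable_lebesgue_on_bounded:
  fixes f :: "real \<Rightarrow> real"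
  assumes "f \<in> borel_measurable (lebesgue_on {a<..<b})" "\<And>x. a < x \<Longrightarrow> x < b \<Longrightarrow> \<bar>f x\<bar> \<le> B"
  shows "integrable (lebesgue_on {a<..<b}) f"
proof -
  interpret finite_measure "lebesgue_on {a<..<b}" by (rule finite_measure_lebesgue_on_Ioo)
  show ?thesis
    by (rule integrable_const_bound[where B=B]) (use assms in \<open>auto intro!: AE_I2\<close>)
qed

lemma continuous_bounded_Ioo:
  fixes f :: "real \<Rightarrow> real"
  assumes "continuous_on {a..b} f"
  obtains B where "0 < B" "\<And>x. a \<le> x \<Longrightarrow> x \<le> b \<Longrightarrow> \<bar>f x\<bar> \<le> B"
proof -
  have "bounded (f ` {a..b})" using assms by (intro compact_imp_bounded compact_continuous_image) auto
  then obtain B where "0 < B" "\<forall>x\<in>{a..b}. \<bar>f x\<bar> \<le> B" by (auto simp: bounded_pos)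
  then show ?thesis using that by auto
qed

text \<open>As \<psi> vanishes at b, \<open>\<psi> x\<close> is minus the integral of its derivative
  over (x, b); inserting this and applying Fubini moves the derivative onto the distribution
  function of f. The measure is a parameter so that densities and singular parts obey the same
  formula.\<close>

lemma integral_test_fun:
  fixes M :: "real measure"
  assumes \<psi>: "test_fun a b \<psi>" and M: "sigma_finite_measure M" and sM: "space M = {a<..<b}"
    and id: "(\<lambda>x. x) \<in> borel_measurable M" and f: "integrable M f"
  shows "(\<integral>x. f x * \<psi> x \<partial>M) =
    - (\<integral>y. (\<integral>x. indicator {..y} x * f x \<partial>M) * deriv \<psi> y \<partial>lebesgue_on {a<..<b})"
proof -
  let ?N = "lebesgue_on {a<..<b}"
  interpret M: sigma_finite_measure M by fact
  interpret N: finite_measure ?N by (rule finite_measure_lebesgue_on_Ioo)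
  interpret pair_sigma_finite M ?N ..
  note [measurable] = id
  have [measurable]: "(\<lambda>x. x) \<in> borel_measurable ?N"
    by (rule borel_measurable_lebesgue_on_continuous) (intro continuous_intros)
  have [measurable]: "deriv \<psi> \<in> borel_measurable ?N"
    by (rule borel_measurable_lebesgue_on_continuous) (rule test_funD[OF \<psi>])
  have [measurable]: "f \<in> borel_measurable M" using f by auto
  obtain B where B: "0 < B" "\<And>x. a \<le> x \<Longrightarrow> x \<le> b \<Longrightarrow> \<bar>deriv \<psi> x\<bar> \<le> B"
    using continuous_bounded_Ioo continuous_on_subset[OF test_funD(2)[OF \<psi>], of "{a..b}"]
    by (metis top_greatest)
  define h where "h x y = (if x \<le> y then f x * deriv \<psi> y else 0)" for x y
  have h_meas[measurable]: "(\<lambda>(x,y). h x y) \<in> borel_measurable (M \<Otimes>\<^sub>M ?N)"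
  proof -
    have "Measurable.pred (M \<Otimes>\<^sub>M ?N) (\<lambda>p. fst p \<le> snd p)" by measurable
    then show ?thesis unfolding h_def split_beta by measurable
  qed
  have int_y: "integrable ?N (\<lambda>y. h x y)" for x
    by (rule integrable_lebesgue_on_bounded[where B="\<bar>f x\<bar> * B"])
       (use B in \<open>auto simp: h_def abs_mult intro!: mult_left_mono\<close>)
  have "integrable (M \<Otimes>\<^sub>M ?N) (\<lambda>(x,y). h x y)"
  proof (rule Fubini_integrable)
    show "integrable M (\<lambda>x. \<integral>y. norm (case (x, y) of (x, y) \<Rightarrow> h x y) \<partial>?N)"
    proof (rule Bochner_Integration.integrable_bound)
      show "integrable M (\<lambda>x. f x * (B * measure ?N (space ?N)))" using f by simp
      show "(\<lambda>x. \<integral>y. norm (case (x, y) of (x, y) \<Rightarrow> h x y) \<partial>?N) \<in> borel_measurable M" by measurable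
      have "(\<integral>y. \<bar>h x y\<bar> \<partial>?N) \<le> (\<integral>y. \<bar>f x\<bar> * B \<partial>?N)" for x
        by (rule integral_mono_AE)
          (use int_y[of x] B in \<open>auto simp: h_def abs_mult intro!: AE_I2 mult_left_mono\<close>)
      then show "AE x in M. norm (\<integral>y. norm (case (x, y) of (x, y) \<Rightarrow> h x y) \<partial>?N)
          \<le> norm (f x * (B * measure ?N (space ?N)))"
        using B(1) by (auto simp: abs_mult ac_simps)
    qed
  qed (use int_y in auto)
  from Fubini_integral[OF this]
  have "(\<integral>y. (\<integral>x. h x y \<partial>M) \<partial>?N) = (\<integral>x. (\<integral>y. h x y \<partial>?N) \<partial>M)" .
  moreover have "(\<integral>y. (\<integral>x. h x y \<partial>M) \<partial>?N) = (\<integral>y. (\<integral>x. indicator {..y} x * f x \<partial>M) * deriv \<psi> y \<partial>?N)"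
  proof (intro Bochner_Integration.integral_cong refl)
    fix y
    have "(\<lambda>x. h x y) = (\<lambda>x. indicator {..y} x * f x * deriv \<psi> y)"
      by (auto simp: h_def fun_eq_iff indicator_def)
    then show "(\<integral>x. h x y \<partial>M) = (\<integral>x. indicator {..y} x * f x \<partial>M) * deriv \<psi> y" by simp
  qed
  moreover have "(\<integral>x. (\<integral>y. h x y \<partial>?N) \<partial>M) = (\<integral>x. - (f x * \<psi> x) \<partial>M)"
  proof (intro Bochner_Integration.integral_cong refl)
    fix x assume "x \<in> space M"
    then have x: "a < x" "x < b" using sM by auto
    have "(deriv \<psi> has_integral (\<psi> b - \<psi> x)) {x..b}"
      by (rule fundamental_theorem_of_calculus)
        (use x test_funD(1)[OF \<psi>] in \<open>auto simp: has_real_derivative_iff_has_vector_derivative intro: has_vector_derivative_at_within\<close>)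
    then have "((\<lambda>y. f x * deriv \<psi> y) has_integral (f x * (\<psi> b - \<psi> x))) {x..b}"
      by (rule has_integral_mult_right)
    then have "((\<lambda>y. if y \<in> {x..b} then f x * deriv \<psi> y else 0) has_integral (f x * (\<psi> b - \<psi> x))) {a..b}"
      by (subst has_integral_restrict) (use x in auto)
    then have "((\<lambda>y. h x y) has_integral (f x * (\<psi> b - \<psi> x))) {a..b}"
      by (rule has_integral_eq[rotated]) (auto simp: h_def)
    then have "((\<lambda>y. h x y) has_integral (f x * (\<psi> b - \<psi> x))) {a<..<b}"
      by (simp add: has_integral_Icc_iff_Ioo)
    then show "(\<integral>y. h x y \<partial>?N) = - (f x * \<psi> x)"
      using int_y[of x] test_funD(3)[OF \<psi>, of b]
      by (simp add: lebesgue_integral_eq_integral integral_unique)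
  qed
  ultimately show ?thesis by simp
qed

section \<open>Functions and set functions that vanish on half-lines\<close>

text \<open>Closed half-lines form an intersection-stable generator of the Borel sets, so a
  \<pi>-\<lambda> induction suffices. F is an abstract real set function because it will be a
  difference of integrals and finite measures.\<close>

lemma borel_zero_from_atMost:
  fixes F :: "real set \<Rightarrow> real"
  assumes atMost: "\<And>y. F {..y} = 0" and emp: "F {} = 0"
    and compl: "\<And>X. X \<in> sets borel \<Longrightarrow> F X = 0 \<Longrightarrow> F (- X) = 0"
    and union: "\<And>X. disjoint_family X \<Longrightarrow> range X \<subseteq> sets borel \<Longrightarrow> (\<lambda>i::nat. F (X i)) sums F (\<Union>i. X i)"
    and X: "X \<in> sets borel"
  shows "F X = 0"
proof -
  let ?G = "range (\<lambda>y. {..y::real})"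
  have eq: "sets (borel :: real measure) = sigma_sets UNIV ?G"
    by (subst borel_eq_atMost) simp
  have "Int_stable ?G" "?G \<subseteq> Pow UNIV" by (auto simp: Int_stable_def)
  then show ?thesis
    using X unfolding eq
  proof (induction rule: sigma_sets_induct_disjoint)
    case (basic A)
    then show ?case using atMost by auto
  next
    case empty then show ?case by (rule emp)
  next
    case (compl A) then show ?case using assms(3)[of A] by (simp add: eq Compl_eq_Diff_UNIV)
  next
    case (union A)
    have "(\<lambda>i::nat. 0::real) sums F (\<Union>i. A i)"
      using assms(4)[of A] union by (simp add: eq)
    then show ?case using sums_unique2 sums_zero by blast
  qed
qed

lemma integrable_indicator_times:
  fixes f :: "real \<Rightarrow> real"
  assumes f: "integrable M f" and X: "X \<inter> space M \<in> sets M"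
  shows "integrable M (\<lambda>x. indicator X x * f x)"
proof (rule Bochner_Integration.integrable_bound[OF f])
  show "(\<lambda>x. indicator X x * f x) \<in> borel_measurable M"
    using f X by (intro borel_measurable_times borel_measurable_indicator') (auto simp: vimage_def Int_def conj_commute)
qed (auto simp: indicator_def)

lemma sums_integral_indicator:
  fixes f :: "real \<Rightarrow> real"
  assumes f: "integrable M f" and X: "disjoint_family X" "\<And>i::nat. X i \<inter> space M \<in> sets M"
  shows "(\<lambda>i. \<integral>x. indicator (X i) x * f x \<partial>M) sums (\<integral>x. indicator (\<Union>i. X i) x * f x \<partial>M)"
proof -
  have int: "integrable M (\<lambda>x. indicator (X i) x * f x)" for i
    by (rule integrable_indicator_times[OF f X(2)])
  then have m: "(\<lambda>x. indicator (X i) x * f x) \<in> borel_measurable M" for i by auto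
  have "(\<lambda>n. \<integral>x. (\<Sum>i<n. indicator (X i) x * f x) \<partial>M) \<longlonglongrightarrow> (\<integral>x. indicator (\<Union>i. X i) x * f x \<partial>M)"
  proof (rule integral_dominated_convergence[where w="\<lambda>x. norm (f x)"])
    have eq: "(\<Sum>i<n. indicator (X i) x * f x) = indicator (\<Union>i<n. X i) x * f x" for n x
      using X(1) by (subst indicator_UN_disjoint) (auto simp: sum_distrib_right disjoint_family_on_def)
    have lim: "(\<lambda>n. indicator (\<Union>i<n. X i) x * f x) \<longlonglongrightarrow> indicator (\<Union>i. X i) x * f x" for x
      by (intro tendsto_mult tendsto_const LIMSEQ_indicator_UN)
    show "AE x in M. (\<lambda>n. \<Sum>i<n. indicator (X i) x * f x) \<longlonglongrightarrow> indicator (\<Union>i. X i) x * f x"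
      unfolding eq using lim by auto
    show "AE x in M. norm (\<Sum>i<n. indicator (X i) x * f x) \<le> norm (f x)" for n
      unfolding eq by (auto simp: indicator_def)
    show "(\<lambda>x. indicator (\<Union>i. X i) x * f x) \<in> borel_measurable M"
    proof (rule borel_measurable_LIMSEQ_real)
      show "(\<lambda>n. \<Sum>i<n. indicator (X i) x * f x) \<longlonglongrightarrow> indicator (\<Union>i. X i) x * f x" for x
        unfolding eq by (rule lim)
    qed (intro borel_measurable_sum m)
    show "integrable M (\<lambda>x. norm (f x))" using f by (rule integrable_norm)
  qed (intro borel_measurable_sum m)
  then show ?thesis
    unfolding sums_def Bochner_Integration.integral_sum[OF int] .
qed

text \<open>f is only Lebesgue measurable while the hypothesis tests Borel sets. A Borel version of
  f supplies the test sets where it is positive and where it is negative; the integrals over them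
  are those of the positive and the negative part of f.\<close>

lemma AE_zero_from_borel:
  fixes f :: "real \<Rightarrow> real"
  assumes f: "integrable (lebesgue_on {a<..<b}) f"
    and z: "\<And>X. X \<in> sets borel \<Longrightarrow> (\<integral>x. indicator X x * f x \<partial>lebesgue_on {a<..<b}) = 0"
  shows "AE x in lebesgue_on {a<..<b}. f x = 0"
proof -
  let ?N = "lebesgue_on {a<..<b}"
  have fm: "f \<in> borel_measurable ?N" using f by auto
  have "(\<lambda>x. if x \<in> {a<..<b} then f x else 0) \<in> borel_measurable lebesgue"
    by (rule borel_measurable_if_I[OF fm]) simp
  then obtain g where g: "g \<in> borel_measurable lborel"
      "AE x in lborel. (if x \<in> {a<..<b} then f x else 0) = g x"
    using completion_ex_borel_measurable_real by blast
  have "AE x in lebesgue. (if x \<in> {a<..<b} then f x else 0) = g x"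
    using g(2) by (rule AE_completion)
  then have eq: "AE x in ?N. f x = g x"
    by (subst AE_restrict_space_iff) auto
  have gb: "g \<in> borel_measurable borel" using g(1) by simp
  have "AE x in ?N. max (f x) 0 = 0"
  proof -
    have X: "{x. 0 < g x} \<in> sets borel" using gb by measurable
    have "(\<integral>x. max (f x) 0 \<partial>?N) = (\<integral>x. indicator {x. 0 < g x} x * f x \<partial>?N)"
    proof (rule integral_cong_AE)
      have "{x. 0 < g x} \<in> sets lebesgue" using X by auto
      then have "{x. 0 < g x} \<inter> space ?N \<in> sets ?N" by (auto simp: sets_restrict_space)
      then show "(\<lambda>x. indicator {x. 0 < g x} x * f x) \<in> borel_measurable ?N"
        using fm by (intro borel_measurable_times borel_measurable_indicator') (auto simp: vimage_def Int_def conj_commute)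
    qed (use fm eq in \<open>auto simp: indicator_def elim!: eventually_mono\<close>)
    then have "(\<integral>x. max (f x) 0 \<partial>?N) = 0" using z[OF X] by simp
    then show ?thesis
      by (subst (asm) integral_nonneg_eq_0_iff_AE) (use f in auto)
  qed
  moreover have "AE x in ?N. max (- f x) 0 = 0"
  proof -
    have X: "{x. g x < 0} \<in> sets borel" using gb by measurable
    have "(\<integral>x. max (- f x) 0 \<partial>?N) = (\<integral>x. - (indicator {x. g x < 0} x * f x) \<partial>?N)"
    proof (rule integral_cong_AE)
      have "{x. g x < 0} \<in> sets lebesgue" using X by auto
      then have "{x. g x < 0} \<inter> space ?N \<in> sets ?N" by (auto simp: sets_restrict_space)
      then show "(\<lambda>x. - (indicator {x. g x < 0} x * f x)) \<in> borel_measurable ?N"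
        using fm by (intro borel_measurable_uminus borel_measurable_times borel_measurable_indicator') (auto simp: vimage_def Int_def conj_commute)
    qed (use fm eq in \<open>auto simp: indicator_def elim!: eventually_mono\<close>)
    then have "(\<integral>x. max (- f x) 0 \<partial>?N) = 0" using z[OF X] by simp
    then show ?thesis
      by (subst (asm) integral_nonneg_eq_0_iff_AE) (use f in auto)
  qed
  ultimately show ?thesis by eventually_elim auto
qed

text \<open>Zero mean makes the primitive that is 0 at a return to 0 at b, so it vanishes on both
  sides of [c, d].\<close>

lemma test_fun_primitive:
  fixes \<phi> :: "real \<Rightarrow> real"
  assumes cont: "continuous_on UNIV \<phi>" and supp: "\<And>x. x \<notin> {c..d} \<Longrightarrow> \<phi> x = 0"
    and cd: "a < c" "d < b" "a < b" and int: "(\<integral>x. \<phi> x \<partial>lebesgue_on {a<..<b}) = 0"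
  obtains \<psi> where "test_fun a b \<psi>" "deriv \<psi> = \<phi>"
proof -
  obtain F where F: "\<And>x. (F has_vector_derivative \<phi> x) (at x)"
    using einterval_antiderivative[of "-\<infinity>" "\<infinity>" \<phi>] cont by (auto simp: continuous_on_eq_continuous_at)
  have Fd: "(F has_real_derivative \<phi> x) (at x)" for x
    using F[of x] by (simp add: has_real_derivative_iff_has_vector_derivative)
  define \<psi> where "\<psi> x = F x - F a" for x
  have \<psi>: "(\<psi> has_real_derivative \<phi> x) (at x)" for x
    unfolding \<psi>_def by (auto intro!: derivative_eq_intros Fd)
  have d: "deriv \<psi> = \<phi>" using \<psi> by (auto intro: DERIV_imp_deriv)
  have iphi: "integrable (lebesgue_on {a<..<b}) \<phi>"
  proof -
    obtain B where "\<And>x. a \<le> x \<Longrightarrow> x \<le> b \<Longrightarrow> \<bar>\<phi> x\<bar> \<le> B"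
      using continuous_bounded_Ioo[OF continuous_on_subset[OF cont subset_UNIV]] by blast
    then show ?thesis
      by (intro integrable_lebesgue_on_bounded[where B=B] borel_measurable_lebesgue_on_continuous[OF cont]) auto
  qed
  have "(\<phi> has_integral (F b - F a)) {a..b}"
    by (rule fundamental_theorem_of_calculus) (use cd F in \<open>auto intro: has_vector_derivative_at_within\<close>)
  then have "integral {a<..<b} \<phi> = F b - F a"
    by (simp add: has_integral_Icc_iff_Ioo integral_unique)
  then have Fab: "F b = F a"
    using int iphi by (simp add: lebesgue_integral_eq_integral)
  have l: "\<psi> x = 0" if "x < c" for x
  proof -
    have "\<exists>k. \<forall>x\<in>{..<c}. \<psi> x = k"
    proof (rule has_field_derivative_zero_constant)
      fix x assume x: "x \<in> {..<c}"
      then have "\<phi> x = 0" by (intro supp) auto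
      then show "(\<psi> has_real_derivative 0) (at x within {..<c})"
        using \<psi>[of x] by (auto intro: has_field_derivative_at_within)
    qed simp
    then obtain k where k: "\<And>x. x \<in> {..<c} \<Longrightarrow> \<psi> x = k" by blast
    show ?thesis using k[of x] k[of a] that cd by (simp add: \<psi>_def)
  qed
  have r: "\<psi> x = 0" if "d < x" for x
  proof -
    have "\<exists>k. \<forall>x\<in>{d<..}. \<psi> x = k"
    proof (rule has_field_derivative_zero_constant)
      fix x assume x: "x \<in> {d<..}"
      then have "\<phi> x = 0" by (intro supp) auto
      then show "(\<psi> has_real_derivative 0) (at x within {d<..})"
        using \<psi>[of x] by (auto intro: has_field_derivative_at_within)
    qed simp
    then obtain k where k: "\<And>x. x \<in> {d<..} \<Longrightarrow> \<psi> x = k" by blast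
    show ?thesis using k[of x] k[of b] that cd Fab by (simp add: \<psi>_def)
  qed
  have "{x. \<psi> x \<noteq> 0} \<subseteq> {c..d}" using l r by force
  then have "closure {x. \<psi> x \<noteq> 0} \<subseteq> {c..d}" by (rule closure_minimal) simp
  then have "test_fun a b \<psi>"
    unfolding test_fun_def C1_differentiable_on_def using cd \<psi> cont
    by (auto simp: has_real_derivative_iff_has_vector_derivative intro!: exI[of _ \<phi>])
  then show ?thesis using d that by blast
qed

text \<open>Weighted differences of continuous cut-offs with zero mean are derivatives of test
  functions, so the integral of h against a cut-off is a fixed multiple c of the mass of that
  cut-off. Cut-offs converge to indicators of intervals; hence h - c has integral zero over
  intervals, and then over all Borel sets.\<close>

lemma du_Bois_Reymond:
  fixes h :: "real \<Rightarrow> real"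
  assumes ab: "a < b" and h: "integrable (lebesgue_on {a<..<b}) h"
    and z: "\<And>\<psi>. test_fun a b \<psi> \<Longrightarrow> (\<integral>x. h x * deriv \<psi> x \<partial>lebesgue_on {a<..<b}) = 0"
  obtains c where "AE x in lebesgue_on {a<..<b}. h x = c"
proof -
  let ?N = "lebesgue_on {a<..<b}"
  interpret N: finite_measure ?N by (rule finite_measure_lebesgue_on_Ioo)
  have hm: "h \<in> borel_measurable ?N" using h by auto
  \<comment> \<open>Trapezoids: \<open>e p q n\<close> vanishes outside [p + 1/(n+1), q - 1/(n+1)],
    which keeps the support inside the open interval, and equals 1 at distance at least 2/(n+1) from
    both ends.\<close>
  define e where "e p q n x = min 1 (max 0 (real (Suc n) * min (x - p) (q - x) - 1))" for p q n and x :: real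
  have e_cont: "continuous_on UNIV (e p q n)" for p q n
    unfolding e_def by (intro continuous_intros)
  have e_m: "e p q n \<in> borel_measurable ?N" for p q n
    by (rule borel_measurable_lebesgue_on_continuous[OF e_cont])
  have e_01: "0 \<le> e p q n x" "e p q n x \<le> 1" for p q n x by (auto simp: e_def)
  have e_int: "integrable ?N (e p q n)" for p q n
    by (rule integrable_lebesgue_on_bounded[OF e_m, where B=1]) (use e_01 in auto)
  have e_supp: "e p q n x = 0" if "x \<notin> {p + 1 / Suc n..q - 1 / Suc n}" for p q n x
  proof -
    have "x - p < 1 / Suc n \<or> q - x < 1 / Suc n" using that by auto
    then have "min (x - p) (q - x) < 1 / Suc n" by auto
    then have "real (Suc n) * min (x - p) (q - x) < 1"
      by (simp add: field_simps)
    then show ?thesis by (simp add: e_def)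
  qed
  have e_lim: "(\<lambda>n. e p q n x) \<longlonglongrightarrow> indicator {p<..<q} x" for p q x
  proof (cases "p < x \<and> x < q")
    case True
    define r where "r = min (x - p) (q - x)"
    have r: "0 < r" using True by (auto simp: r_def)
    obtain k :: nat where k: "2 / r < k" using reals_Archimedean2 by blast
    have "e p q n x = 1" if "n \<ge> k" for n
    proof -
      have "2 / r < real (Suc n)" using k that by linarith
      then have "2 < real (Suc n) * r" using r by (simp add: field_simps)
      then show ?thesis unfolding e_def r_def[symmetric] by simp
    qed
    then have "eventually (\<lambda>n. e p q n x = 1) sequentially"
      by (auto simp: eventually_sequentially)
    then show ?thesis using True by (simp add: tendsto_eventually)
  next
    case False
    have "e p q n x = 0" for n
    proof -
      have "min (x - p) (q - x) \<le> 0" using False by auto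
      then have "real (Suc n) * min (x - p) (q - x) \<le> 0" by (simp add: mult_nonneg_nonpos)
      then show ?thesis by (simp add: e_def)
    qed
    then show ?thesis using False by auto
  qed
  have lim: "(\<lambda>n. \<integral>x. f x * e p q n x \<partial>?N) \<longlonglongrightarrow> (\<integral>x. f x * indicator {p<..<q} x \<partial>?N)"
    if f: "integrable ?N f" for f p q
  proof (rule integral_dominated_convergence[where w="\<lambda>x. norm (f x)"])
    have fm: "f \<in> borel_measurable ?N" using f by auto
    show "(\<lambda>x. f x * e p q n x) \<in> borel_measurable ?N" for n
      using fm e_m by measurable
    have "(\<lambda>x. indicator {p<..<q} x :: real) \<in> borel_measurable ?N"
      by (rule borel_measurable_LIMSEQ_real[OF e_lim e_m])
    then show "(\<lambda>x. f x * indicator {p<..<q} x) \<in> borel_measurable ?N" using fm by measurable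
    show "AE x in ?N. (\<lambda>n. f x * e p q n x) \<longlonglongrightarrow> f x * indicator {p<..<q} x"
      by (intro AE_I2 tendsto_mult tendsto_const e_lim)
    show "AE x in ?N. norm (f x * e p q n x) \<le> norm (f x)" for n
      using e_01[of p q n] by (auto simp: abs_mult intro!: AE_I2 mult_left_le)
  qed (use f in auto)
  have he: "integrable ?N (\<lambda>x. h x * e p q n x)" for p q n
    by (rule Bochner_Integration.integrable_bound[OF h])
      (use hm e_m e_01 in \<open>auto simp: abs_mult intro!: AE_I2 mult_left_le\<close>)
  define p0 q0 where "p0 = (2 * a + b) / 3" "q0 = (a + 2 * b) / 3"
  have pq0: "a < p0" "p0 < q0" "q0 < b" using ab by (auto simp: p0_q0_def)
  have meas: "(\<integral>x. 1 * indicator {p<..<q} x \<partial>?N) = q - p" if "a \<le> p" "p < q" "q \<le> b" for p q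
  proof -
    have "{p<..<q} \<subseteq> {a<..<b}" using that by auto
    then show ?thesis using that
      by (simp add: integral_restrict_space measure_restrict_space Int_absorb2)
  qed
  have "(\<lambda>n. \<integral>x. e p0 q0 n x \<partial>?N) \<longlonglongrightarrow> q0 - p0"
    using lim[of "\<lambda>_. 1" p0 q0] meas[of p0 q0] pq0 by auto
  from order_tendstoD(1)[OF this, of 0] obtain n0 where n0: "0 < (\<integral>x. e p0 q0 n0 x \<partial>?N)"
    using pq0 by (auto simp: eventually_sequentially)
  \<comment> \<open>A reference cut-off of positive mass; the mean of h with weight
    \<open>e0\<close> is the candidate for the constant.\<close>
  define e0 where "e0 = e p0 q0 n0"
  define c where "c = (\<integral>x. h x * e0 x \<partial>?N) / (\<integral>x. e0 x \<partial>?N)"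
  have key: "(\<integral>x. h x * e p q n x \<partial>?N) = c * (\<integral>x. e p q n x \<partial>?N)" if pq: "a \<le> p" "p < q" "q \<le> b" for p q n
  proof -
    define k where "k = (\<integral>x. e p q n x \<partial>?N) / (\<integral>x. e0 x \<partial>?N)"
    define \<phi> where "\<phi> x = e p q n x - k * e0 x" for x
    define N where "N = max n n0"
    obtain \<psi> where "test_fun a b \<psi>" "deriv \<psi> = \<phi>"
    proof (rule test_fun_primitive)
      show "continuous_on UNIV \<phi>" unfolding \<phi>_def e0_def by (intro continuous_intros e_cont)
      show "(\<integral>x. \<phi> x \<partial>?N) = 0"
        unfolding \<phi>_def using e_int n0 by (simp add: e0_def k_def)
      show "\<phi> x = 0" if "x \<notin> {a + 1 / Suc N..b - 1 / Suc N}" for x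
      proof -
        have "1 / Suc N \<le> 1 / Suc n" "1 / Suc N \<le> 1 / Suc n0" by (auto simp: N_def field_simps)
        then have "x \<notin> {p + 1 / Suc n..q - 1 / Suc n}" "x \<notin> {p0 + 1 / Suc n0..q0 - 1 / Suc n0}"
          using that pq pq0 by auto
        then show ?thesis using e_supp by (simp add: \<phi>_def e0_def)
      qed
    qed (use ab in auto)
    from z[OF this(1)] this(2) have "0 = (\<integral>x. h x * e p q n x - k * (h x * e0 x) \<partial>?N)"
      by (simp add: \<phi>_def algebra_simps)
    also have "\<dots> = (\<integral>x. h x * e p q n x \<partial>?N) - k * (\<integral>x. h x * e0 x \<partial>?N)"
      using he by (simp add: e0_def)
    finally show ?thesis by (simp add: c_def k_def)
  qed
  have hc: "integrable ?N (\<lambda>x. h x - c)" using h by simp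
  have Ioo: "(\<integral>x. indicator {p<..<q} x * (h x - c) \<partial>?N) = 0" if pq: "a \<le> p" "p < q" "q \<le> b" for p q
  proof -
    have "(\<lambda>n. \<integral>x. (h x - c) * e p q n x \<partial>?N) \<longlonglongrightarrow> (\<integral>x. (h x - c) * indicator {p<..<q} x \<partial>?N)"
      by (rule lim[OF hc])
    moreover have "(\<integral>x. (h x - c) * e p q n x \<partial>?N) = 0" for n
      using key[OF pq, of n] he e_int by (simp add: left_diff_distrib)
    ultimately show ?thesis by (simp add: LIMSEQ_const_iff mult.commute)
  qed
  have "AE x in ?N. h x - c = 0"
  proof (rule AE_zero_from_borel[OF hc])
    fix X :: "real set" assume X: "X \<in> sets borel"
    have sN: "Y \<inter> space ?N \<in> sets ?N" if "Y \<in> sets borel" for Y :: "real set"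
      using that by (auto simp: sets_restrict_space)
    show "(\<integral>x. indicator X x * (h x - c) \<partial>?N) = 0"
      using X
    proof (rule borel_zero_from_atMost[rotated -1, where F="\<lambda>X. \<integral>x. indicator X x * (h x - c) \<partial>?N"])
      fix y :: real
      \<comment> \<open>Single points are null, so the half-line can be replaced by the open
        interval (a, min y b), on which the integral is already known to vanish.\<close>
      have "AE x in lebesgue. x \<noteq> y" by (intro AE_completion AE_lborel_singleton)
      then have ne: "AE x in ?N. x \<noteq> y" by (subst AE_restrict_space_iff) auto
      have "integrable ?N (\<lambda>x. indicator Y x * (h x - c))" if "Y \<in> sets borel" for Y
        by (rule integrable_indicator_times[OF hc sN[OF that]])
      then have m: "(\<lambda>x. indicator Y x * (h x - c)) \<in> borel_measurable ?N" if "Y \<in> sets borel" for Y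
        using that by auto
      have eq: "(\<integral>x. indicator {..y} x * (h x - c) \<partial>?N) = (\<integral>x. indicator {a<..<min y b} x * (h x - c) \<partial>?N)"
        using ne by (intro integral_cong_AE m) (auto simp: indicator_def AE_restrict_space_iff elim!: eventually_mono)
      show "(\<integral>x. indicator {..y} x * (h x - c) \<partial>?N) = 0"
      proof (cases "a < y")
        case True then show ?thesis unfolding eq using ab by (intro Ioo) auto
      next
        case False
        then have "{a<..<min y b} = {}" by auto
        then show ?thesis unfolding eq by simp
      qed
    next
      fix X :: "real set" assume X: "X \<in> sets borel" "(\<integral>x. indicator X x * (h x - c) \<partial>?N) = 0"
      have "(\<integral>x. indicator (- X) x * (h x - c) \<partial>?N) = (\<integral>x. indicator {a<..<b} x * (h x - c) - indicator X x * (h x - c) \<partial>?N)"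
        by (intro Bochner_Integration.integral_cong) (auto simp: indicator_def)
      also have "\<dots> = (\<integral>x. indicator {a<..<b} x * (h x - c) \<partial>?N) - (\<integral>x. indicator X x * (h x - c) \<partial>?N)"
      proof (rule Bochner_Integration.integral_diff)
        have "integrable ?N (\<lambda>x. indicator Y x * (h x - c))" if "Y \<in> sets borel" for Y
          by (rule integrable_indicator_times[OF hc sN[OF that]])
        then show "integrable ?N (\<lambda>x. indicator {a<..<b} x * (h x - c))" "integrable ?N (\<lambda>x. indicator X x * (h x - c))"
          using X by auto
      qed
      finally show "(\<integral>x. indicator (- X) x * (h x - c) \<partial>?N) = 0" using X Ioo[of a b] ab by simp
    next
      fix X :: "nat \<Rightarrow> real set" assume "disjoint_family X" "range X \<subseteq> sets borel"
      then show "(\<lambda>i. \<integral>x. indicator (X i) x * (h x - c) \<partial>?N) sums (\<integral>x. indicator (\<Union>i. X i) x * (h x - c) \<partial>?N)"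
        by (intro sums_integral_indicator hc sN) auto
    qed simp
  qed
  then show ?thesis using that[of c] by auto
qed

section \<open>Distributional derivatives of functions of bounded variation\<close>

text \<open>The distribution function of the signed measure f M. M is a parameter so that it can be
  Lebesgue measure with density f as well as a singular part with f = 1.\<close>

definition cdf_on :: "real measure \<Rightarrow> (real \<Rightarrow> real) \<Rightarrow> real \<Rightarrow> real" where
  "cdf_on M f y = (\<integral>x. indicator {..y} x * f x \<partial>M)"

lemma tendsto_cdf_on:
  fixes f :: "real \<Rightarrow> real" and Y :: "nat \<Rightarrow> real"
  assumes f: "integrable M f" and id: "(\<lambda>x. x) \<in> borel_measurable M"
    and lim: "\<And>x. x \<in> space M \<Longrightarrow> (\<lambda>n. indicator {..Y n} x :: real) \<longlonglongrightarrow> indicator A x" and A: "A \<in> sets borel"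
  shows "(\<lambda>n. cdf_on M f (Y n)) \<longlonglongrightarrow> (\<integral>x. indicator A x * f x \<partial>M)"
  unfolding cdf_on_def
proof (rule integral_dominated_convergence[where w="\<lambda>x. norm (f x)"])
  have s: "B \<inter> space M \<in> sets M" if "B \<in> sets borel" for B
    using measurable_sets[OF id that] by (simp add: vimage_def Int_def)
  show "(\<lambda>x. indicator A x * f x) \<in> borel_measurable M" "(\<lambda>x. indicator {..Y n} x * f x) \<in> borel_measurable M" for n
    using integrable_indicator_times[OF f s] A by auto
  show "AE x in M. (\<lambda>n. indicator {..Y n} x * f x) \<longlonglongrightarrow> indicator A x * f x"
    using lim by (intro AE_I2 tendsto_mult tendsto_const) auto
  show "AE x in M. norm (indicator {..Y n} x * f x) \<le> norm (f x)" for n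
    by (auto simp: indicator_def)
qed (use f in auto)

lemma cdf_on_at_right:
  fixes f :: "real \<Rightarrow> real"
  assumes f: "integrable M f" and id: "(\<lambda>x. x) \<in> borel_measurable M"
  shows "(cdf_on M f \<longlongrightarrow> cdf_on M f y) (at_right y)"
proof (rule tendsto_at_right_sequentially[of y "y + 1"])
  fix Y :: "nat \<Rightarrow> real" assume Y: "\<And>n. y < Y n" "Y \<longlonglongrightarrow> y"
  have "(\<lambda>n. indicator {..Y n} x :: real) \<longlonglongrightarrow> indicator {..y} x" for x
  proof (cases "x \<le> y")
    case True then show ?thesis using Y(1) by (auto simp: indicator_def intro!: tendsto_eventually always_eventually) (meson less_le_trans not_less order_trans less_imp_le)
  next
    case False
    then have "eventually (\<lambda>n. Y n < x) sequentially" using order_tendstoD(2)[OF Y(2), of x] by auto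
    then have "eventually (\<lambda>n. indicator {..Y n} x = (indicator {..y} x :: real)) sequentially"
      by eventually_elim (use False in auto)
    then show ?thesis by (rule tendsto_eventually)
  qed
  then show "(\<lambda>n. cdf_on M f (Y n)) \<longlonglongrightarrow> cdf_on M f y"
    using tendsto_cdf_on[OF f id, of Y "{..y}"] by (simp add: cdf_on_def)
qed simp

lemma cdf_on_at_left:
  fixes f :: "real \<Rightarrow> real"
  assumes f: "integrable M f" and id: "(\<lambda>x. x) \<in> borel_measurable M" and sM: "space M = {a<..<b}" and ab: "a < b"
  shows "(cdf_on M f \<longlongrightarrow> (\<integral>x. f x \<partial>M)) (at_left b)"
proof (rule tendsto_at_left_sequentially[of "b - 1"])
  fix Y :: "nat \<Rightarrow> real" assume Y: "\<And>n. Y n < b" "Y \<longlonglongrightarrow> b"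
  have "(\<lambda>n. indicator {..Y n} x :: real) \<longlonglongrightarrow> indicator {..<b} x" if "x \<in> space M" for x
  proof -
    have "x < b" using that sM by auto
    then have "eventually (\<lambda>n. x < Y n) sequentially" using order_tendstoD(1)[OF Y(2), of x] by auto
    then have "eventually (\<lambda>n. indicator {..Y n} x = (indicator {..<b} x :: real)) sequentially"
      by eventually_elim (use \<open>x < b\<close> in auto)
    then show ?thesis by (rule tendsto_eventually)
  qed
  then have "(\<lambda>n. cdf_on M f (Y n)) \<longlonglongrightarrow> (\<integral>x. indicator {..<b} x * f x \<partial>M)"
    by (intro tendsto_cdf_on[OF f id]) auto
  also have "(\<integral>x. indicator {..<b} x * f x \<partial>M) = (\<integral>x. f x \<partial>M)"
    by (intro Bochner_Integration.integral_cong) (auto simp: sM)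
  finally show "(\<lambda>n. cdf_on M f (Y n)) \<longlonglongrightarrow> (\<integral>x. f x \<partial>M)" .
qed simp

lemma cdf_on_le_left:
  assumes "space M = {a<..<b}" "y \<le> a" shows "cdf_on M f y = 0"
proof -
  have "cdf_on M f y = (\<integral>x. 0 \<partial>M)" unfolding cdf_on_def
    by (intro Bochner_Integration.integral_cong) (use assms in auto)
  then show ?thesis by simp
qed

lemma cdf_on_ge_right:
  assumes "space M = {a<..<b}" "b \<le> y" shows "cdf_on M f y = (\<integral>x. f x \<partial>M)"
  unfolding cdf_on_def by (intro Bochner_Integration.integral_cong) (use assms in auto)

lemma integrable_cdf_on:
  fixes f :: "real \<Rightarrow> real"
  assumes M: "sigma_finite_measure M" and id: "(\<lambda>x. x) \<in> borel_measurable M" and f: "integrable M f"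
  shows "integrable (lebesgue_on {a<..<b}) (cdf_on M f)"
proof (rule integrable_lebesgue_on_bounded)
  interpret M: sigma_finite_measure M by fact
  note [measurable] = id
  have [measurable]: "(\<lambda>x. x) \<in> borel_measurable (lebesgue_on {a<..<b})"
    by (rule borel_measurable_lebesgue_on_continuous) (intro continuous_intros)
  have [measurable]: "f \<in> borel_measurable M" using f by auto
  have "Measurable.pred (lebesgue_on {a<..<b} \<Otimes>\<^sub>M M) (\<lambda>p. snd p \<le> fst p)" by measurable
  then have "(\<lambda>(y, x). if x \<le> y then f x else 0) \<in> borel_measurable (lebesgue_on {a<..<b} \<Otimes>\<^sub>M M)"
    unfolding split_beta by measurable
  then have "(\<lambda>y. \<integral>x. (if x \<le> y then f x else 0) \<partial>M) \<in> borel_measurable (lebesgue_on {a<..<b})"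
    by (rule M.borel_measurable_lebesgue_integral)
  moreover have "(if x \<le> y then f x else 0) = indicator {..y} x * f x" for x y by auto
  ultimately show "cdf_on M f \<in> borel_measurable (lebesgue_on {a<..<b})"
    unfolding cdf_on_def[abs_def] by simp
  have s: "{..y} \<inter> space M \<in> sets M" for y
    using measurable_sets[OF id, of "{..y}"] by (simp add: vimage_def Int_def)
  show "\<bar>cdf_on M f y\<bar> \<le> (\<integral>x. \<bar>f x\<bar> \<partial>M)" for y
    unfolding cdf_on_def
    by (rule order_trans[OF integral_abs_bound
          integral_mono[OF integrable_abs[OF integrable_indicator_times[OF f s]] integrable_abs[OF f]]])
       (auto simp: indicator_def)
qed

lemma finite_borel_measure_onD:
  assumes "finite_borel_measure_on a b \<mu>"
  shows "finite_measure \<mu>" "space \<mu> = {a<..<b}" "(\<lambda>x. x) \<in> borel_measurable \<mu>"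
    "sigma_finite_measure \<mu>" "integrable \<mu> (\<lambda>x. 1 :: real)" "X \<in> sets \<mu> \<longleftrightarrow> X \<in> sets borel \<and> X \<subseteq> {a<..<b}"
proof -
  have s: "sets \<mu> = sets (restrict_space borel {a<..<b})" and f: "finite_measure \<mu>"
    using assms by (auto simp: finite_borel_measure_on_def)
  interpret finite_measure \<mu> by (rule f)
  show "finite_measure \<mu>" by (rule f)
  show sp: "space \<mu> = {a<..<b}" using sets_eq_imp_space_eq[OF s] by (simp add: space_restrict_space)
  have "(\<lambda>x. x) \<in> borel_measurable (restrict_space borel {a<..<b})"
    by (rule measurable_restrict_space1) simp
  then show "(\<lambda>x. x) \<in> borel_measurable \<mu>" using measurable_cong_sets[OF s refl] by blast
  show "sigma_finite_measure \<mu>" by unfold_locales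
  show "integrable \<mu> (\<lambda>x. 1 :: real)" by simp
  show "X \<in> sets \<mu> \<longleftrightarrow> X \<in> sets borel \<and> X \<subseteq> {a<..<b}"
    unfolding s by (subst sets_restrict_space_iff) auto
qed

lemma id_borel_measurable_lebesgue_on: "(\<lambda>x::real. x) \<in> borel_measurable (lebesgue_on S)"
  by (rule borel_measurable_lebesgue_on_continuous[OF continuous_on_id])

text \<open>The right continuous representative of \<open>w\<close>, up to an additive constant.\<close>

definition bv_cdf :: "real \<Rightarrow> real \<Rightarrow> (real \<Rightarrow> real) \<Rightarrow> real measure \<Rightarrow> real measure \<Rightarrow> real \<Rightarrow> real" where
  "bv_cdf a b f \<sigma> \<tau> y = cdf_on (lebesgue_on {a<..<b}) f y + cdf_on \<sigma> (\<lambda>_. 1) y - cdf_on \<tau> (\<lambda>_. 1) y"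

lemma sigma_finite_lebesgue_on_Ioo: "sigma_finite_measure (lebesgue_on {a<..<b::real})"
  using finite_measure_lebesgue_on_Ioo finite_measure.axioms(1) by blast

lemma integrable_times_continuous:
  fixes f g :: "real \<Rightarrow> real"
  assumes f: "integrable (lebesgue_on {a<..<b}) f" and g: "continuous_on UNIV g"
  shows "integrable (lebesgue_on {a<..<b}) (\<lambda>x. f x * g x)"
proof -
  obtain B where B: "0 < B" "\<And>x. a \<le> x \<Longrightarrow> x \<le> b \<Longrightarrow> \<bar>g x\<bar> \<le> B"
    using continuous_bounded_Ioo[OF continuous_on_subset[OF g subset_UNIV]] by blast
  have "integrable (lebesgue_on {a<..<b}) (\<lambda>x. f x * B)" using f by simp
  then show ?thesis
  proof (rule Bochner_Integration.integrable_bound)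
    show "(\<lambda>x. f x * g x) \<in> borel_measurable (lebesgue_on {a<..<b})"
      using f borel_measurable_lebesgue_on_continuous[OF g] by (intro borel_measurable_times) auto
  qed (use B in \<open>auto simp: abs_mult intro!: AE_I2 mult_left_mono\<close>)
qed

lemma integral_cdf_test_fun:
  assumes \<psi>: "test_fun a b \<psi>" and M: "sigma_finite_measure M" and sM: "space M = {a<..<b}"
    and id: "(\<lambda>x. x) \<in> borel_measurable M" and f: "integrable M f"
  shows "(\<integral>y. cdf_on M f y * deriv \<psi> y \<partial>lebesgue_on {a<..<b}) = - (\<integral>x. f x * \<psi> x \<partial>M)"
    and "integrable (lebesgue_on {a<..<b}) (\<lambda>y. cdf_on M f y * deriv \<psi> y)"
  using integral_test_fun[OF assms]
    integrable_times_continuous[OF integrable_cdf_on[OF M id f] test_funD(2)[OF \<psi>]]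
  by (simp_all add: cdf_on_def)

text \<open>\<open>w - bv_cdf\<close> is annihilated by the derivatives of all test functions,
  because integrating the three distribution functions by parts reproduces the right-hand side of
  \<open>bv_decomp\<close>. So du Bois-Reymond applies.\<close>

lemma bv_decomp_repr:
  assumes ab: "a < b" and w: "L1_on a b w" and d: "bv_decomp a b w f \<sigma> \<tau>"
  obtains c where "AE y in lebesgue_on {a<..<b}. w y = c + bv_cdf a b f \<sigma> \<tau> y"
proof -
  let ?N = "lebesgue_on {a<..<b}"
  have f: "integrable ?N f" and s: "finite_borel_measure_on a b \<sigma>" and t: "finite_borel_measure_on a b \<tau>"
    using d by (auto simp: bv_decomp_def L1_on_def)
  note sD = finite_borel_measure_onD[OF s] and tD = finite_borel_measure_onD[OF t]
  note fD = sigma_finite_lebesgue_on_Ioo[of a b] id_borel_measurable_lebesgue_on[of "{a<..<b}"]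
  have wI: "integrable ?N w" using w by (simp add: L1_on_def)
  have VI: "integrable ?N (bv_cdf a b f \<sigma> \<tau>)"
    unfolding bv_cdf_def[abs_def]
    by (intro Bochner_Integration.integrable_add Bochner_Integration.integrable_diff integrable_cdf_on fD f sD tD)
  obtain c where c: "AE y in ?N. w y - bv_cdf a b f \<sigma> \<tau> y = c"
  proof (rule du_Bois_Reymond[OF ab])
    show "integrable ?N (\<lambda>y. w y - bv_cdf a b f \<sigma> \<tau> y)" using wI VI by simp
    fix \<psi> assume \<psi>: "test_fun a b \<psi>"
    note F = integral_cdf_test_fun[OF \<psi> fD(1) _ fD(2) f]
    note S = integral_cdf_test_fun[OF \<psi> sD(4,2,3,5)] and T = integral_cdf_test_fun[OF \<psi> tD(4,2,3,5)]
    have wd: "integrable ?N (\<lambda>y. w y * deriv \<psi> y)"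
      by (rule integrable_times_continuous[OF wI test_funD(2)[OF \<psi>]])
    have "(\<integral>y. (w y - bv_cdf a b f \<sigma> \<tau> y) * deriv \<psi> y \<partial>?N) =
       (\<integral>y. w y * deriv \<psi> y - (cdf_on ?N f y * deriv \<psi> y + cdf_on \<sigma> (\<lambda>_. 1) y * deriv \<psi> y - cdf_on \<tau> (\<lambda>_. 1) y * deriv \<psi> y) \<partial>?N)"
      by (simp add: bv_cdf_def algebra_simps)
    also have "\<dots> = (\<integral>y. w y * deriv \<psi> y \<partial>?N) + (\<integral>x. f x * \<psi> x \<partial>?N) + (\<integral>x. \<psi> x \<partial>\<sigma>) - (\<integral>x. \<psi> x \<partial>\<tau>)"
      using wd F S T by simp
    also have "\<dots> = 0" using d \<psi> by (simp add: bv_decomp_def)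
    finally show "(\<integral>y. (w y - bv_cdf a b f \<sigma> \<tau> y) * deriv \<psi> y \<partial>?N) = 0" .
  qed
  then show ?thesis using that[of c] by (auto simp: algebra_simps)
qed


lemma bv_cdf_at_right:
  assumes "integrable (lebesgue_on {a<..<b}) f" "finite_borel_measure_on a b \<sigma>" "finite_borel_measure_on a b \<tau>"
  shows "(bv_cdf a b f \<sigma> \<tau> \<longlongrightarrow> bv_cdf a b f \<sigma> \<tau> y) (at_right y)"
  unfolding bv_cdf_def[abs_def]
  by (intro tendsto_intros cdf_on_at_right assms id_borel_measurable_lebesgue_on
      finite_borel_measure_onD(3,5)[OF assms(2)] finite_borel_measure_onD(3,5)[OF assms(3)])

lemma integral_one_finite_borel_measure:
  assumes "finite_borel_measure_on a b \<mu>"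
  shows "(\<integral>x. 1 \<partial>\<mu>) = measure \<mu> {a<..<b}"
  using finite_borel_measure_onD(2)[OF assms] by simp

lemma bv_cdf_at_left:
  assumes "integrable (lebesgue_on {a<..<b}) f" "finite_borel_measure_on a b \<sigma>" "finite_borel_measure_on a b \<tau>" "a < b"
  shows "(bv_cdf a b f \<sigma> \<tau> \<longlongrightarrow> (\<integral>x. f x \<partial>lebesgue_on {a<..<b}) + measure \<sigma> {a<..<b} - measure \<tau> {a<..<b}) (at_left b)"
  unfolding bv_cdf_def[abs_def] integral_one_finite_borel_measure[OF assms(2), symmetric] integral_one_finite_borel_measure[OF assms(3), symmetric]
  by (intro tendsto_intros cdf_on_at_left[where a=a] assms id_borel_measurable_lebesgue_on
      finite_borel_measure_onD(2,3,5)[OF assms(2)] finite_borel_measure_onD(2,3,5)[OF assms(3)]) simp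

text \<open>A set of full measure meets every interval to the right of y. In this form an identity
  that holds almost everywhere can be confronted with a one-sided limit.\<close>

lemma frequently_ae_at_right:
  assumes "AE y in lebesgue_on {a<..<b}. P y" "a \<le> y" "y < (b::real)"
  shows "\<exists>\<^sub>F x in at_right y. P x"
  unfolding frequently_def
proof (rule notI)
  assume "\<forall>\<^sub>F x in at_right y. \<not> P x"
  then obtain z where z: "y < z" "\<And>x. y < x \<Longrightarrow> x < z \<Longrightarrow> \<not> P x"
    by (auto simp: eventually_at_right_field)
  define c where "c = min z b"
  have c: "y < c" "c \<le> z" "c \<le> b" using z assms by (auto simp: c_def)
  have "AE x in lebesgue. x \<in> {a<..<b} \<longrightarrow> P x"
    using assms(1) by (subst (asm) AE_restrict_space_iff) auto
  then have "AE x in lebesgue. x \<notin> {y<..<c}"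
    by eventually_elim (use z c assms in auto)
  then have "{y<..<c} \<in> null_sets lebesgue"
    by (subst AE_iff_null_sets) auto
  then have "emeasure lborel {y<..<c} = 0" by (auto simp: null_sets_def)
  then show False using c by simp
qed

lemma frequently_ae_at_left:
  assumes "AE y in lebesgue_on {a<..<b}. P y" "a < y" "y \<le> (b::real)"
  shows "\<exists>\<^sub>F x in at_left y. P x"
  unfolding frequently_def
proof (rule notI)
  assume "\<forall>\<^sub>F x in at_left y. \<not> P x"
  then obtain z where z: "z < y" "\<And>x. z < x \<Longrightarrow> x < y \<Longrightarrow> \<not> P x"
    by (auto simp: eventually_at_left_field)
  define c where "c = max z a"
  have c: "c < y" "z \<le> c" "a \<le> c" using z assms by (auto simp: c_def)
  have "AE x in lebesgue. x \<in> {a<..<b} \<longrightarrow> P x"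
    using assms(1) by (subst (asm) AE_restrict_space_iff) auto
  then have "AE x in lebesgue. x \<notin> {c<..<y}"
    by eventually_elim (use z c assms in auto)
  then have "{c<..<y} \<in> null_sets lebesgue"
    by (subst AE_iff_null_sets) auto
  then have "emeasure lborel {c<..<y} = 0" by (auto simp: null_sets_def)
  then show False using c by simp
qed

section \<open>Uniqueness of the Lebesgue and Jordan decomposition\<close>

text \<open>Both functions represent w up to a constant, so they differ by a constant almost
  everywhere, and by right continuity everywhere on [a, b). Both vanish at a, which makes the
  constant 0. Points y \<ge> b are reached through the limit from the left at b.\<close>

lemma bv_decomp_cdf_unique:
  assumes ab: "a < b" and w: "L1_on a b w"
    and d1: "bv_decomp a b w f1 \<sigma>1 \<tau>1" and d2: "bv_decomp a b w f2 \<sigma>2 \<tau>2"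
  shows "bv_cdf a b f1 \<sigma>1 \<tau>1 y = bv_cdf a b f2 \<sigma>2 \<tau>2 y"
proof -
  let ?N = "lebesgue_on {a<..<b}"
  let ?V1 = "bv_cdf a b f1 \<sigma>1 \<tau>1" and ?V2 = "bv_cdf a b f2 \<sigma>2 \<tau>2"
  have i1: "integrable ?N f1" "finite_borel_measure_on a b \<sigma>1" "finite_borel_measure_on a b \<tau>1"
    and i2: "integrable ?N f2" "finite_borel_measure_on a b \<sigma>2" "finite_borel_measure_on a b \<tau>2"
    using d1 d2 by (auto simp: bv_decomp_def L1_on_def)
  obtain c1 where c1: "AE y in ?N. w y = c1 + ?V1 y" using bv_decomp_repr[OF ab w d1] .
  obtain c2 where c2: "AE y in ?N. w y = c2 + ?V2 y" using bv_decomp_repr[OF ab w d2] .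
  have ae: "AE y in ?N. ?V1 y - ?V2 y = c2 - c1" using c1 c2 by eventually_elim auto
  have eq: "?V1 y - ?V2 y = c2 - c1" if "a \<le> y" "y < b" for y
  proof (rule ccontr)
    assume ne: "?V1 y - ?V2 y \<noteq> c2 - c1"
    have "((\<lambda>y. ?V1 y - ?V2 y) \<longlongrightarrow> ?V1 y - ?V2 y) (at_right y)"
      by (intro tendsto_intros bv_cdf_at_right i1 i2)
    then have "\<forall>\<^sub>F x in at_right y. ?V1 x - ?V2 x \<noteq> c2 - c1"
      using ne by (rule tendsto_imp_eventually_ne)
    with frequently_ae_at_right[OF ae that] show False by (simp add: frequently_def)
  qed
  have left: "bv_cdf a b f \<sigma> \<tau> y = 0" if "y \<le> a" "finite_borel_measure_on a b \<sigma>" "finite_borel_measure_on a b \<tau>"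
    for y f \<sigma> \<tau>
    unfolding bv_cdf_def
    using that(1) finite_borel_measure_onD(2)[OF that(2)] finite_borel_measure_onD(2)[OF that(3)]
    by (simp add: cdf_on_le_left[where a=a and b=b])
  have c: "c2 - c1 = 0" using eq[of a] ab left i1 i2 by simp
  consider "y \<le> a" | "a \<le> y" "y < b" | "b \<le> y" by linarith
  then show ?thesis
  proof cases
    case 1 then show ?thesis using left i1 i2 by simp
  next
    case 2 then show ?thesis using eq[of y] c by simp
  next
    case 3
    have V: "bv_cdf a b f \<sigma> \<tau> y = (\<integral>x. f x \<partial>?N) + measure \<sigma> {a<..<b} - measure \<tau> {a<..<b}"
      if "finite_borel_measure_on a b \<sigma>" "finite_borel_measure_on a b \<tau>" for f \<sigma> \<tau>
      unfolding bv_cdf_def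
      using 3 finite_borel_measure_onD(2)[OF that(1)] finite_borel_measure_onD(2)[OF that(2)]
      by (simp add: cdf_on_ge_right[where a=a and b=b])
    have "((\<lambda>y. ?V1 y - ?V2 y) \<longlongrightarrow> ?V1 y - ?V2 y) (at_left b)"
      unfolding V[OF i1(2,3)] V[OF i2(2,3)]
      by (intro tendsto_intros bv_cdf_at_left i1 i2 ab)
    moreover have "\<forall>\<^sub>F y in at_left b. ?V1 y - ?V2 y = 0"
      using eventually_at_left_real[OF ab] by eventually_elim (use eq c in auto)
    then have "((\<lambda>y. ?V1 y - ?V2 y) \<longlongrightarrow> 0) (at_left b)" by (rule tendsto_eventually)
    ultimately have "?V1 y - ?V2 y = 0" using tendsto_unique[of "at_left b"] by force
    then show ?thesis by simp
  qed
qed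

text \<open>The difference F of the two signed measures vanishes on half-lines by assumption, and on
  the whole line because nothing lies beyond b; the \<pi>-\<lambda> induction then gives all Borel
  sets.\<close>

lemma signed_measure_eq:
  assumes i1: "integrable (lebesgue_on {a<..<b}) f1" "finite_borel_measure_on a b \<sigma>1" "finite_borel_measure_on a b \<tau>1"
    and i2: "integrable (lebesgue_on {a<..<b}) f2" "finite_borel_measure_on a b \<sigma>2" "finite_borel_measure_on a b \<tau>2"
    and eq: "\<And>y. bv_cdf a b f1 \<sigma>1 \<tau>1 y = bv_cdf a b f2 \<sigma>2 \<tau>2 y"
    and X: "X \<in> sets borel"
  shows "(\<integral>x. indicator X x * (f1 x - f2 x) \<partial>lebesgue_on {a<..<b})
     + measure \<sigma>1 (X \<inter> {a<..<b}) + measure \<tau>2 (X \<inter> {a<..<b}) = measure \<sigma>2 (X \<inter> {a<..<b}) + measure \<tau>1 (X \<inter> {a<..<b})"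
proof -
  let ?N = "lebesgue_on {a<..<b}"
  define I where "I M f X = (\<integral>x. indicator X x * f x \<partial>M)" for M and f :: "real \<Rightarrow> real" and X :: "real set"
  define F where "F X = (I ?N f1 X - I ?N f2 X) + (I \<sigma>1 (\<lambda>_. 1) X - I \<sigma>2 (\<lambda>_. 1) X) - (I \<tau>1 (\<lambda>_. 1) X - I \<tau>2 (\<lambda>_. 1) X)" for X
  \<comment> \<open>The conditions shared by the six integrals in F, so that complements and
    disjoint unions need be treated only once.\<close>
  define adm where "adm M f \<longleftrightarrow> integrable M f \<and> space M = {a<..<b} \<and> (\<forall>X\<in>sets borel. X \<inter> space M \<in> sets M)" for M and f :: "real \<Rightarrow> real"
  have admD: "integrable M f" "X \<in> sets borel \<Longrightarrow> X \<inter> space M \<in> sets M" if "adm M f" for M f X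
    using that by (auto simp: adm_def)
  have admN: "adm ?N f" if "integrable ?N f" for f
    using that by (auto simp: adm_def sets_restrict_space)
  have admS: "adm \<sigma> (\<lambda>_. 1)" if "finite_borel_measure_on a b \<sigma>" for \<sigma>
    using finite_borel_measure_onD[OF that] by (auto simp: adm_def)
  note adm = admN[OF i1(1)] admN[OF i2(1)] admS[OF i1(2)] admS[OF i1(3)] admS[OF i2(2)] admS[OF i2(3)]
  have I_compl: "I M f (- X) = I M f UNIV - I M f X" if "adm M f" "X \<in> sets borel" for M f X
  proof -
    have "I M f (- X) = (\<integral>x. indicator UNIV x * f x - indicator X x * f x \<partial>M)"
      unfolding I_def by (intro Bochner_Integration.integral_cong) (auto simp: indicator_def)
    also have "\<dots> = I M f UNIV - I M f X"
      unfolding I_def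
      by (rule Bochner_Integration.integral_diff; rule integrable_indicator_times)
        (use that in \<open>auto intro: admD\<close>)
    finally show ?thesis .
  qed
  have I_sums: "(\<lambda>i. I M f (X i)) sums I M f (\<Union>i. X i)"
    if "adm M f" "disjoint_family X" "range X \<subseteq> sets borel" for M f and X :: "nat \<Rightarrow> real set"
    unfolding I_def using that by (intro sums_integral_indicator admD) auto
  have at: "F {..y} = 0" for y
    using eq[of y] by (simp add: F_def I_def bv_cdf_def cdf_on_def)
  have UNIV0: "F UNIV = 0"
  proof -
    have "I M f UNIV = I M f {..b}" if "adm M f" for M f
      unfolding I_def using that by (intro Bochner_Integration.integral_cong) (auto simp: adm_def)
    then show ?thesis using at[of b] adm by (simp add: F_def)
  qed
  have "F X = 0"
    using X
  proof (rule borel_zero_from_atMost[rotated -1])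
    show "F {} = 0" by (simp add: F_def I_def)
    show "F (- X) = 0" if "X \<in> sets borel" "F X = 0" for X
      using that UNIV0 adm by (simp add: F_def I_compl)
    show "(\<lambda>i. F (X i)) sums F (\<Union>i. X i)" if "disjoint_family X" "range X \<subseteq> sets borel" for X :: "nat \<Rightarrow> real set"
      unfolding F_def by (intro sums_add sums_diff I_sums that adm)
  qed (rule at)
  moreover have "I \<sigma> (\<lambda>_. 1) X = measure \<sigma> (X \<inter> {a<..<b})" if "finite_borel_measure_on a b \<sigma>" for \<sigma>
    unfolding I_def using finite_borel_measure_onD(2)[OF that] by simp
  moreover have "X \<inter> space ?N \<in> sets ?N" using X by (auto simp: sets_restrict_space)
  then have "I ?N f1 X - I ?N f2 X = (\<integral>x. indicator X x * (f1 x - f2 x) \<partial>?N)"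
    unfolding I_def right_diff_distrib
    by (intro Bochner_Integration.integral_diff[symmetric] integrable_indicator_times i1(1) i2(1))
  ultimately show ?thesis using i1 i2 by (simp add: F_def)
qed

text \<open>Removing from X two null sets of \<sigma>1, one carrying Lebesgue measure and one
  carrying \<tau>1, leaves a set Y that is null for Lebesgue measure and for \<tau>1 but has the
  full \<sigma>1-mass of X. On Y the balance of the singular parts reads \<sigma>1 + \<tau>2 =
  \<sigma>2.\<close>

lemma singular_part_le:
  assumes fin: "finite_borel_measure_on a b \<sigma>1" "finite_borel_measure_on a b \<tau>1" "finite_borel_measure_on a b \<sigma>2" "finite_borel_measure_on a b \<tau>2"
    and s: "mutually_singular \<sigma>1 (restrict_space lborel {a<..<b})" "mutually_singular \<sigma>1 \<tau>1"
    and eq: "\<And>Y. Y \<in> sets borel \<Longrightarrow> Y \<subseteq> {a<..<b} \<Longrightarrow> emeasure lborel Y = 0 \<Longrightarrow>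
       measure \<sigma>1 Y + measure \<tau>2 Y = measure \<sigma>2 Y + measure \<tau>1 Y"
    and X: "X \<in> sets borel" "X \<subseteq> {a<..<b}"
  shows "measure \<sigma>1 X \<le> measure \<sigma>2 X"
proof -
  note D1 = finite_borel_measure_onD[OF fin(1)] and D2 = finite_borel_measure_onD[OF fin(2)] and D3 = finite_borel_measure_onD[OF fin(3)]
  interpret S1: finite_measure \<sigma>1 by (rule D1)
  interpret T1: finite_measure \<tau>1 by (rule D2)
  interpret S2: finite_measure \<sigma>2 by (rule D3)
  let ?S = "{a<..<b}"
  obtain A where A: "A \<in> sets \<sigma>1" "emeasure \<sigma>1 A = 0" "emeasure (restrict_space lborel ?S) (?S - A) = 0"
    using s(1) by (auto simp: mutually_singular_def space_restrict_space)
  obtain P where P: "P \<in> sets \<sigma>1" "emeasure \<sigma>1 P = 0" "emeasure \<tau>1 (?S - P) = 0"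
    using s(2) D2(2) by (auto simp: mutually_singular_def)
  define Y where "Y = X - (A \<union> P)"
  have AP: "A \<in> sets borel" "P \<in> sets borel" using A(1) P(1) D1(6) by auto
  have Yb: "Y \<in> sets borel" "Y \<subseteq> ?S" using X AP by (auto simp: Y_def)
  have "emeasure lborel (?S - A) = 0"
    using A(3) AP by (subst (asm) emeasure_restrict_space) auto
  then have "emeasure lborel Y = 0"
    by (rule emeasure_eq_0[rotated]) (use X AP in \<open>auto simp: Y_def\<close>)
  note e = eq[OF Yb this]
  have "emeasure \<tau>1 Y = 0"
    by (rule emeasure_eq_0[OF _ P(3)]) (use X AP D2(6) in \<open>auto simp: Y_def\<close>)
  then have t: "measure \<tau>1 Y = 0" by (simp add: measure_def)
  have "A \<union> P \<in> null_sets \<sigma>1" using A P by (intro null_sets.Un null_setsI) auto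
  then have "emeasure \<sigma>1 X = emeasure \<sigma>1 Y"
    unfolding Y_def using X D1(6) by (intro emeasure_Diff_null_set[symmetric]) auto
  then have "measure \<sigma>1 X = measure \<sigma>1 Y" by (simp add: measure_def)
  also have "\<dots> \<le> measure \<sigma>2 Y" using e t by (simp add: measure_nonneg) (smt (verit) measure_nonneg)
  also have "\<dots> \<le> measure \<sigma>2 X"
    by (rule S2.finite_measure_mono) (use X D3(6) in \<open>auto simp: Y_def\<close>)
  finally show ?thesis .
qed

lemma mutually_singular_sym:
  assumes "mutually_singular \<mu> \<nu>" "sets \<mu> = sets \<nu>"
  shows "mutually_singular \<nu> \<mu>"
proof -
  obtain A where A: "A \<in> sets \<mu>" "emeasure \<mu> A = 0" "emeasure \<nu> (space \<nu> - A) = 0"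
    using assms(1) by (auto simp: mutually_singular_def)
  have sp: "space \<mu> = space \<nu>" using sets_eq_imp_space_eq[OF assms(2)] .
  have "space \<nu> - (space \<nu> - A) = A" using A(1) sets.sets_into_space[of A \<mu>] sp by auto
  then show ?thesis unfolding mutually_singular_def
    using A assms(2) sp by (intro bexI[of _ "space \<nu> - A"]) auto
qed

text \<open>On Lebesgue null sets the densities drop out of the equality of signed measures, so the
  singular parts can be compared alone: \<open>singular_part_le\<close> is used in both directions,
  and again with \<sigma> and \<tau> exchanged. Once the singular parts agree, so do the integrals
  of the densities over Borel sets.\<close>

lemma bv_decomp_unique:
  assumes ab: "a < b" and w: "L1_on a b w"
    and d1: "bv_decomp a b w f1 \<sigma>1 \<tau>1" and d2: "bv_decomp a b w f2 \<sigma>2 \<tau>2"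
  shows "\<sigma>1 = \<sigma>2" "\<tau>1 = \<tau>2" "AE x in lebesgue_on {a<..<b}. f1 x = f2 x"
proof -
  let ?N = "lebesgue_on {a<..<b}"
  have i1: "integrable ?N f1" "finite_borel_measure_on a b \<sigma>1" "finite_borel_measure_on a b \<tau>1"
    and i2: "integrable ?N f2" "finite_borel_measure_on a b \<sigma>2" "finite_borel_measure_on a b \<tau>2"
    and s: "mutually_singular \<sigma>1 (restrict_space lborel {a<..<b})" "mutually_singular \<sigma>1 \<tau>1"
       "mutually_singular \<tau>1 (restrict_space lborel {a<..<b})"
       "mutually_singular \<sigma>2 (restrict_space lborel {a<..<b})" "mutually_singular \<sigma>2 \<tau>2"
       "mutually_singular \<tau>2 (restrict_space lborel {a<..<b})"
    using d1 d2 by (auto simp: bv_decomp_def L1_on_def)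
  have s': "mutually_singular \<tau>1 \<sigma>1" "mutually_singular \<tau>2 \<sigma>2"
    using s i1 i2 by (auto intro!: mutually_singular_sym simp: finite_borel_measure_on_def)
  note eqX = signed_measure_eq[OF i1 i2 bv_decomp_cdf_unique[OF ab w d1 d2]]
  have null: "measure \<sigma>1 Y + measure \<tau>2 Y = measure \<sigma>2 Y + measure \<tau>1 Y"
    if "Y \<in> sets borel" "Y \<subseteq> {a<..<b}" "emeasure lborel Y = 0" for Y
  proof -
    have "Y \<in> null_sets lebesgue" using that by (intro null_sets_completionI) auto
    then have "AE x in lebesgue. x \<notin> Y" by (rule AE_not_in)
    then have "AE x in ?N. x \<notin> Y" by (subst AE_restrict_space_iff) auto
    then have "AE x in ?N. indicator Y x * (f1 x - f2 x) = 0" by eventually_elim auto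
    then have "(\<integral>x. indicator Y x * (f1 x - f2 x) \<partial>?N) = 0" by (rule integral_eq_zero_AE)
    then show ?thesis using eqX[OF that(1)] that(2) by (simp add: Int_absorb2)
  qed
  have m: "measure \<sigma>1 X = measure \<sigma>2 X" "measure \<tau>1 X = measure \<tau>2 X" if X: "X \<in> sets borel" "X \<subseteq> {a<..<b}" for X
  proof -
    have "measure \<sigma>1 X \<le> measure \<sigma>2 X"
      by (rule singular_part_le[OF i1(2,3) i2(2,3) s(1,2) null X])
    moreover have "measure \<sigma>2 X \<le> measure \<sigma>1 X"
      by (rule singular_part_le[OF i2(2,3) i1(2,3) s(4,5) _ X]) (use null in \<open>simp add: add.commute\<close>)
    moreover have "measure \<tau>1 X \<le> measure \<tau>2 X"
      by (rule singular_part_le[OF i1(3,2) i2(3,2) s(3) s'(1) _ X]) (use null in \<open>simp add: add.commute\<close>)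
    moreover have "measure \<tau>2 X \<le> measure \<tau>1 X"
      by (rule singular_part_le[OF i2(3,2) i1(3,2) s(6) s'(2) _ X]) (use null in \<open>simp add: add.commute\<close>)
    ultimately show "measure \<sigma>1 X = measure \<sigma>2 X" "measure \<tau>1 X = measure \<tau>2 X" by auto
  qed
  have eqI: "M1 = M2" if "finite_borel_measure_on a b M1" "finite_borel_measure_on a b M2"
    "\<And>X. X \<in> sets borel \<Longrightarrow> X \<subseteq> {a<..<b} \<Longrightarrow> measure M1 X = measure M2 X" for M1 M2 :: "real measure"
  proof (rule measure_eqI)
    show "sets M1 = sets M2" using that by (simp add: finite_borel_measure_on_def)
    interpret M1: finite_measure M1 by (rule finite_borel_measure_onD[OF that(1)])
    interpret M2: finite_measure M2 by (rule finite_borel_measure_onD[OF that(2)])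
    fix X assume "X \<in> sets M1"
    then show "emeasure M1 X = emeasure M2 X"
      using that(3)[of X] finite_borel_measure_onD(6)[OF that(1)]
      by (simp add: M1.emeasure_eq_measure M2.emeasure_eq_measure)
  qed
  show st: "\<sigma>1 = \<sigma>2" "\<tau>1 = \<tau>2" using eqI i1 i2 m by auto
  have "AE x in ?N. f1 x - f2 x = 0"
    by (rule AE_zero_from_borel) (use i1 i2 eqX st in auto)
  then show "AE x in ?N. f1 x = f2 x" by simp
qed


section \<open>Existence of the decomposition\<close>

lemma finite_measure_sum_exists:
  assumes "finite_measure M1" "finite_measure M2" "sets M2 = sets M1"
  obtains R where "finite_measure R" "sets R = sets M1" "\<And>X. X \<in> sets M1 \<Longrightarrow> emeasure R X = emeasure M1 X + emeasure M2 X"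
proof -
  define R where "R = measure_of (space M1) (sets M1) (\<lambda>X. emeasure M1 X + emeasure M2 X)"
  have sR: "sets R = sets M1" unfolding R_def by simp
  have e: "emeasure R X = emeasure M1 X + emeasure M2 X" if "X \<in> sets M1" for X
    unfolding R_def
  proof (rule emeasure_measure_of_sigma[OF sets.sigma_algebra_axioms _ _ that])
    show "positive (sets M1) (\<lambda>X. emeasure M1 X + emeasure M2 X)" by (simp add: positive_def)
    show "countably_additive (sets M1) (\<lambda>X. emeasure M1 X + emeasure M2 X)"
      unfolding countably_additive_def
    proof safe
      fix A :: "nat \<Rightarrow> _" assume A: "range A \<subseteq> sets M1" "disjoint_family A"
      have "(\<Sum>i. emeasure M1 (A i) + emeasure M2 (A i)) = (\<Sum>i. emeasure M1 (A i)) + (\<Sum>i. emeasure M2 (A i))"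
        by (rule suminf_add[symmetric]) auto
      also have "\<dots> = emeasure M1 (\<Union> (range A)) + emeasure M2 (\<Union> (range A))"
        using A assms(3) by (simp add: suminf_emeasure)
      finally show "(\<Sum>i. emeasure M1 (A i) + emeasure M2 (A i)) = emeasure M1 (\<Union> (range A)) + emeasure M2 (\<Union> (range A))" .
    qed
  qed
  have sp: "space R = space M1" "space M2 = space M1" using sR assms(3) by (auto dest: sets_eq_imp_space_eq)
  have "finite_measure R"
  proof (rule finite_measureI)
    have "emeasure M1 (space M1) \<noteq> \<infinity>" "emeasure M2 (space M1) \<noteq> \<infinity>"
      using finite_measure.finite_emeasure_space[OF assms(1)] finite_measure.finite_emeasure_space[OF assms(2)] sp by auto
    then show "emeasure R (space R) \<noteq> \<infinity>" using e[of "space M1"] sp by simp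
  qed
  then show ?thesis using that[OF _ sR e] by blast
qed

text \<open>Domination by R gives absolute continuity, and finiteness of both measures gives a
  Radon-Nikodym density that is real instead of extended.\<close>

lemma real_density_exists:
  assumes R: "finite_measure R" and M: "finite_measure M" "sets M = sets R"
    and le: "\<And>X. X \<in> sets R \<Longrightarrow> emeasure M X \<le> emeasure R X"
  obtains p :: "'a \<Rightarrow> real" where "p \<in> borel_measurable R" "\<And>x. 0 \<le> p x" "M = density R (\<lambda>x. ennreal (p x))"
proof -
  interpret R: finite_measure R by fact
  have ac: "absolutely_continuous R M"
    unfolding absolutely_continuous_def using M(2) le by (auto simp: null_sets_def) (metis le_zero_eq)
  obtain D where D: "D \<in> borel_measurable R" "AE x in R. RN_deriv R M x = ennreal (D x)" "\<And>x. 0 \<le> D x"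
    using R.real_RN_deriv[OF M(1) ac M(2)] by metis
  have "M = density R (RN_deriv R M)"
    using R.density_RN_deriv[OF ac M(2)] by simp
  also have "\<dots> = density R (\<lambda>x. ennreal (D x))"
    by (rule density_cong) (use D in auto)
  finally show ?thesis using that D by blast
qed

lemma lebesgue_on_Ioo_borel_eq:
  fixes f :: "real \<Rightarrow> real"
  assumes "f \<in> borel_measurable (restrict_space lborel {a<..<b})"
  shows "integrable (lebesgue_on {a<..<b}) f \<longleftrightarrow> integrable (restrict_space lborel {a<..<b}) f"
    and "(\<integral>x. f x \<partial>lebesgue_on {a<..<b}) = (\<integral>x. f x \<partial>restrict_space lborel {a<..<b})"
proof -
  have "(\<lambda>x. f x * indicator {a<..<b} x) \<in> borel_measurable lborel"
    using assms by (subst (asm) borel_measurable_restrict_space_iff) (simp_all add: mult.commute)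
  then have m: "(\<lambda>x. indicator {a<..<b} x *\<^sub>R f x) \<in> borel_measurable lborel" by (simp add: mult.commute)
  show "integrable (lebesgue_on {a<..<b}) f \<longleftrightarrow> integrable (restrict_space lborel {a<..<b}) f"
    by (subst (1 2) integrable_restrict_space) (use m in \<open>auto simp: integrable_completion\<close>)
  show "(\<integral>x. f x \<partial>lebesgue_on {a<..<b}) = (\<integral>x. f x \<partial>restrict_space lborel {a<..<b})"
    by (subst (1 2) integral_restrict_space) (use m in \<open>auto simp: integral_completion\<close>)
qed

lemma test_fun_integrable:
  assumes \<psi>: "test_fun a b \<psi>" and M: "finite_borel_measure_on a b M"
  shows "integrable M \<psi>"
proof -
  interpret finite_measure M by (rule finite_borel_measure_onD[OF M])
  have c: "continuous_on UNIV \<psi>"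
    using test_funD(1)[OF \<psi>] by (auto simp: continuous_on_eq_continuous_at intro: DERIV_isCont)
  obtain B where B: "\<And>x. a \<le> x \<Longrightarrow> x \<le> b \<Longrightarrow> \<bar>\<psi> x\<bar> \<le> B"
    using continuous_bounded_Ioo[OF continuous_on_subset[OF c subset_UNIV]] by metis
  show ?thesis
  proof (rule integrable_const_bound[where B=B])
    show "AE x in M. norm (\<psi> x) \<le> B" using B finite_borel_measure_onD(2)[OF M] by (intro AE_I2) auto
    have "\<psi> \<in> borel_measurable borel" using c by (rule borel_measurable_continuous_onI)
    then have "(\<lambda>x. \<psi> (id x)) \<in> borel_measurable M"
      by (rule measurable_compose[rotated]) (use finite_borel_measure_onD(3)[OF M] in \<open>simp add: id_def\<close>)
    then show "\<psi> \<in> borel_measurable M" by simp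
  qed
qed

text \<open>Lebesgue measure, \<mu> and \<nu> get densities p, q, r with respect to their sum R.
  Where p > 0, the quotient (q - r) / p is the absolutely continuous density. The set p = 0 is
  Lebesgue null and carries the singular part, split into the positive and the negative part of q -
  r.\<close>

lemma bv_decomp_exists:
  assumes "BV a b w"
  shows "\<exists>f \<sigma> \<tau>. bv_decomp a b w f \<sigma> \<tau>"
proof -
  obtain \<mu> \<nu> where mu: "finite_borel_measure_on a b \<mu>" and nu: "finite_borel_measure_on a b \<nu>"
    and test: "\<And>\<psi>. test_fun a b \<psi> \<Longrightarrow>
           (\<integral>x. w x * deriv \<psi> x \<partial>lebesgue_on {a<..<b}) = - ((\<integral>x. \<psi> x \<partial>\<mu>) - (\<integral>x. \<psi> x \<partial>\<nu>))"
    using assms by (auto simp: BV_def)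
  let ?L = "restrict_space lborel {a<..<b}"
  have "emeasure lborel {a<..<b} < \<infinity>" by (rule emeasure_bounded_finite) simp
  then have fL: "finite_measure ?L"
    by (intro finite_measureI) (auto simp: emeasure_restrict_space space_restrict_space less_top)
  have sL: "sets ?L = sets (restrict_space borel {a<..<b})" by (rule sets_restrict_space_cong) simp
  have smu: "sets \<mu> = sets ?L" and snu: "sets \<nu> = sets ?L"
    using mu nu sL by (auto simp: finite_borel_measure_on_def)
  have fmu: "finite_measure \<mu>" and fnu: "finite_measure \<nu>" using mu nu by (auto simp: finite_borel_measure_on_def)
  obtain R0 where R0: "finite_measure R0" "sets R0 = sets \<mu>"
    "\<And>X. X \<in> sets \<mu> \<Longrightarrow> emeasure R0 X = emeasure \<mu> X + emeasure \<nu> X"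
    using finite_measure_sum_exists[OF fmu fnu] smu snu by metis
  obtain R where R: "finite_measure R" "sets R = sets ?L"
    "\<And>X. X \<in> sets ?L \<Longrightarrow> emeasure R X = emeasure ?L X + emeasure R0 X"
    using finite_measure_sum_exists[OF fL R0(1)] smu R0(2) by metis
  interpret R: finite_measure R by (rule R)
  obtain p :: "real \<Rightarrow> real" where p[measurable]: "p \<in> borel_measurable R" and p0: "\<And>x. 0 \<le> p x"
      and pL: "?L = density R (\<lambda>x. ennreal (p x))"
    by (rule real_density_exists[OF R(1) fL]) (use R in auto)
  obtain q :: "real \<Rightarrow> real" where q[measurable]: "q \<in> borel_measurable R" and q0: "\<And>x. 0 \<le> q x"
      and qm: "\<mu> = density R (\<lambda>x. ennreal (q x))"
    by (rule real_density_exists[OF R(1) fmu]) (use R R0 smu in \<open>auto simp: add_increasing\<close>)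
  obtain r :: "real \<Rightarrow> real" where r[measurable]: "r \<in> borel_measurable R" and r0: "\<And>x. 0 \<le> r x"
      and rn: "\<nu> = density R (\<lambda>x. ennreal (r x))"
    by (rule real_density_exists[OF R(1) fnu]) (use R R0 smu snu in \<open>auto simp: add_increasing\<close>)
  have sp: "space R = {a<..<b}" using sets_eq_imp_space_eq[OF R(2)] by (simp add: space_restrict_space)
  have qI: "integrable R q"
    using fmu finite_measure.integrable_const[OF fmu, of "1::real"] unfolding qm
    by (subst (asm) integrable_density) (use q0 in auto)
  have rI: "integrable R r"
    using fnu finite_measure.integrable_const[OF fnu, of "1::real"] unfolding rn
    by (subst (asm) integrable_density) (use r0 in auto)
  define f where "f x = (if p x = 0 then 0 else (q x - r x) / p x)" for x
  define s where "s x = (if p x = 0 then max (q x - r x) 0 else 0)" for x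
  define t where "t x = (if p x = 0 then max (r x - q x) 0 else 0)" for x
  have [measurable]: "f \<in> borel_measurable R" "s \<in> borel_measurable R" "t \<in> borel_measurable R"
    unfolding f_def[abs_def] s_def[abs_def] t_def[abs_def] by measurable
  have s0: "0 \<le> s x" "0 \<le> t x" for x by (auto simp: s_def t_def)
  have sI: "integrable R s" "integrable R t"
    by (rule Bochner_Integration.integrable_bound[OF Bochner_Integration.integrable_add[OF qI rI]];
        use q0 r0 in \<open>auto simp: s_def t_def add_nonneg_nonneg intro!: AE_I2\<close>; smt (verit) q0 r0)+
  define \<sigma> where "\<sigma> = density R (\<lambda>x. ennreal (s x))"
  define \<tau> where "\<tau> = density R (\<lambda>x. ennreal (t x))"
  have fb: "finite_borel_measure_on a b (density R (\<lambda>x. ennreal (s x)))"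
    if [measurable]: "s \<in> borel_measurable R" and "integrable R s" "\<And>x. 0 \<le> s x" for s
  proof -
    have "(\<integral>\<^sup>+ x. ennreal (s x) \<partial>R) < \<infinity>" using that by (simp add: nn_integral_eq_integral)
    then have "finite_measure (density R (\<lambda>x. ennreal (s x)))"
      by (intro finite_measureI) (simp add: emeasure_density nn_integral_cong[of R "\<lambda>x. ennreal (s x) * indicator (space R) x" "\<lambda>x. ennreal (s x)"] less_top)
    then show ?thesis using R(2) sL by (simp add: finite_borel_measure_on_def)
  qed
  have fs: "finite_borel_measure_on a b \<sigma>" and ft: "finite_borel_measure_on a b \<tau>"
    unfolding \<sigma>_def \<tau>_def using sI s0 by (auto intro!: fb)
  have z: "emeasure (density R (\<lambda>x. ennreal (s x))) {x \<in> space R. P x} = 0"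
    if [measurable]: "s \<in> borel_measurable R" "Measurable.pred R P" and "\<And>x. P x \<Longrightarrow> s x = 0" for s :: "real \<Rightarrow> real" and P
  proof -
    have "(\<integral>\<^sup>+ x. ennreal (s x) * indicator {x \<in> space R. P x} x \<partial>R) = (\<integral>\<^sup>+ x. 0 \<partial>R)"
      by (rule nn_integral_cong) (use that in \<open>auto simp: indicator_def\<close>)
    then show ?thesis by (simp add: emeasure_density)
  qed
  have [simp]: "sets \<sigma> = sets R" "sets \<tau> = sets R" "space \<sigma> = space R" "space \<tau> = space R"
    by (simp_all add: \<sigma>_def \<tau>_def)
  have spL: "space ?L = space R" using sp by (simp add: space_restrict_space)
  have sing: "mutually_singular \<sigma> ?L" "mutually_singular \<tau> ?L" "mutually_singular \<sigma> \<tau>"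
  proof -
    have e: "space R - {x \<in> space R. P x} = {x \<in> space R. \<not> P x}" for P by auto
    have A: "{x \<in> space R. p x \<noteq> 0} \<in> sets R" "{x \<in> space R. q x \<le> r x} \<in> sets R" by measurable
    show "mutually_singular \<sigma> ?L" "mutually_singular \<tau> ?L"
      unfolding mutually_singular_def spL
      by (rule bexI[of _ "{x \<in> space R. p x \<noteq> 0}"]; use A in \<open>simp add: e\<close>; 
          simp add: \<sigma>_def \<tau>_def pL; intro conjI z; simp add: s_def t_def)+
    show "mutually_singular \<sigma> \<tau>"
      unfolding mutually_singular_def
      by (rule bexI[of _ "{x \<in> space R. q x \<le> r x}"]; use A in \<open>simp add: e\<close>;
          simp add: \<sigma>_def \<tau>_def; intro conjI z; simp add: s_def t_def)
  qed
  have m_eq: "borel_measurable ?L = borel_measurable R" by (rule measurable_cong_sets[OF R(2)[symmetric] refl])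
  have fm: "f \<in> borel_measurable ?L" unfolding m_eq by measurable
  have pf: "p x * f x + (s x - t x) = q x - r x" for x by (auto simp: f_def s_def t_def)
  have pfI: "integrable R (\<lambda>x. p x * f x)"
  proof -
    have "p x * f x = q x - r x - (s x - t x)" for x using pf[of x] by simp
    then show ?thesis using qI rI sI by simp
  qed
  have "integrable ?L f"
    unfolding pL using p0 pfI by (subst integrable_density) auto
  then have f1: "L1_on a b f" unfolding L1_on_def by (subst lebesgue_on_Ioo_borel_eq[OF fm])
  have "(\<integral>x. w x * deriv \<psi> x \<partial>lebesgue_on {a<..<b}) =
          - ((\<integral>x. f x * \<psi> x \<partial>lebesgue_on {a<..<b}) + ((\<integral>x. \<psi> x \<partial>\<sigma>) - (\<integral>x. \<psi> x \<partial>\<tau>)))"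
    if \<psi>: "test_fun a b \<psi>" for \<psi>
  proof -
    note int = test_fun_integrable[OF \<psi>]
    have c: "continuous_on UNIV \<psi>"
      using test_funD(1)[OF \<psi>] by (auto simp: continuous_on_eq_continuous_at intro: DERIV_isCont)
    have "\<psi> \<in> borel_measurable \<mu>" using int[OF mu] by auto
    then have [measurable]: "\<psi> \<in> borel_measurable R" using smu R(2) by (simp cong: measurable_cong_sets)
    have I: "integrable R (\<lambda>x. q x * \<psi> x)" "integrable R (\<lambda>x. r x * \<psi> x)" "integrable R (\<lambda>x. s x * \<psi> x)" "integrable R (\<lambda>x. t x * \<psi> x)"
      using int[OF mu] int[OF nu] int[OF fs] int[OF ft] unfolding qm rn \<sigma>_def \<tau>_def
      by (subst (asm) (1 2 3 4) integrable_density; use q0 r0 s0 in auto)+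
    have E: "(\<integral>x. \<psi> x \<partial>\<mu>) = (\<integral>x. q x * \<psi> x \<partial>R)" "(\<integral>x. \<psi> x \<partial>\<nu>) = (\<integral>x. r x * \<psi> x \<partial>R)"
      "(\<integral>x. \<psi> x \<partial>\<sigma>) = (\<integral>x. s x * \<psi> x \<partial>R)" "(\<integral>x. \<psi> x \<partial>\<tau>) = (\<integral>x. t x * \<psi> x \<partial>R)"
      unfolding qm rn \<sigma>_def \<tau>_def by (subst integral_density; use q0 r0 s0 in auto)+
    have fpm: "(\<lambda>x. f x * \<psi> x) \<in> borel_measurable ?L" unfolding m_eq by measurable
    have "(\<integral>x. f x * \<psi> x \<partial>lebesgue_on {a<..<b}) = (\<integral>x. f x * \<psi> x \<partial>?L)"
      by (rule lebesgue_on_Ioo_borel_eq[OF fpm])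
    also have "\<dots> = (\<integral>x. p x * (f x * \<psi> x) \<partial>R)"
      unfolding pL by (subst integral_density; use p0 in auto)
    also have "\<dots> = (\<integral>x. (q x * \<psi> x - r x * \<psi> x) - (s x * \<psi> x - t x * \<psi> x) \<partial>R)"
    proof (intro Bochner_Integration.integral_cong refl)
      fix x
      have e: "p x * f x = q x - r x - (s x - t x)" using pf[of x] by simp
      show "p x * (f x * \<psi> x) = (q x * \<psi> x - r x * \<psi> x) - (s x * \<psi> x - t x * \<psi> x)"
        using arg_cong[OF e, of "\<lambda>y. y * \<psi> x"] by (simp add: algebra_simps)
    qed
    also have "\<dots> = ((\<integral>x. \<psi> x \<partial>\<mu>) - (\<integral>x. \<psi> x \<partial>\<nu>)) - ((\<integral>x. \<psi> x \<partial>\<sigma>) - (\<integral>x. \<psi> x \<partial>\<tau>))"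
      unfolding E using I by simp
    finally show ?thesis using test[OF \<psi>] by simp
  qed
  moreover have "mutually_singular \<sigma> \<tau>" by (rule sing)
  ultimately have "bv_decomp a b w f \<sigma> \<tau>"
    unfolding bv_decomp_def using f1 fs ft sing by blast
  then show ?thesis by blast
qed

text \<open>\<open>SOME\<close> picks a density together with some pair of singular parts; by
  uniqueness this is the pair returned by the two \<open>THE\<close>, so the three separate choices
  fit together.\<close>

lemma bv_decomp_canonical:
  assumes ab: "a < b" and w: "BV a b w"
  shows "bv_decomp a b w (bv_density a b w) (bv_sing_pos a b w) (bv_sing_neg a b w)"
proof -
  have w1: "L1_on a b w" using w by (simp add: BV_def)
  note uniq = bv_decomp_unique[OF ab w1]
  have ex: "\<exists>f \<sigma> \<tau>. bv_decomp a b w f \<sigma> \<tau>" by (rule bv_decomp_exists[OF w])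
  then have "\<exists>\<sigma> \<tau>. bv_decomp a b w (bv_density a b w) \<sigma> \<tau>"
    unfolding bv_density_def by (rule someI_ex)
  then obtain \<sigma> \<tau> where d: "bv_decomp a b w (bv_density a b w) \<sigma> \<tau>" by blast
  have "bv_sing_pos a b w = \<sigma>" "bv_sing_neg a b w = \<tau>"
    unfolding bv_sing_pos_def bv_sing_neg_def
    by (rule the_equality; use d uniq in blast)+
  then show ?thesis using d by simp
qed

section \<open>Traces as essential one-sided limits\<close>

text \<open>The filter of the essential limit is proper because every set of full measure is met
  frequently along F. The limit can then be computed with any representative V.\<close>

lemma ess_Lim_eq:
  fixes w V :: "real \<Rightarrow> real"
  assumes ae: "AE y in lebesgue_on {a<..<b}. w y = V y" and V: "(V \<longlongrightarrow> L) F"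
    and F: "\<forall>\<^sub>F x in F. x \<in> {a<..<b}"
    and freq: "\<And>P. AE y in lebesgue_on {a<..<b}. P y \<Longrightarrow> \<exists>\<^sub>F x in F. P x"
  shows "Lim (inf F (ae_filter lebesgue)) w = L"
proof (rule tendsto_Lim)
  let ?F = "inf F (ae_filter lebesgue)"
  show "\<not> trivial_limit ?F"
  proof
    assume "?F = bot"
    then have "\<forall>\<^sub>F x in ?F. False" by simp
    then obtain P Q where P: "eventually P F" and Q: "eventually Q (ae_filter lebesgue)" and PQ: "\<And>x. P x \<Longrightarrow> Q x \<Longrightarrow> False"
      unfolding eventually_inf by auto
    have "AE y in lebesgue_on {a<..<b}. Q y"
      using Q by (subst AE_restrict_space_iff) (auto elim: eventually_mono)
    from freq[OF this] have "\<exists>\<^sub>F x in F. Q x" .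
    moreover have "\<forall>\<^sub>F x in F. \<not> Q x" using P by eventually_elim (use PQ in auto)
    ultimately show False by (simp add: frequently_def)
  qed
  have "AE y in lebesgue. y \<in> {a<..<b} \<longrightarrow> w y = V y"
    using ae by (subst (asm) AE_restrict_space_iff) auto
  then have 1: "\<forall>\<^sub>F y in ?F. y \<in> {a<..<b} \<longrightarrow> w y = V y"
    by (rule filter_leD[OF inf_le2])
  have "\<forall>\<^sub>F y in ?F. y \<in> {a<..<b}" by (rule filter_leD[OF inf_le1 F])
  with 1 have "\<forall>\<^sub>F y in ?F. V y = w y" by eventually_elim auto
  moreover have "(V \<longlongrightarrow> L) ?F" using V by (rule tendsto_mono[OF inf_le1])
  ultimately show "(w \<longlongrightarrow> L) ?F" by (rule Lim_transform_eventually[rotated])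
qed

lemma bv_traces:
  assumes ab: "a < b" and w: "L1_on a b w" and d: "bv_decomp a b w f \<sigma> \<tau>"
    and c: "AE y in lebesgue_on {a<..<b}. w y = c + bv_cdf a b f \<sigma> \<tau> y"
  shows "trace_right w a = c"
    "trace_left w b = c + (\<integral>x. f x \<partial>lebesgue_on {a<..<b}) + measure \<sigma> {a<..<b} - measure \<tau> {a<..<b}"
proof -
  have i: "integrable (lebesgue_on {a<..<b}) f" "finite_borel_measure_on a b \<sigma>" "finite_borel_measure_on a b \<tau>"
    using d by (auto simp: bv_decomp_def L1_on_def)
  have 0: "bv_cdf a b f \<sigma> \<tau> a = 0"
    using finite_borel_measure_onD(2)[OF i(2)] finite_borel_measure_onD(2)[OF i(3)]
    by (simp add: bv_cdf_def cdf_on_le_left[where a=a and b=b])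
  show "trace_right w a = c"
    unfolding trace_right_def
  proof (rule ess_Lim_eq[OF c])
    show "((\<lambda>y. c + bv_cdf a b f \<sigma> \<tau> y) \<longlongrightarrow> c) (at_right a)"
      using tendsto_add[OF tendsto_const bv_cdf_at_right[OF i, of a]] 0 by simp
    show "\<forall>\<^sub>F x in at_right a. x \<in> {a<..<b}" by (rule eventually_at_right_real[OF ab])
  qed (rule frequently_ae_at_right, use ab in auto)
  show "trace_left w b = c + (\<integral>x. f x \<partial>lebesgue_on {a<..<b}) + measure \<sigma> {a<..<b} - measure \<tau> {a<..<b}"
    unfolding trace_left_def
  proof (rule ess_Lim_eq[OF c])
    show "((\<lambda>y. c + bv_cdf a b f \<sigma> \<tau> y) \<longlongrightarrow> c + (\<integral>x. f x \<partial>lebesgue_on {a<..<b}) + measure \<sigma> {a<..<b} - measure \<tau> {a<..<b}) (at_left b)"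
      using tendsto_add[OF tendsto_const bv_cdf_at_left[OF i ab], of c] by (simp add: add_diff_eq add.assoc)
    show "\<forall>\<^sub>F x in at_left b. x \<in> {a<..<b}" by (rule eventually_at_left_real[OF ab])
  qed (rule frequently_ae_at_left, use ab in auto)
qed

section \<open>The dual profile and the function \<open>\<Phi>\<close>\<close>

lemma nn_integral_lebesgue_on_Ioo:
  "(\<integral>\<^sup>+x. f x \<partial>lebesgue_on {a<..<b::real}) = (\<integral>\<^sup>+x. f x * indicator {a<..<b} x \<partial>lborel)"
  by (subst nn_integral_restrict_space) (auto simp: nn_integral_completion)

lemma nn_integral_lebesgue_on_has_integral:
  fixes f :: "real \<Rightarrow> real"
  assumes "(f has_integral I) {a..b}" "\<And>x. a < x \<Longrightarrow> x < b \<Longrightarrow> 0 \<le> f x"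
  shows "(\<integral>\<^sup>+x. ennreal (f x) \<partial>lebesgue_on {a<..<b}) = ennreal I"
  unfolding nn_integral_lebesgue_on_Ioo
  by (rule nn_integral_has_integral_lebesgue') (use assms in \<open>auto simp: has_integral_Icc_iff_Ioo\<close>)

locale cohesive =
  fixes l Q \<omega> \<phi> :: "real \<Rightarrow> real"
  assumes data: "regular_data l Q \<omega> \<phi>"
begin

abbreviation \<theta> where "\<theta> \<equiv> theta l Q \<omega>"

definition W where "W t = \<omega> (1 - t)"

text \<open>The coefficient of \<open>\<bar>v'\<bar>\<close> in the Cauchy-Schwarz bound for
  \<lambda>^2 = \<open>\<theta> m\<close>. The \<open>max 0\<close> extends it by zero to levels
  below m, so that different values of m can be compared on one interval.\<close>

definition k where "k m t = sqrt (W t * max 0 (1 - \<theta> m / \<theta> t))"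

definition A where "A m = 2 * integral {m..1} (k m)"

definition H where "H m s = sqrt (\<theta> m) * s + A m"

text \<open>The slope du/dv, at the level v = t, of the curve with minimum x for which
  Cauchy-Schwarz is an equality.\<close>

definition dw where "dw x t = sqrt (\<theta> x * W t / (\<theta> t * (\<theta> t - \<theta> x)))"

text \<open>\<open>dw x\<close> after the substitution t = x + (1 - x) y^2. The factor y from the
  substitution compensates the singularity of \<open>dw x\<close> at t = x, and the interval of
  integration (0, 1) does not depend on x.\<close>

definition J where "J x y = dw x (x + (1 - x) * y\<^sup>2) * (2 * (1 - x) * y)"

lemma dataD:
  "continuous_on {0..1} l" "\<forall>t\<in>{0..1}. 0 \<le> l t" "continuous_on {0..1} Q" "\<forall>t\<in>{0..1}. 0 \<le> Q t" "l 1 = 1"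
  "\<forall>t\<in>{0..1}. l t = 0 \<longleftrightarrow> t = 0" "\<forall>t\<in>{0..1}. Q t = 0 \<longleftrightarrow> t = 0"
  "continuous_on {0..1} \<omega>" "\<forall>t\<in>{0..1}. 0 \<le> \<omega> t" "\<forall>t\<in>{0..1}. \<omega> t = 0 \<longleftrightarrow> t = 0"
  "\<exists>L::ennreal. ((\<lambda>t. ennreal (sqrt (\<omega> t / Q t))) \<longlongrightarrow> L) (at_right 0)"
  "\<theta> C1_differentiable_on {0<..<1}" "\<forall>t\<in>{0<..<1}. 0 < deriv \<theta> t"
  using data unfolding regular_data_def by - (elim conjE, assumption)+

lemma W_cont: "continuous_on {0..1} W"
proof -
  have "continuous_on ((\<lambda>t. 1 - t) ` {0..1}) \<omega>"
    by (rule continuous_on_subset[OF dataD(8)]) auto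
  then show ?thesis unfolding W_def[abs_def]
    by (rule continuous_on_compose2[of _ \<omega>]) (auto intro!: continuous_intros)
qed

lemma W_nonneg: "0 \<le> t \<Longrightarrow> t \<le> 1 \<Longrightarrow> 0 \<le> W t"
  and W_pos: "0 \<le> t \<Longrightarrow> t < 1 \<Longrightarrow> 0 < W t" and W_1 [simp]: "W 1 = 0"
proof -
  note w = dataD(9,10)
  show "0 \<le> t \<Longrightarrow> t \<le> 1 \<Longrightarrow> 0 \<le> W t" using w(1) by (auto simp: W_def)
  have "0 \<le> W t" "W t \<noteq> 0" if "0 \<le> t" "t < 1"
    using w(1)[rule_format, of "1 - t"] w(2)[rule_format, of "1 - t"] that by (auto simp: W_def)
  then show "0 \<le> t \<Longrightarrow> t < 1 \<Longrightarrow> 0 < W t" by force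
  show "W 1 = 0" using w by (simp add: W_def)
qed

lemma Q_pos: "0 < t \<Longrightarrow> t \<le> 1 \<Longrightarrow> 0 < Q t" and l_pos: "0 < t \<Longrightarrow> t \<le> 1 \<Longrightarrow> 0 < l t"
  and l_0: "l 0 = 0" and l_1: "l 1 = 1"
proof -
  note w = dataD(4,7,2,6)
  show "0 < t \<Longrightarrow> t \<le> 1 \<Longrightarrow> 0 < Q t" "0 < t \<Longrightarrow> t \<le> 1 \<Longrightarrow> 0 < l t" "l 0 = 0"
    using w by (auto simp: less_le)
  show "l 1 = 1" by (rule dataD)
qed

lemma th_W: "\<theta> t = W t / Q (1 - t) * l t" by (simp add: theta_def W_def)

lemma th_0 [simp]: "\<theta> 0 = 0" by (simp add: th_W l_0)

lemma th_pos: "0 < t \<Longrightarrow> t < 1 \<Longrightarrow> 0 < \<theta> t"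
  unfolding th_W using W_pos[of t] Q_pos[of "1 - t"] l_pos[of t] by simp

lemma th_nonneg: "0 \<le> t \<Longrightarrow> t < 1 \<Longrightarrow> 0 \<le> \<theta> t"
  using th_pos[of t] by (cases "t = 0") auto

lemma th_cont: "continuous_on {0..<1} \<theta>"
proof -
  have "continuous_on {0..<1} (\<lambda>t. Q (1 - t))"
    by (rule continuous_on_compose2[OF dataD(3)]) (auto intro!: continuous_intros)
  moreover have "Q (1 - t) \<noteq> 0" if "t \<in> {0..<1}" for t using Q_pos[of "1 - t"] that by auto
  moreover have "continuous_on {0..<1} W" "continuous_on {0..<1} l"
    by (rule continuous_on_subset[OF W_cont]; auto) (rule continuous_on_subset[OF dataD(1)]; auto)
  ultimately have "continuous_on {0..<1} (\<lambda>t. W t / Q (1 - t) * l t)"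
    by (intro continuous_on_mult continuous_on_divide) auto
  then show ?thesis by (simp add: th_W[abs_def])
qed

lemma th_deriv: "0 < t \<Longrightarrow> t < 1 \<Longrightarrow> (\<theta> has_real_derivative deriv \<theta> t) (at t)"
  and th_deriv_cont: "continuous_on {0<..<1} (deriv \<theta>)"
  and th_deriv_pos: "0 < t \<Longrightarrow> t < 1 \<Longrightarrow> 0 < deriv \<theta> t"
proof -
  obtain D where D: "\<forall>x\<in>{0<..<1}. (\<theta> has_real_derivative D x) (at x)" "continuous_on {0<..<1} D"
    using dataD(12) by (auto simp: C1_differentiable_on_def has_real_derivative_iff_has_vector_derivative)
  then have e: "deriv \<theta> x = D x" if "x \<in> {0<..<1}" for x using that by (auto intro: DERIV_imp_deriv)
  show "0 < t \<Longrightarrow> t < 1 \<Longrightarrow> (\<theta> has_real_derivative deriv \<theta> t) (at t)" using D(1) e by auto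
  show "continuous_on {0<..<1} (deriv \<theta>)" using D(2) by (rule continuous_on_eq) (simp add: e)
  show "0 < t \<Longrightarrow> t < 1 \<Longrightarrow> 0 < deriv \<theta> t" using dataD(13) by auto
qed

lemma th_strict_mono:
  assumes a: "0 \<le> x" "x < y" "y < 1"
  shows "\<theta> x < \<theta> y"
proof (rule DERIV_pos_imp_increasing_open[OF a(2)])
  show "continuous_on {x..y} \<theta>" by (rule continuous_on_subset[OF th_cont]) (use a in auto)
  show "\<exists>d. (\<theta> has_real_derivative d) (at t) \<and> 0 < d" if "x < t" "t < y" for t
    using th_deriv[of t] th_deriv_pos[of t] that a by auto
qed

lemma th_mono: "0 \<le> x \<Longrightarrow> x \<le> y \<Longrightarrow> y < 1 \<Longrightarrow> \<theta> x \<le> \<theta> y"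
  using th_strict_mono[of x y] by (cases "x = y") auto

text \<open>At \<open>t = 1\<close> the term \<open>\<theta> t\<close> has the junk value \<open>0\<close>, but \<open>W 1 = 0\<close>.\<close>

lemma k_le: "0 \<le> m \<Longrightarrow> m < 1 \<Longrightarrow> 0 \<le> t \<Longrightarrow> t \<le> 1 \<Longrightarrow> k m t \<le> sqrt (W t)"
proof -
  assume a: "0 \<le> m" "m < 1" "0 \<le> t" "t \<le> 1"
  have "max 0 (1 - \<theta> m / \<theta> t) \<le> 1" if "t < 1"
    using th_nonneg[of m] th_nonneg[of t] a that by auto
  then show ?thesis using a W_nonneg[of t] unfolding k_def
    by (cases "t < 1") (auto simp: mult_left_le)
qed

lemma k_nonneg: "0 \<le> t \<Longrightarrow> t \<le> 1 \<Longrightarrow> 0 \<le> k m t"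
  using W_nonneg[of t] by (simp add: k_def)

lemma k_1 [simp]: "k m 1 = 0" by (simp add: k_def)

lemma k_0: "k 0 t = sqrt (W t)" by (simp add: k_def)

lemma k_eq_0: "0 \<le> t \<Longrightarrow> t \<le> m \<Longrightarrow> 0 < m \<Longrightarrow> m < 1 \<Longrightarrow> 0 < t \<Longrightarrow> k m t = 0"
  using th_mono[of t m] th_pos[of t] by (simp add: k_def)

lemma sqrt_W_cont: "continuous_on {0..1} (\<lambda>t. sqrt (W t))"
  by (intro continuous_intros W_cont)

text \<open>Away from t = 1 this is continuity of a quotient, with c > 0 keeping
  \<open>\<theta> t\<close> away from 0. At t = 1 the bound \<open>k_le\<close> squeezes
  \<open>k m\<close> below sqrt (W t), which tends to 0.\<close>

lemma k_cont:
  assumes m: "0 < m" "m < 1" and c: "0 < c"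
  shows "continuous_on {c..1} (k m)"
  unfolding continuous_on_eq_continuous_within
proof
  fix t assume t: "t \<in> {c..1}"
  show "continuous (at t within {c..1}) (k m)"
  proof (cases "t = 1")
    case False
    have "\<theta> x \<noteq> 0" if "x \<in> {c..<1}" for x using th_pos[of x] that c by auto
    moreover have "continuous_on {c..<1} W" "continuous_on {c..<1} \<theta>"
      by (rule continuous_on_subset[OF W_cont] continuous_on_subset[OF th_cont]; use c in auto)+
    ultimately have "continuous_on {c..<1} (k m)" unfolding k_def[abs_def]
      by (intro continuous_intros) auto
    then have "continuous (at t within {c..<1}) (k m)" using t False by (simp add: continuous_on_eq_continuous_within)
    moreover have "at t within {c..1} = at t within {c..<1}"
      by (rule at_within_nhd[of t "{..<1}"]) (use t False in auto)
    ultimately show ?thesis by simp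
  next
    case True
    have "((\<lambda>t. sqrt (W t)) \<longlongrightarrow> sqrt (W 1)) (at 1 within {c..1})"
      using continuous_on_subset[OF sqrt_W_cont, of "{c..1}"] c t True unfolding continuous_on_def by force
    then have "((\<lambda>t. sqrt (W t)) \<longlongrightarrow> 0) (at 1 within {c..1})" by simp
    then have "(k m \<longlongrightarrow> 0) (at 1 within {c..1})"
    proof (rule Lim_null_comparison[rotated])
      show "\<forall>\<^sub>F t in at 1 within {c..1}. norm (k m t) \<le> sqrt (W t)"
        unfolding eventually_at_filter
        by (rule always_eventually) (use c m k_le k_nonneg in auto)
    qed
    then show ?thesis using True by (simp add: continuous_within)
  qed
qed

lemma k_0_cont: "continuous_on {0..1} (k 0)"
  using sqrt_W_cont by (simp add: k_0[abs_def])

lemma k_integrable: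
  assumes m: "0 \<le> m" "m < 1"
  shows "k m integrable_on {m..1}"
proof (cases "m = 0")
  case True then show ?thesis using k_0_cont by (simp add: integrable_continuous_real)
next
  case False then show ?thesis using k_cont[of m m] m by (simp add: integrable_continuous_real)
qed

lemma A_nonneg: "0 \<le> m \<Longrightarrow> m < 1 \<Longrightarrow> 0 \<le> A m"
  unfolding A_def by (intro mult_nonneg_nonneg integral_nonneg k_integrable) (auto intro: k_nonneg)

lemma A_le: "0 \<le> m \<Longrightarrow> m < 1 \<Longrightarrow> A m \<le> 2 * integral {m..1} (\<lambda>t. sqrt (W t))"
  unfolding A_def
  by (intro mult_left_mono integral_le k_integrable integrable_continuous_real continuous_on_subset[OF sqrt_W_cont])
    (auto intro: k_le)

lemma Psi_1: "Psi \<omega> 1 = integral {0..1} (\<lambda>t. sqrt (W t))"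
  by (simp add: Psi_def W_def)

lemma A_0: "A 0 = 2 * Psi \<omega> 1"
  by (simp add: A_def Psi_1 k_0[abs_def])

lemma Psi_pos: "0 < Psi \<omega> 1"
proof -
  have "0 \<le> Psi \<omega> 1"
    unfolding Psi_1 by (intro integral_nonneg integrable_continuous_real sqrt_W_cont) (auto intro: W_nonneg)
  moreover have "Psi \<omega> 1 \<noteq> 0"
  proof
    assume "Psi \<omega> 1 = 0"
    then have "\<forall>t\<in>{0..1}. sqrt (W t) = 0"
      unfolding Psi_1 by (subst (asm) integral_eq_0_iff[OF sqrt_W_cont]) (auto intro: W_nonneg)
    then show False using W_pos[of 0] by auto
  qed
  ultimately show ?thesis by simp
qed

lemma A_tendsto_1: "(A \<longlongrightarrow> 0) (at_left 1)"
proof (rule tendsto_sandwich[where f="\<lambda>_. 0" and h="\<lambda>m. 2 * integral {m..1} (\<lambda>t. sqrt (W t))"])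
  have c: "continuous_on {0..1} (\<lambda>m. integral {m..1} (\<lambda>t. sqrt (W t)))"
    by (rule indefinite_integral_continuous_1') (rule integrable_continuous_real[OF sqrt_W_cont])
  then have "((\<lambda>m. integral {m..1} (\<lambda>t. sqrt (W t))) \<longlongrightarrow> integral {1..1} (\<lambda>t. sqrt (W t))) (at 1 within {0..1})"
    unfolding continuous_on_def by (rule bspec) simp
  then have "((\<lambda>m. integral {m..1} (\<lambda>t. sqrt (W t))) \<longlongrightarrow> 0) (at_left 1)"
    by (simp add: at_within_Icc_at_left)
  then show "((\<lambda>m. 2 * integral {m..1} (\<lambda>t. sqrt (W t))) \<longlongrightarrow> 0) (at_left 1)"
    using tendsto_mult_left[of _ 0 _ "2::real"] by fastforce
  have ev: "\<forall>\<^sub>F m in at_left 1. 0 < m \<and> m < (1::real)"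
    using eventually_at_left_real[of 0 1] by auto
  show "\<forall>\<^sub>F m in at_left 1. 0 \<le> A m" using ev by eventually_elim (auto intro: A_nonneg)
  show "\<forall>\<^sub>F m in at_left 1. A m \<le> 2 * integral {m..1} (\<lambda>t. sqrt (W t))" using ev by eventually_elim (auto intro: A_le)
qed simp

lemma A_tendsto_0: "(A \<longlongrightarrow> 2 * Psi \<omega> 1) (at_right 0)"
proof (rule tendsto_at_right_sequentially[of _ 1])
  fix S :: "nat \<Rightarrow> real" assume S: "\<And>n. 0 < S n" "\<And>n. S n < 1" "S \<longlonglongrightarrow> 0"
  define f where "f n t = (if t \<in> {S n..1} then k (S n) t else 0)" for n t
  have fh: "(f n has_integral integral {S n..1} (k (S n))) {0..1}" for n
    unfolding f_def
    by (subst has_integral_restrict) (use S(1,2)[of n] k_integrable[of "S n"] less_imp_le in \<open>auto intro!: integrable_integral\<close>)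
  then have fi: "f n integrable_on {0..1}" for n by blast
  have fI: "integral {0..1} (f n) = integral {S n..1} (k (S n))" for n
    using fh by (rule integral_unique)
  \<comment> \<open>The pointwise limit at t = 0 is 0, since every lower end \<open>S n\<close> is
    positive; this single value does not affect the integral.\<close>
  have "(\<lambda>n. integral {0..1} (f n)) \<longlonglongrightarrow> integral {0..1} (\<lambda>t. if t = 0 then 0 else sqrt (W t))"
  proof (rule dominated_convergence(2)[where h="\<lambda>t. sqrt (W t)"])
    show "f n integrable_on {0..1}" for n by (rule fi)
    show "(\<lambda>t. sqrt (W t)) integrable_on {0..1}" by (rule integrable_continuous_real[OF sqrt_W_cont])
    show "norm (f n t) \<le> sqrt (W t)" if "t \<in> {0..1}" for n t
      using that k_le[of "S n" t] k_nonneg[of t "S n"] S(1,2)[of n] W_nonneg[of t] by (auto simp: f_def)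
    show "(\<lambda>n. f n t) \<longlonglongrightarrow> (if t = 0 then 0 else sqrt (W t))" if t: "t \<in> {0..1}" for t
    proof (cases "0 < t \<and> t < 1")
      case True
      have "((\<lambda>x. \<theta> x) \<longlongrightarrow> \<theta> 0) (at 0 within {0..<1})" using th_cont unfolding continuous_on_def by (rule bspec) simp
      moreover have "filterlim S (at 0 within {0..<1}) sequentially"
        unfolding filterlim_at using S less_imp_le by (auto intro!: always_eventually simp: less_imp_neq[symmetric])
      ultimately have "(\<lambda>n. \<theta> (S n)) \<longlonglongrightarrow> \<theta> 0" by (rule filterlim_compose)
      then have "(\<lambda>n. \<theta> (S n)) \<longlonglongrightarrow> 0" by simp
      then have "(\<lambda>n. k (S n) t) \<longlonglongrightarrow> sqrt (W t * max 0 (1 - 0 / \<theta> t))"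
        unfolding k_def using True th_pos[of t] by (intro tendsto_intros) auto
      moreover have "\<forall>\<^sub>F n in sequentially. k (S n) t = f n t"
        using order_tendstoD(2)[OF S(3), of t, OF conjunct1[OF True]]
        by eventually_elim (use True in \<open>auto simp: f_def\<close>)
      ultimately show ?thesis using True by (auto intro: Lim_transform_eventually)
    next
      case False
      have "f n t = 0" for n using False t S(1)[of n] by (auto simp: f_def)
      then show ?thesis using False t by (auto simp: not_less)
    qed
  qed
  also have "integral {0..1} (\<lambda>t. if t = 0 then 0 else sqrt (W t)) = Psi \<omega> 1"
    unfolding Psi_1 by (rule integral_spike[of "{0}"]) auto
  finally have "(\<lambda>n. 2 * integral {0..1} (f n)) \<longlonglongrightarrow> 2 * Psi \<omega> 1" by (intro tendsto_intros)
  then show "(\<lambda>n. A (S n)) \<longlonglongrightarrow> 2 * Psi \<omega> 1" by (simp add: fI A_def)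
qed simp


section \<open>The integral \<Phi>: relation to A, finiteness and continuity\<close>

lemma Phi_dw: "Phi l Q \<omega> x = 2 * (\<integral>\<^sup>+t. ennreal (dw x t) \<partial>lebesgue_on {x<..<1})"
  unfolding Phi_def dw_def W_def ..

lemma dw_cont:
  assumes x: "0 < x"
  shows "continuous_on {x<..<1} (dw x)"
proof -
  have "\<theta> t * (\<theta> t - \<theta> x) \<noteq> 0" if "t \<in> {x<..<1}" for t
    using th_pos[of t] th_strict_mono[of x t] x that by auto
  moreover have "continuous_on {x<..<1} W" by (rule continuous_on_subset[OF W_cont]) (use x in auto)
  moreover have "continuous_on {x<..<1} \<theta>" by (rule continuous_on_subset[OF th_cont]) (use x in auto)
  ultimately show ?thesis unfolding dw_def[abs_def] by (intro continuous_intros) auto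
qed

lemma th_diff_deriv:
  assumes "0 < x" "x < 1" "\<theta> x < \<theta> t"
  shows "((\<lambda>x. - 2 * sqrt (\<theta> t - \<theta> x)) has_real_derivative deriv \<theta> x / sqrt (\<theta> t - \<theta> x)) (at x)"
  using assms by (auto intro!: derivative_eq_intros th_deriv simp: field_simps)

lemma inner_has_integral:
  assumes "0 < m1" "m1 \<le> c" "c \<le> t" "t < 1"
  shows "((\<lambda>x. deriv \<theta> x / sqrt (\<theta> t - \<theta> x)) has_integral 2 * sqrt (\<theta> t - \<theta> m1) - 2 * sqrt (\<theta> t - \<theta> c)) {m1..c}"
proof -
  have "((\<lambda>x. deriv \<theta> x / sqrt (\<theta> t - \<theta> x)) has_integral (- 2 * sqrt (\<theta> t - \<theta> c)) - (- 2 * sqrt (\<theta> t - \<theta> m1))) {m1..c}"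
  \<comment> \<open>For c = t the integrand is singular at the right end, so differentiability of
    the antiderivative is used only in the interior.\<close>
  proof (rule fundamental_theorem_of_calculus_interior)
    show "continuous_on {m1..c} (\<lambda>x. - 2 * sqrt (\<theta> t - \<theta> x))"
      by (intro continuous_intros continuous_on_subset[OF th_cont]) (use assms in auto)
    show "((\<lambda>x. - 2 * sqrt (\<theta> t - \<theta> x)) has_vector_derivative deriv \<theta> x / sqrt (\<theta> t - \<theta> x)) (at x)"
      if "x \<in> {m1<..<c}" for x
      using th_diff_deriv[of x t] th_strict_mono[of x t] that assms
      by (simp add: has_real_derivative_iff_has_vector_derivative)
  qed (use assms in auto)
  then show ?thesis by (simp add: algebra_simps)
qed

lemma q_has_integral:
  assumes "0 < m1" "m1 \<le> m2" "m2 < 1"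
  shows "((\<lambda>x. deriv \<theta> x / (2 * sqrt (\<theta> x))) has_integral sqrt (\<theta> m2) - sqrt (\<theta> m1)) {m1..m2}"
proof (rule fundamental_theorem_of_calculus_interior)
  show "continuous_on {m1..m2} (\<lambda>x. sqrt (\<theta> x))"
    by (intro continuous_intros continuous_on_subset[OF th_cont]) (use assms in auto)
  fix x assume x: "x \<in> {m1<..<m2}"
  have "((\<lambda>x. sqrt (\<theta> x)) has_real_derivative deriv \<theta> x / (2 * sqrt (\<theta> x))) (at x)"
    by (rule DERIV_cong[OF DERIV_chain2[OF DERIV_real_sqrt th_deriv]])
      (use x assms th_pos[of x] in \<open>auto simp: field_simps\<close>)
  then show "((\<lambda>x. sqrt (\<theta> x)) has_vector_derivative deriv \<theta> x / (2 * sqrt (\<theta> x))) (at x)"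
    by (simp add: has_real_derivative_iff_has_vector_derivative)
qed (use assms in auto)

text \<open>The relation \<open>A' = - \<Phi> (\<theta>\<^sup>1\<^sup>/\<^sup>2)'\<close> in integrated form, obtained by exchanging the order of integration.\<close>

lemma Phi_integral:
  assumes m: "0 < m1" "m1 < m2" "m2 < 1"
  shows "(\<integral>\<^sup>+x. Phi l Q \<omega> x * ennreal (deriv \<theta> x / (2 * sqrt (\<theta> x))) \<partial>lebesgue_on {m1<..<m2}) = ennreal (A m1 - A m2)"
proof -
  \<comment> \<open>\<open>G x t\<close> is minus the x-derivative of \<open>2 * k x t\<close>.
    Integrated over t in (x, 1) it gives \<open>\<Phi> x\<close> times the derivative of sqrt
    \<theta>, integrated over x it gives a difference of values of k.\<close>
  define G where "G x t = sqrt (W t / \<theta> t) * (deriv \<theta> x / sqrt (\<theta> t - \<theta> x))" for x t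
  define Om where "Om = {p::real \<times> real. m1 < fst p \<and> fst p < m2 \<and> fst p < snd p \<and> snd p < 1}"
  have Oo: "open Om" unfolding Om_def by (intro open_Collect_conj open_Collect_less continuous_intros)
  have Om01: "0 < fst p" "fst p < 1" "0 < snd p" "snd p < 1" "fst p < snd p" if "p \<in> Om" for p
    using that m by (auto simp: Om_def)
  have c1: "continuous_on Om (\<lambda>p. W (snd p))"
    by (rule continuous_on_compose2[OF W_cont continuous_on_snd[OF continuous_on_id]]) (use m in \<open>auto simp: Om_def\<close>)
  have c2: "continuous_on Om (\<lambda>p. \<theta> (snd p))" 
    by (rule continuous_on_compose2[OF th_cont continuous_on_snd[OF continuous_on_id]]) (use m in \<open>auto simp: Om_def\<close>)
  have c3: "continuous_on Om (\<lambda>p. \<theta> (fst p))" 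
    by (rule continuous_on_compose2[OF th_cont continuous_on_fst[OF continuous_on_id]]) (use m in \<open>auto simp: Om_def\<close>)
  have c4: "continuous_on Om (\<lambda>p. deriv \<theta> (fst p))" 
    by (rule continuous_on_compose2[OF th_deriv_cont continuous_on_fst[OF continuous_on_id]]) (use m in \<open>auto simp: Om_def\<close>)
  have nz: "\<theta> (snd p) \<noteq> 0" "\<theta> (snd p) - \<theta> (fst p) \<noteq> 0" if "p \<in> Om" for p
    using th_pos[of "snd p"] th_strict_mono[of "fst p" "snd p"] Om01[OF that] by auto
  have Gc: "continuous_on Om (\<lambda>p. G (fst p) (snd p))"
    unfolding G_def by (intro continuous_intros c1 c2 c3 c4) (use nz in auto)
  have meas: "(\<lambda>p. indicator Om p *\<^sub>R G (fst p) (snd p)) \<in> borel_measurable borel"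
    using borel_measurable_continuous_on_indicator[OF _ Gc] Oo by auto
  define F where "F x t = ennreal (indicator Om (x, t) * G x t)" for x t
  have Fm: "(\<lambda>(x, t). F x t) \<in> borel_measurable (lborel \<Otimes>\<^sub>M lborel)"
    using meas unfolding F_def split_beta by (simp add: lborel_prod)
  have fub: "(\<integral>\<^sup>+t. (\<integral>\<^sup>+x. F x t \<partial>lborel) \<partial>lborel) = (\<integral>\<^sup>+x. (\<integral>\<^sup>+t. F x t \<partial>lborel) \<partial>lborel)"
    by (rule lborel_pair.Fubini'[OF Fm])
  have G0: "0 \<le> G x t" if "(x, t) \<in> Om" for x t
    using Om01[OF that] th_pos[of t] th_deriv_pos[of x] th_strict_mono[of x t] W_nonneg[of t] by (auto simp: G_def)
  have left: "(\<integral>\<^sup>+t. F x t \<partial>lborel) = Phi l Q \<omega> x * ennreal (deriv \<theta> x / (2 * sqrt (\<theta> x))) * indicator {m1<..<m2} x" for x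
  proof (cases "x \<in> {m1<..<m2}")
    case False
    then have "F x t = 0" for t by (auto simp: F_def Om_def indicator_def)
    then show ?thesis using False by simp
  next
    case True
    then have x: "0 < x" "x < 1" using m by auto
    have "(\<integral>\<^sup>+t. F x t \<partial>lborel) = (\<integral>\<^sup>+t. ennreal (G x t) \<partial>lebesgue_on {x<..<1})"
      unfolding nn_integral_lebesgue_on_Ioo
      by (rule nn_integral_cong) (use True in \<open>auto simp: F_def Om_def indicator_def\<close>)
    also have "\<dots> = (\<integral>\<^sup>+t. ennreal (deriv \<theta> x / (2 * sqrt (\<theta> x))) * (2 * ennreal (dw x t)) \<partial>lebesgue_on {x<..<1})"
    proof (rule nn_integral_cong)
      fix t assume "t \<in> space (lebesgue_on {x<..<1})"
      then have t: "x < t" "t < 1" by auto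
      have p: "0 < \<theta> x" "0 < \<theta> t" "0 < \<theta> t - \<theta> x" "0 \<le> W t" "0 < deriv \<theta> x"
        using th_pos[of x] th_pos[of t] th_strict_mono[of x t] W_nonneg[of t] th_deriv_pos[of x] x t by auto
      have e: "dw x t = sqrt (\<theta> x) * (sqrt (W t / \<theta> t) / sqrt (\<theta> t - \<theta> x))"
        unfolding dw_def by (simp only: real_sqrt_mult real_sqrt_divide times_divide_eq_right times_divide_eq_left divide_divide_eq_left)
      have "a * (d / c) = d / (2 * r) * (2 * (r * (a / c)))" if "r \<noteq> 0" for a d c r :: real
        using that by simp
      then have Gx: "G x t = (deriv \<theta> x / (2 * sqrt (\<theta> x))) * (2 * dw x t)"
        unfolding e G_def using p by simp
      have E: "ennreal (a * (2 * b)) = ennreal a * (2 * ennreal b)" if "0 \<le> a" "0 \<le> b" for a b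
        using that by (simp add: ennreal_mult)
      have "0 \<le> dw x t" unfolding e using p by simp
      then show "ennreal (G x t) = ennreal (deriv \<theta> x / (2 * sqrt (\<theta> x))) * (2 * ennreal (dw x t))"
        unfolding Gx using p by (intro E) auto
    qed
    also have "\<dots> = ennreal (deriv \<theta> x / (2 * sqrt (\<theta> x))) * Phi l Q \<omega> x"
    proof -
      have m: "dw x \<in> borel_measurable (lebesgue_on {x<..<1})"
        by (rule continuous_imp_measurable_on_sets_lebesgue[OF dw_cont[OF x(1)]]) simp
      have "(\<integral>\<^sup>+t. c * (2 * ennreal (dw x t)) \<partial>lebesgue_on {x<..<1}) = c * Phi l Q \<omega> x" for c
        unfolding Phi_dw using m by (simp add: nn_integral_cmult)
      then show ?thesis .
    qed
    finally show ?thesis using True by (simp add: mult.commute)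
  qed
  have right: "(\<integral>\<^sup>+x. F x t \<partial>lborel) = ennreal (2 * (k m1 t - k m2 t)) * indicator {m1<..<1} t" for t
  proof (cases "t \<in> {m1<..<1}")
    case False
    then have "F x t = 0" for x by (auto simp: F_def Om_def indicator_def)
    then show ?thesis using False by simp
  next
    case True
    \<comment> \<open>For fixed t the variable x runs up to min m2 t. If t < m2 the boundary term at
      the upper end vanishes, in agreement with \<open>k m2 t = 0\<close>.\<close>
    define c where "c = min m2 t"
    have c: "m1 < c" "c \<le> t" "t < 1" "c \<le> m2" using True m by (auto simp: c_def)
    have I: "((\<lambda>x. G x t) has_integral sqrt (W t / \<theta> t) * (2 * sqrt (\<theta> t - \<theta> m1) - 2 * sqrt (\<theta> t - \<theta> c))) {m1..c}"
      unfolding G_def by (intro has_integral_mult_right inner_has_integral) (use m c in auto)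
    have "(\<integral>\<^sup>+x. F x t \<partial>lborel) = (\<integral>\<^sup>+x. ennreal (G x t) \<partial>lebesgue_on {m1<..<c})"
      unfolding nn_integral_lebesgue_on_Ioo
      by (rule nn_integral_cong) (use True in \<open>auto simp: F_def Om_def indicator_def c_def\<close>)
    also have "\<dots> = ennreal (sqrt (W t / \<theta> t) * (2 * sqrt (\<theta> t - \<theta> m1) - 2 * sqrt (\<theta> t - \<theta> c)))"
      by (rule nn_integral_lebesgue_on_has_integral[OF I]) (use c True in \<open>auto intro!: G0 simp: Om_def\<close>)
    also have "sqrt (W t / \<theta> t) * (2 * sqrt (\<theta> t - \<theta> m1) - 2 * sqrt (\<theta> t - \<theta> c)) = 2 * (k m1 t - k m2 t)"
    proof -
      have p: "0 < \<theta> t" "0 \<le> W t" "\<theta> m1 \<le> \<theta> t" "0 < t" "t < 1"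
        using th_pos[of t] W_nonneg[of t] th_mono[of m1 t] True m by auto
      have e: "k x t = sqrt (W t / \<theta> t) * sqrt (\<theta> t - \<theta> x)" if "0 < x" "x \<le> t" for x
      proof -
        have "\<theta> x \<le> \<theta> t" using th_mono[of x t] that p by auto
        then have "W t * max 0 (1 - \<theta> x / \<theta> t) = (W t / \<theta> t) * (\<theta> t - \<theta> x)"
          using p by (simp add: max_def field_simps)
        then show ?thesis unfolding k_def by (simp only: real_sqrt_mult[symmetric])
      qed
      have "k m2 t = sqrt (W t / \<theta> t) * sqrt (\<theta> t - \<theta> c)"
      proof (cases "m2 \<le> t")
        case True then show ?thesis using e[of m2] m by (simp add: c_def)
      next
        case False then show ?thesis using k_eq_0[of t m2] m p by (simp add: c_def)
      qed
      then show ?thesis using e[of m1] m True by (simp add: algebra_simps)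
    qed
    finally show ?thesis using True by simp
  qed
  have kk: "k m1 t - k m2 t \<ge> 0" if "m1 < t" "t < 1" for t
  proof -
    have "\<theta> m1 \<le> \<theta> m2" "0 < \<theta> t" using th_mono[of m1 m2] th_pos[of t] m that by auto
    then have "max 0 (1 - \<theta> m2 / \<theta> t) \<le> max 0 (1 - \<theta> m1 / \<theta> t)" by (simp add: divide_right_mono max.coboundedI2 max.mono)
    then show ?thesis using W_nonneg[of t] that m by (simp add: k_def mult_left_mono)
  qed
  have k2: "(k m2 has_integral integral {m2..1} (k m2)) {m1..1}"
  proof -
    have a: "(k m2 has_integral integral {m2..1} (k m2)) {m2..1}"
      by (rule integrable_integral) (use k_integrable[of m2] m in auto)
    have b: "(k m2 has_integral 0) {m1..m2}"
      by (rule has_integral_eq[of _ "\<lambda>_. 0"]) (use k_eq_0[of _ m2] m in auto)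
    show ?thesis using has_integral_combine[OF _ _ b a] m by simp
  qed
  have k1: "(k m1 has_integral integral {m1..1} (k m1)) {m1..1}"
    by (rule integrable_integral) (use k_integrable[of m1] m in auto)
  have "((\<lambda>t. 2 * (k m1 t - k m2 t)) has_integral 2 * (integral {m1..1} (k m1) - integral {m2..1} (k m2))) {m1..1}"
    by (intro has_integral_mult_right has_integral_diff k1 k2)
  then have I: "((\<lambda>t. 2 * (k m1 t - k m2 t)) has_integral A m1 - A m2) {m1..1}"
    by (simp add: A_def algebra_simps)
  have "(\<integral>\<^sup>+t. ennreal (2 * (k m1 t - k m2 t)) \<partial>lebesgue_on {m1<..<1}) = ennreal (A m1 - A m2)"
    by (rule nn_integral_lebesgue_on_has_integral[OF I]) (use kk in auto)
  then show ?thesis using fub unfolding left right nn_integral_lebesgue_on_Ioo by simp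
qed

text \<open>The increment of \<theta> has to dominate t - x uniformly in x. Near x this follows from
  a positive minimum of the derivative on a compact interval; towards 1, where the derivative is not
  controlled, monotonicity of \<theta> replaces it. With t - x = (1 - x) y^2 the square root then
  cancels against the factor y.\<close>

lemma J_bound:
  assumes cd: "0 < c" "c \<le> d" "d < 1"
  obtains B where "0 < B" "\<And>x y. c \<le> x \<Longrightarrow> x \<le> d \<Longrightarrow> 0 < y \<Longrightarrow> y < 1 \<Longrightarrow> 0 \<le> J x y \<and> J x y \<le> B"
proof -
  define e where "e = (d + 1) / 2"
  have e: "d < e" "e < 1" using cd by (auto simp: e_def)
  have "continuous_on {c..e} (deriv \<theta>)" by (rule continuous_on_subset[OF th_deriv_cont]) (use cd e in auto)
  then obtain z where z: "z \<in> {c..e}" "\<forall>x\<in>{c..e}. deriv \<theta> z \<le> deriv \<theta> x"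
    using continuous_attains_inf[of "{c..e}" "deriv \<theta>"] cd e by auto
  define \<mu> where "\<mu> = deriv \<theta> z"
  have \<mu>: "0 < \<mu>" using th_deriv_pos[of z] z cd e by (auto simp: \<mu>_def)
  have le1: "\<mu> * (t - x) \<le> \<theta> t - \<theta> x" if "c \<le> x" "x < t" "t \<le> e" for x t
  proof -
    have "\<exists>z. z > x \<and> z < t \<and> \<theta> t - \<theta> x = (t - x) * deriv \<theta> z"
      by (rule MVT2) (use that cd e th_deriv in auto)
    then obtain y where y: "x < y" "y < t" "\<theta> t - \<theta> x = (t - x) * deriv \<theta> y" by blast
    have "\<mu> \<le> deriv \<theta> y" using z(2) y that by (auto simp: \<mu>_def)
    then show ?thesis using y that by (simp add: mult.commute mult_right_mono)
  qed
  \<comment> \<open>The factor e - d serves both ranges of t: it is at most 1, so C \<le> \<mu> for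
    t \<le> e; beyond e the increment of \<theta> is at least \<mu> (e - x), hence at least C, while
    t - x is at most 1.\<close>
  define C where "C = \<mu> * (e - d)"
  have C: "0 < C" using \<mu> e by (simp add: C_def)
  have lower: "C * (t - x) \<le> \<theta> t - \<theta> x" if "c \<le> x" "x \<le> d" "x < t" "t < 1" for x t
  proof (cases "t \<le> e")
    case True
    have "e - d \<le> 1" using e cd by auto
    then have "C \<le> \<mu>" using \<mu> by (simp add: C_def mult_left_le)
    then have "C * (t - x) \<le> \<mu> * (t - x)" using that by (intro mult_right_mono) auto
    then show ?thesis using le1[OF that(1,3) True] by linarith
  next
    case False
    have "C * (t - x) \<le> C" using C that cd by (simp add: mult_left_le)
    also have "C \<le> \<mu> * (e - x)" using \<mu> that by (simp add: C_def)
    also have "\<dots> \<le> \<theta> e - \<theta> x" using le1[of x e] that e by auto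
    also have "\<dots> \<le> \<theta> t - \<theta> x" using th_mono[of e t] False that cd e by auto
    finally show ?thesis .
  qed
  obtain w where w: "0 < w" "\<And>t. 0 \<le> t \<Longrightarrow> t \<le> 1 \<Longrightarrow> \<bar>W t\<bar> \<le> w"
    using continuous_bounded_Ioo[OF W_cont] by blast
  define B where "B = 2 * sqrt (w / C)"
  show ?thesis
  proof (rule that[of B])
    show "0 < B" using w C by (simp add: B_def)
    fix x y assume xy: "c \<le> x" "x \<le> d" "0 < y" "y < (1::real)"
    define t where "t = x + (1 - x) * y\<^sup>2"
    have y2: "0 < y\<^sup>2" "y\<^sup>2 < 1" using xy by (auto simp: power_less_one_iff)
    have t: "x < t" "t < 1"
    proof -
      show "x < t" using xy y2 cd by (simp add: t_def)
      have "(1 - x) * y\<^sup>2 < (1 - x) * 1" by (rule mult_strict_left_mono) (use xy y2 cd in auto)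
      then show "t < 1" unfolding t_def by (simp only: mult_1_right less_diff_eq add.commute)
    qed
    have p: "0 < \<theta> x" "0 < \<theta> t" "\<theta> x \<le> \<theta> t" "0 < \<theta> t - \<theta> x" "0 \<le> W t" "W t \<le> w"
      using th_pos[of x] th_pos[of t] th_strict_mono[of x t] W_nonneg[of t] w(2)[of t] xy cd t by auto
    have J0: "0 \<le> J x y" using p xy cd by (auto simp: J_def dw_def t_def[symmetric] intro!: mult_nonneg_nonneg)
    have Ct: "0 < C * (t - x)" using C t by simp
    have "\<theta> x * W t / (\<theta> t * (\<theta> t - \<theta> x)) = (\<theta> x / \<theta> t) * (W t / (\<theta> t - \<theta> x))" by simp
    also have "\<dots> \<le> 1 * (W t / (\<theta> t - \<theta> x))" by (rule mult_right_mono) (use p in auto)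
    also have "\<dots> \<le> w / (C * (t - x))"
      using frac_le[of w "W t" "C * (t - x)" "\<theta> t - \<theta> x"] p w Ct lower[of x t] xy t by auto
    finally have "dw x t \<le> sqrt (w / (C * (t - x)))" by (simp add: dw_def)
    also have "\<dots> = sqrt (w / C) / (sqrt (1 - x) * y)"
      using xy by (simp add: t_def real_sqrt_divide real_sqrt_mult)
    finally have "dw x t \<le> sqrt (w / C) / (sqrt (1 - x) * y)" .
    then have "J x y \<le> sqrt (w / C) / (sqrt (1 - x) * y) * (2 * (1 - x) * y)"
      unfolding J_def t_def[symmetric] by (rule mult_right_mono) (use xy cd in auto)
    also have "\<dots> = sqrt (w / C) * 2 * sqrt (1 - x)"
    proof -
      define r where "r = sqrt (1 - x)"
      have r: "1 - x = r * r" "r \<noteq> 0" using xy cd by (auto simp: r_def)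
      show ?thesis unfolding r_def[symmetric] unfolding r(1) using r(2) xy by (simp add: field_simps)
    qed
    also have "\<dots> \<le> B"
    proof -
      have "sqrt (1 - x) \<le> 1" using xy cd by simp
      moreover have "0 \<le> sqrt (w / C) * 2" using w C by simp
      ultimately show ?thesis unfolding B_def using mult_left_le[of "sqrt (1 - x)" "sqrt (w / C) * 2"] by (simp add: mult.commute)
    qed
    finally show "0 \<le> J x y \<and> J x y \<le> B" using J0 by simp
  qed
qed

lemma curve_in: "0 \<le> x \<Longrightarrow> x < 1 \<Longrightarrow> 0 < y \<Longrightarrow> y < 1 \<Longrightarrow> x < x + (1 - x) * y\<^sup>2 \<and> x + (1 - x) * y\<^sup>2 < (1::real)"
proof -
  assume a: "0 \<le> x" "x < 1" "0 < y" "y < 1"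
  have y2: "0 < y\<^sup>2" "y\<^sup>2 < 1" using a by (auto simp: power_less_one_iff)
  have "(1 - x) * y\<^sup>2 < (1 - x) * 1" by (rule mult_strict_left_mono) (use a y2 in auto)
  then have "x + (1 - x) * y\<^sup>2 < 1" by (simp only: mult_1_right less_diff_eq add.commute)
  moreover have "0 < (1 - x) * y\<^sup>2" using a y2 by simp
  ultimately show ?thesis by simp
qed

lemma J_cont:
  "continuous_on {p. 0 < fst p \<and> fst p < 1 \<and> 0 < snd p \<and> snd p < 1} (\<lambda>p. J (fst p) (snd p))" (is "continuous_on ?O _")
proof -
  define T where "T p = fst p + (1 - fst p) * (snd p)\<^sup>2" for p :: "real \<times> real"
  have t: "continuous_on ?O T" unfolding T_def by (intro continuous_intros)
  have r: "0 < fst p \<and> fst p < T p \<and> T p < 1" if "p \<in> ?O" for p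
    using curve_in[of "fst p" "snd p"] that by (auto simp: T_def)
  then have r': "T p \<in> {0..<1}" "T p \<in> {0..1}" if "p \<in> ?O" for p using that by force+
  have c1: "continuous_on ?O (\<lambda>p. W (T p))"
    by (rule continuous_on_compose2[OF W_cont t]) (rule image_subsetI, erule r')
  have c2: "continuous_on ?O (\<lambda>p. \<theta> (T p))" 
    by (rule continuous_on_compose2[OF th_cont t]) (rule image_subsetI, erule r')
  have c3: "continuous_on ?O (\<lambda>p. \<theta> (fst p))" 
    by (rule continuous_on_compose2[OF th_cont continuous_on_fst[OF continuous_on_id]]) auto
  have nz: "\<theta> (T p) * (\<theta> (T p) - \<theta> (fst p)) \<noteq> 0" if "p \<in> ?O" for p
    using th_pos[of "T p"] th_strict_mono[of "fst p" "T p"] r[OF that] by auto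
  show ?thesis unfolding J_def dw_def T_def[symmetric]
    by (intro continuous_intros c1 c2 c3) (use nz in auto)
qed

lemma J_measurable:
  assumes "0 < x" "x < 1"
  shows "J x \<in> borel_measurable (lebesgue_on {0<..<1})" "continuous_on {0<..<1} (J x)"
proof -
  have "continuous_on {0<..<1} (\<lambda>y. (\<lambda>p. J (fst p) (snd p)) (x, y))"
    by (rule continuous_on_compose2[OF J_cont]) (use assms in \<open>auto intro!: continuous_intros\<close>)
  then show c: "continuous_on {0<..<1} (J x)" by simp
  show "J x \<in> borel_measurable (lebesgue_on {0<..<1})"
    by (rule continuous_imp_measurable_on_sets_lebesgue[OF c]) simp
qed

lemma J_integrable:
  assumes x: "0 < x" "x < 1"
  shows "integrable (lebesgue_on {0<..<1}) (J x)"
proof -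
  obtain B where "\<And>y. 0 < y \<Longrightarrow> y < 1 \<Longrightarrow> 0 \<le> J x y \<and> J x y \<le> B"
    using J_bound[of x x] x by (metis order_refl)
  then show ?thesis
    by (intro integrable_lebesgue_on_bounded[where B=B] J_measurable x) auto
qed

text \<open>Substitution along the parabola. Since \<open>J x\<close> is bounded, this also shows
  that \<Phi> is finite on (0, 1), so that passing to a real-valued version loses nothing.\<close>

lemma Phi_J:
  assumes x: "0 < x" "x < 1"
  shows "Phi l Q \<omega> x = ennreal (2 * (\<integral>y. J x y \<partial>lebesgue_on {0<..<1}))"
proof -
  define f where "f t = indicator {x<..<1} t * dw x t" for t
  have dc: "continuous_on {x<..<1} (dw x)"
    by (rule dw_cont) (use x in auto)
  have fm: "f \<in> borel_measurable borel"
    using borel_measurable_continuous_on_indicator[OF _ dc] by (simp add: f_def[abs_def])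
  define g where "g y = x + (1 - x) * y\<^sup>2" for y
  have J0: "0 \<le> J x y" if "0 < y" "y < 1" for y
    using J_bound[of x x] x that by (metis order_refl)
  have "(\<integral>\<^sup>+t. ennreal (dw x t) \<partial>lebesgue_on {x<..<1}) = (\<integral>\<^sup>+t. ennreal (f t * indicator {g 0..g 1} t) \<partial>lborel)"
    unfolding nn_integral_lebesgue_on_Ioo by (rule nn_integral_cong) (auto simp: f_def g_def indicator_def)
  also have "\<dots> = (\<integral>\<^sup>+y. ennreal (f (g y) * (2 * (1 - x) * y) * indicator {0..1} y) \<partial>lborel)"
  proof (rule nn_integral_substitution)
    show "set_borel_measurable borel {g 0..g 1} f"
      unfolding set_borel_measurable_def using fm by measurable
    show "(g has_real_derivative 2 * (1 - x) * y) (at y)" for y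
      unfolding g_def by (auto intro!: derivative_eq_intros)
    show "continuous_on {0..1} (\<lambda>y. 2 * (1 - x) * y)" by (intro continuous_intros)
  qed (use x in auto)
  also have "\<dots> = (\<integral>\<^sup>+y. ennreal (J x y) \<partial>lebesgue_on {0<..<1})"
    unfolding nn_integral_lebesgue_on_Ioo
  proof (rule nn_integral_cong)
    fix y :: real
    show "ennreal (f (g y) * (2 * (1 - x) * y) * indicator {0..1} y) = ennreal (J x y) * indicator {0<..<1} y"
    proof (cases "0 < y \<and> y < 1")
      case True
      then show ?thesis using curve_in[of x y] x by (simp add: f_def g_def J_def)
    next
      case False
      then consider "y < 0" | "y = 0" | "y = 1" | "y > 1" by linarith
      then show ?thesis by cases (auto simp: f_def g_def)
    qed
  qed
  also have "\<dots> = ennreal (\<integral>y. J x y \<partial>lebesgue_on {0<..<1})"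
    by (rule nn_integral_eq_integral[OF J_integrable[OF x]]) (use J0 in auto)
  finally have "Phi l Q \<omega> x = 2 * ennreal (\<integral>y. J x y \<partial>lebesgue_on {0<..<1})"
    by (simp add: Phi_dw)
  moreover have "0 \<le> (\<integral>y. J x y \<partial>lebesgue_on {0<..<1})"
    by (rule integral_nonneg_AE) (use J0 in auto)
  ultimately show ?thesis by (simp add: ennreal_mult)
qed

definition P where "P x = enn2real (Phi l Q \<omega> x)"

lemma P_eq: "0 < x \<Longrightarrow> x < 1 \<Longrightarrow> P x = 2 * (\<integral>y. J x y \<partial>lebesgue_on {0<..<1})"
  and P_nonneg: "0 \<le> P x" and Phi_P: "0 < x \<Longrightarrow> x < 1 \<Longrightarrow> Phi l Q \<omega> x = ennreal (P x)"
proof -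
  assume x: "0 < x" "x < 1"
  have J0: "0 \<le> J x y" if "0 < y" "y < 1" for y
    using J_bound[of x x] x that by (metis order_refl)
  have "0 \<le> (\<integral>y. J x y \<partial>lebesgue_on {0<..<1})"
    by (rule integral_nonneg_AE) (use J0 in auto)
  then show "P x = 2 * (\<integral>y. J x y \<partial>lebesgue_on {0<..<1})" "Phi l Q \<omega> x = ennreal (P x)"
    using Phi_J[OF x] by (simp_all add: P_def)
qed (simp add: P_def)

text \<open>Dominated convergence: after the substitution the integrands live on the fixed interval
  (0, 1) and \<open>J_bound\<close> is uniform for x in [c, d].\<close>

lemma P_cont_Icc:
  assumes cd: "0 < c" "c \<le> d" "d < 1"
  shows "continuous_on {c..d} P"
  unfolding continuous_on_sequentially
proof (intro ballI allI impI, elim conjE)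
  fix x :: real and X :: "nat \<Rightarrow> real"
  assume x: "x \<in> {c..d}" and X: "\<forall>n. X n \<in> {c..d}" "X \<longlonglongrightarrow> x"
  obtain B where B: "\<And>x y. c \<le> x \<Longrightarrow> x \<le> d \<Longrightarrow> 0 < y \<Longrightarrow> y < 1 \<Longrightarrow> 0 \<le> J x y \<and> J x y \<le> B"
    using J_bound[OF cd] by metis
  interpret N: finite_measure "lebesgue_on {0<..<1::real}" by (rule finite_measure_lebesgue_on_Ioo)
  have "(\<lambda>n. \<integral>y. J (X n) y \<partial>lebesgue_on {0<..<1}) \<longlonglongrightarrow> (\<integral>y. J x y \<partial>lebesgue_on {0<..<1})"
  proof (rule integral_dominated_convergence[where w="\<lambda>_. B"])
    show "J x \<in> borel_measurable (lebesgue_on {0<..<1})" "J (X n) \<in> borel_measurable (lebesgue_on {0<..<1})" for n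
      using x X(1)[rule_format, of n] cd by (auto intro!: J_measurable)
    show "AE y in lebesgue_on {0<..<1}. (\<lambda>n. J (X n) y) \<longlonglongrightarrow> J x y"
    proof (rule AE_I2)
      fix y :: real assume "y \<in> space (lebesgue_on {0<..<1})"
      then have y: "0 < y" "y < 1" by auto
      have "continuous_on {c..d} (\<lambda>x. (\<lambda>p. J (fst p) (snd p)) (x, y))"
        by (rule continuous_on_compose2[OF J_cont]) (use cd y in \<open>auto intro!: continuous_intros\<close>)
      then show "(\<lambda>n. J (X n) y) \<longlonglongrightarrow> J x y"
        unfolding continuous_on_sequentially using x X by (auto simp: o_def)
    qed
    show "AE y in lebesgue_on {0<..<1}. norm (J (X n) y) \<le> B" for n
      using B X(1)[rule_format, of n] by (intro AE_I2) auto
  qed auto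
  then have "(\<lambda>n. 2 * (\<integral>y. J (X n) y \<partial>lebesgue_on {0<..<1})) \<longlonglongrightarrow> 2 * (\<integral>y. J x y \<partial>lebesgue_on {0<..<1})"
    by (intro tendsto_intros)
  moreover have "0 < X n \<and> X n < 1" for n using X(1)[rule_format, of n] cd by auto
  ultimately show "(P \<circ> X) \<longlonglongrightarrow> P x"
    using x cd by (simp add: P_eq o_def)
qed

end

section \<open>Lower and upper bounds for the surface energy\<close>

lemma cdf_on_add:
  fixes f g :: "real \<Rightarrow> real"
  assumes "integrable M f" "integrable M g" "(\<lambda>x. x) \<in> borel_measurable M"
  shows "cdf_on M (\<lambda>x. f x + g x) y = cdf_on M f y + cdf_on M g y"
proof -
  have "{..y} \<inter> space M \<in> sets M"
    using measurable_sets[OF assms(3), of "{..y}"] by (simp add: vimage_def Int_def)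
  then show ?thesis unfolding cdf_on_def distrib_left
    by (intro Bochner_Integration.integral_add integrable_indicator_times assms)
qed

lemma cdf_on_mono:
  fixes f g :: "real \<Rightarrow> real"
  assumes f: "integrable M f" and id: "(\<lambda>x. x) \<in> borel_measurable M" and le: "p \<le> q"
    and fg: "\<And>x. x \<in> space M \<Longrightarrow> p < x \<Longrightarrow> x \<le> q \<Longrightarrow> f x \<le> g x" and g: "integrable M g"
  shows "cdf_on M f q - cdf_on M f p \<le> cdf_on M g q - cdf_on M g p"
proof -
  have s: "{..y} \<inter> space M \<in> sets M" for y
    using measurable_sets[OF id, of "{..y}"] by (simp add: vimage_def Int_def)
  have e: "cdf_on M h q - cdf_on M h p = (\<integral>x. indicator {..q} x * h x - indicator {..p} x * h x \<partial>M)"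
    if "integrable M h" for h
    unfolding cdf_on_def by (intro Bochner_Integration.integral_diff[symmetric] integrable_indicator_times that s)
  show ?thesis unfolding e[OF f] e[OF g]
    by (intro integral_mono Bochner_Integration.integrable_diff integrable_indicator_times f g s)
      (use le fg in \<open>auto simp: indicator_def\<close>)
qed

lemma cdf_on_abs_le:
  fixes f g :: "real \<Rightarrow> real"
  assumes f: "integrable M f" and id: "(\<lambda>x. x) \<in> borel_measurable M" and le: "p \<le> q"
    and fg: "\<And>x. x \<in> space M \<Longrightarrow> p < x \<Longrightarrow> x \<le> q \<Longrightarrow> \<bar>f x\<bar> \<le> g x" and g: "integrable M g"
  shows "\<bar>cdf_on M f q - cdf_on M f p\<bar> \<le> cdf_on M g q - cdf_on M g p"
proof -
  have n: "cdf_on M (\<lambda>x. - f x) y = - cdf_on M f y" for y by (simp add: cdf_on_def)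
  have "cdf_on M f q - cdf_on M f p \<le> cdf_on M g q - cdf_on M g p"
    by (rule cdf_on_mono[OF f id le _ g]) (use fg in force)
  moreover have "cdf_on M (\<lambda>x. - f x) q - cdf_on M (\<lambda>x. - f x) p \<le> cdf_on M g q - cdf_on M g p"
    by (rule cdf_on_mono[OF _ id le _ g]) (use fg f in force)+
  ultimately show ?thesis by (simp add: n)
qed

lemma cdf_on_const:
  assumes "a \<le> p" "p \<le> b"
  shows "cdf_on (lebesgue_on {a<..<b}) (\<lambda>_. c) p = c * (p - a)"
proof -
  have "cdf_on (lebesgue_on {a<..<b}) (\<lambda>_. c) p = c * (\<integral>x. indicator {..p} x \<partial>lebesgue_on {a<..<b})"
    unfolding cdf_on_def by (subst mult.commute) simp
  also have "(\<integral>x. indicator {..p} x \<partial>lebesgue_on {a<..<b}) = measure lebesgue ({..p} \<inter> {a<..<b})"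
    by (simp add: integral_restrict_space measure_restrict_space)
  also have "\<dots> = p - a"
  proof (cases "p = b")
    case True
    then have "{..p} \<inter> {a<..<b} = {a<..<b}" by auto
    then show ?thesis using assms True by simp
  next
    case False
    then have "{..p} \<inter> {a<..<b} = {a<..p}" using assms by auto
    then show ?thesis using assms by simp
  qed
  finally show ?thesis .
qed

text \<open>As in the BV case, u minus the distribution function of u' is constant almost
  everywhere; continuity of u makes this hold at every point, including b. On a bounded interval L^2
  is contained in L^1 because \<bar>y\<bar> \<le> 1 + y^2.\<close>

lemma H1_FTC:
  assumes ab: "a < b" and u: "H1 a b u u'"
  shows "integrable (lebesgue_on {a<..<b}) u'"
    and "\<And>x. a \<le> x \<Longrightarrow> x \<le> b \<Longrightarrow> u x = u a + cdf_on (lebesgue_on {a<..<b}) u' x"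
proof -
  let ?N = "lebesgue_on {a<..<b}"
  interpret N: finite_measure ?N by (rule finite_measure_lebesgue_on_Ioo)
  have uc: "continuous_on {a..b} u" and L2: "L2_on a b u" "L2_on a b u'" and wd: "weak_deriv a b u u'"
    using u by (auto simp: H1_def)
  have L1: "integrable ?N f" if "L2_on a b f" for f
  proof (rule Bochner_Integration.integrable_bound)
    show "integrable ?N (\<lambda>x. 1 + (f x)\<^sup>2)" using that by (auto simp: L2_on_def)
    show "f \<in> borel_measurable ?N" using that by (auto simp: L2_on_def)
    have "\<bar>y\<bar> \<le> 1 + y\<^sup>2" for y :: real
    proof -
      have "0 \<le> (\<bar>y\<bar> - 1)\<^sup>2" by simp
      then have "2 * \<bar>y\<bar> \<le> 1 + y\<^sup>2" by (simp add: power2_diff)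
      then show ?thesis by linarith
    qed
    then show "AE x in ?N. norm (f x) \<le> norm (1 + (f x)\<^sup>2)" by (auto simp: add_nonneg_nonneg)
  qed
  show u': "integrable ?N u'" by (rule L1[OF L2(2)])
  have uI: "integrable ?N u" by (rule L1[OF L2(1)])
  note id = id_borel_measurable_lebesgue_on[of "{a<..<b}"]
  let ?F = "cdf_on ?N u'"
  note FI = integrable_cdf_on[OF sigma_finite_lebesgue_on_Ioo id u', of a b]
  obtain c where c: "AE y in ?N. u y - ?F y = c"
  proof (rule du_Bois_Reymond[OF ab])
    show "integrable ?N (\<lambda>y. u y - ?F y)" using uI FI by simp
    fix \<psi> assume \<psi>: "test_fun a b \<psi>"
    note F = integral_cdf_test_fun[OF \<psi> sigma_finite_lebesgue_on_Ioo _ id u']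
    note ud = integrable_times_continuous[OF uI test_funD(2)[OF \<psi>]]
    have "(\<integral>y. (u y - ?F y) * deriv \<psi> y \<partial>?N) = (\<integral>y. u y * deriv \<psi> y - ?F y * deriv \<psi> y \<partial>?N)"
      by (simp add: algebra_simps)
    also have "\<dots> = (\<integral>y. u y * deriv \<psi> y \<partial>?N) + (\<integral>x. u' x * \<psi> x \<partial>?N)"
      using ud F by simp
    also have "\<dots> = 0" using wd \<psi> by (simp add: weak_deriv_def)
    finally show "(\<integral>y. (u y - ?F y) * deriv \<psi> y \<partial>?N) = 0" .
  qed
  have eq: "u x - ?F x = c" if x: "a \<le> x" "x < b" for x
  proof (rule ccontr)
    assume ne: "u x - ?F x \<noteq> c"
    have "(u \<longlongrightarrow> u x) (at x within {a..b})" using uc x by (auto simp: continuous_on_def)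
    then have "(u \<longlongrightarrow> u x) (at x within {x..b})" by (rule tendsto_within_subset) (use x in auto)
    then have "(u \<longlongrightarrow> u x) (at_right x)" using x by (simp add: at_within_Icc_at_right)
    then have "((\<lambda>y. u y - ?F y) \<longlongrightarrow> u x - ?F x) (at_right x)"
      by (intro tendsto_diff cdf_on_at_right u' id)
    then have "\<forall>\<^sub>F y in at_right x. u y - ?F y \<noteq> c" using ne by (rule tendsto_imp_eventually_ne)
    with frequently_ae_at_right[OF c x] show False by (simp add: frequently_def)
  qed
  have eqb: "u b - ?F b = c"
  proof -
    have "(u \<longlongrightarrow> u b) (at b within {a..b})" using uc ab by (auto simp: continuous_on_def)
    then have ub: "(u \<longlongrightarrow> u b) (at_left b)" using ab by (simp add: at_within_Icc_at_left)
    have "((\<lambda>y. u y - ?F y) \<longlongrightarrow> u b - ?F b) (at_left b)"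
      using cdf_on_ge_right[of ?N a b b u'] by (intro tendsto_diff ub) (use cdf_on_at_left[OF u' id _ ab] in simp)
    moreover have "\<forall>\<^sub>F y in at_left b. u y - ?F y = c"
      using eventually_at_left_real[OF ab] by eventually_elim (use eq in auto)
    then have "((\<lambda>y. u y - ?F y) \<longlongrightarrow> c) (at_left b)" by (rule tendsto_eventually)
    ultimately show ?thesis using tendsto_unique[of "at_left b"] by force
  qed
  have "?F a = 0" by (rule cdf_on_le_left[where a=a and b=b]) auto
  then have "u a = c" using eq[of a] ab by simp
  then show "u x = u a + ?F x" if "a \<le> x" "x \<le> b" for x
    using eq[of x] eqb that by (cases "x = b") auto
qed

text \<open>Builds competitors whose slope is bounded but need not be continuous. Boundedness yields
  all conditions of H^1 at once: the primitive is Lipschitz, and both functions are square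
  integrable.\<close>

lemma H1_primitive:
  assumes ab: "a < b" and m: "f \<in> borel_measurable (lebesgue_on {a<..<b})"
    and B: "\<And>x. a < x \<Longrightarrow> x < b \<Longrightarrow> \<bar>f x\<bar> \<le> B"
    and u: "\<And>x. a \<le> x \<Longrightarrow> x \<le> b \<Longrightarrow> u x = c + cdf_on (lebesgue_on {a<..<b}) f x"
  shows "H1 a b u f"
proof -
  let ?N = "lebesgue_on {a<..<b}"
  let ?F = "cdf_on ?N f"
  interpret N: finite_measure ?N by (rule finite_measure_lebesgue_on_Ioo)
  have f: "integrable ?N f" by (rule integrable_lebesgue_on_bounded[OF m B])
  note id = id_borel_measurable_lebesgue_on[of "{a<..<b}"]
  have B0: "0 \<le> B" using B[of "(a + b) / 2"] ab by auto
  have lip: "\<bar>?F q - ?F p\<bar> \<le> B * (q - p)" if "a \<le> p" "p \<le> q" "q \<le> b" for p q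
  proof -
    have "\<bar>?F q - ?F p\<bar> \<le> cdf_on ?N (\<lambda>_. B) q - cdf_on ?N (\<lambda>_. B) p"
      by (rule cdf_on_abs_le[OF f id]) (use that B in auto)
    then show ?thesis using that by (simp add: cdf_on_const algebra_simps)
  qed
  have "B-lipschitz_on {a..b} ?F"
  proof (rule lipschitz_onI[OF _ B0])
    fix x y assume "x \<in> {a..b}" "y \<in> {a..b}"
    then show "dist (?F x) (?F y) \<le> B * dist x y"
      using lip[of x y] lip[of y x] by (cases "x \<le> y") (auto simp: dist_real_def abs_minus_commute)
  qed
  then have "continuous_on {a..b} (\<lambda>x. c + ?F x)" by (intro continuous_intros lipschitz_on_continuous_on)
  then have uc: "continuous_on {a..b} u" by (rule continuous_on_eq) (use u in auto)
  have sq: "L2_on a b h" if "h \<in> borel_measurable ?N" "\<And>x. a < x \<Longrightarrow> x < b \<Longrightarrow> \<bar>h x\<bar> \<le> B'" for h B'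
    unfolding L2_on_def
  proof
    show "integrable ?N (\<lambda>x. (h x)\<^sup>2)"
      by (rule integrable_lebesgue_on_bounded[where B="B'\<^sup>2"]) (use that in \<open>auto simp: abs_le_square_iff[symmetric] intro: order_trans[OF _ abs_ge_self]\<close>)
  qed (rule that)
  have um: "u \<in> borel_measurable ?N"
    by (rule continuous_imp_measurable_on_sets_lebesgue[OF continuous_on_subset[OF uc]]) auto
  obtain D where D: "\<And>x. a \<le> x \<Longrightarrow> x \<le> b \<Longrightarrow> \<bar>u x\<bar> \<le> D" using continuous_bounded_Ioo[OF uc] by blast
  have "L2_on a b u" by (rule sq[OF um, where B'=D]) (use D in auto)
  moreover have "L2_on a b f" by (rule sq[OF m B])
  moreover have "weak_deriv a b u f"
    unfolding weak_deriv_def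
  proof (intro allI impI)
    fix \<psi> assume \<psi>: "test_fun a b \<psi>"
    note F = integral_cdf_test_fun[OF \<psi> sigma_finite_lebesgue_on_Ioo _ id f]
    have d: "(deriv \<psi> has_integral \<psi> b - \<psi> a) {a..b}"
      by (rule fundamental_theorem_of_calculus)
        (use ab test_funD(1)[OF \<psi>] in \<open>auto simp: has_real_derivative_iff_has_vector_derivative intro: has_vector_derivative_at_within\<close>)
    have di: "integrable ?N (\<lambda>x. c * deriv \<psi> x)"
      by (rule integrable_times_continuous[OF N.integrable_const test_funD(2)[OF \<psi>]])
    have "integrable ?N (\<lambda>x. 1 * deriv \<psi> x)"
      by (rule integrable_times_continuous[OF N.integrable_const test_funD(2)[OF \<psi>]])
    then have "(\<integral>x. deriv \<psi> x \<partial>?N) = 0"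
      using d test_funD(3)[OF \<psi>, of a] test_funD(3)[OF \<psi>, of b]
      by (simp add: lebesgue_integral_eq_integral has_integral_Icc_iff_Ioo integral_unique)
    then have "(\<integral>x. c * deriv \<psi> x + ?F x * deriv \<psi> x \<partial>?N) = - (\<integral>x. f x * \<psi> x \<partial>?N)"
      using di F by simp
    moreover have "(\<integral>x. u x * deriv \<psi> x \<partial>?N) = (\<integral>x. c * deriv \<psi> x + ?F x * deriv \<psi> x \<partial>?N)"
      by (intro Bochner_Integration.integral_cong) (use u in \<open>auto simp: algebra_simps\<close>)
    ultimately show "(\<integral>x. u x * deriv \<psi> x \<partial>?N) = - (\<integral>x. f x * \<psi> x \<partial>?N)" by simp
  qed
  ultimately show ?thesis using uc by (simp add: H1_def)
qed

lemma H1_C1: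
  assumes ab: "a < b" and d: "\<And>x. (u has_real_derivative u' x) (at x)" and c: "continuous_on UNIV u'"
  shows "H1 a b u u'"
proof -
  obtain B where B: "\<And>x. a \<le> x \<Longrightarrow> x \<le> b \<Longrightarrow> \<bar>u' x\<bar> \<le> B"
    using continuous_bounded_Ioo[OF continuous_on_subset[OF c subset_UNIV]] by blast
  have m: "u' \<in> borel_measurable (lebesgue_on {a<..<b})"
    by (rule borel_measurable_lebesgue_on_continuous[OF c])
  show ?thesis
  proof (rule H1_primitive[OF ab m, where c="u a" and B=B])
    fix x assume x: "a \<le> x" "x \<le> b"
    let ?h = "\<lambda>y. indicator {..x} y * u' y"
    have "(u' has_integral u x - u a) {a..x}"
      by (rule fundamental_theorem_of_calculus)
        (use x d in \<open>auto simp: has_real_derivative_iff_has_vector_derivative intro: has_vector_derivative_at_within\<close>)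
    then have "((\<lambda>y. if y \<in> {a..x} then u' y else 0) has_integral u x - u a) {a..b}"
      by (subst has_integral_restrict) (use x in auto)
    then have "(?h has_integral u x - u a) {a..b}"
      by (rule has_integral_eq[rotated]) auto
    then have "(?h has_integral u x - u a) {a<..<b}" by (simp add: has_integral_Icc_iff_Ioo)
    moreover have "integrable (lebesgue_on {a<..<b}) u'"
      by (rule integrable_lebesgue_on_bounded[OF m, where B=B]) (use B in auto)
    then have "integrable (lebesgue_on {a<..<b}) ?h"
      by (rule integrable_indicator_times) (auto simp: sets_restrict_space)
    ultimately show "u x = u a + cdf_on (lebesgue_on {a<..<b}) u' x"
      unfolding cdf_on_def by (simp add: lebesgue_integral_eq_integral integral_unique)
  qed (use B in auto)
qed

text \<open>Patching local estimates together avoids differentiating \<open>v\<close> almost everywhere.\<close>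

lemma chain_inequality:
  fixes v v' K \<kappa> :: "real \<Rightarrow> real"
  assumes ab: "a < b" and v': "integrable (lebesgue_on {a<..<b}) v'"
    and v: "\<And>x. a \<le> x \<Longrightarrow> x \<le> b \<Longrightarrow> v x = v a + cdf_on (lebesgue_on {a<..<b}) v' x"
    and vc: "continuous_on {a..b} v" and range: "\<And>x. a \<le> x \<Longrightarrow> x \<le> b \<Longrightarrow> c \<le> v x \<and> v x \<le> d"
    and K: "\<And>t. c \<le> t \<Longrightarrow> t \<le> d \<Longrightarrow> (K has_real_derivative \<kappa> t) (at t within {c..d})"
    and \<kappa>: "continuous_on {c..d} \<kappa>" "\<And>t. c \<le> t \<Longrightarrow> t \<le> d \<Longrightarrow> 0 \<le> \<kappa> t"
    and pq: "a \<le> p" "p \<le> q" "q \<le> b"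
  shows "integrable (lebesgue_on {a<..<b}) (\<lambda>x. \<kappa> (v x) * \<bar>v' x\<bar>)"
    and "\<bar>K (v q) - K (v p)\<bar> \<le> cdf_on (lebesgue_on {a<..<b}) (\<lambda>x. \<kappa> (v x) * \<bar>v' x\<bar>) q
      - cdf_on (lebesgue_on {a<..<b}) (\<lambda>x. \<kappa> (v x) * \<bar>v' x\<bar>) p"
proof -
  let ?N = "lebesgue_on {a<..<b}"
  note id = id_borel_measurable_lebesgue_on[of "{a<..<b}"]
  have kvc: "continuous_on {a..b} (\<lambda>x. \<kappa> (v x))"
    by (rule continuous_on_compose2[OF \<kappa>(1) vc]) (use range in auto)
  have absv': "integrable ?N (\<lambda>x. \<bar>v' x\<bar>)" using v' by simp
  show int: "integrable ?N (\<lambda>x. \<kappa> (v x) * \<bar>v' x\<bar>)"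
  proof -
    obtain B where B: "0 < B" "\<And>x. a \<le> x \<Longrightarrow> x \<le> b \<Longrightarrow> \<bar>\<kappa> (v x)\<bar> \<le> B"
      using continuous_bounded_Ioo[OF kvc] by blast
    have "integrable ?N (\<lambda>x. B * \<bar>v' x\<bar>)" using absv' by simp
    then show ?thesis
    proof (rule Bochner_Integration.integrable_bound)
      have "(\<lambda>x. \<kappa> (v x)) \<in> borel_measurable ?N"
        by (rule continuous_imp_measurable_on_sets_lebesgue[OF continuous_on_subset[OF kvc]]) auto
      then show "(\<lambda>x. \<kappa> (v x) * \<bar>v' x\<bar>) \<in> borel_measurable ?N" using absv' by (intro borel_measurable_times) auto
    qed (use B in \<open>auto simp: abs_mult intro!: AE_I2 mult_right_mono\<close>)
  qed
  define D where "D f p q = cdf_on ?N f q - cdf_on ?N f p" for f p q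
  \<comment> \<open>The slack e absorbs the oscillation of \<kappa> along v on short intervals; it
    is sent to 0 at the end.\<close>
  have main: "\<bar>K (v q) - K (v p)\<bar> \<le> D (\<lambda>x. \<kappa> (v x) * \<bar>v' x\<bar>) p q + e * D (\<lambda>x. \<bar>v' x\<bar>) p q" if e: "0 < e" for e
  proof -
    define f where "f x = \<kappa> (v x) * \<bar>v' x\<bar> + e * \<bar>v' x\<bar>" for x
    have fI: "integrable ?N f" unfolding f_def using int absv' by simp
    \<comment> \<open>The estimate is compatible with concatenation of intervals, so
      \<open>Bolzano\<close> reduces it to short intervals around a single point.\<close>
    have "a \<le> p \<and> q \<le> b \<longrightarrow> \<bar>K (v q) - K (v p)\<bar> \<le> D f p q"
      using pq(2)
    proof (induction p q rule: Bolzano)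
      case (trans a b c)
      then show ?case unfolding D_def by auto
    next
      case (local x)
      show ?case
      proof (cases "a \<le> x \<and> x \<le> b")
        case False then show ?thesis by (intro exI[of _ 1]) auto
      next
        case True
        have "continuous (at (v x) within {c..d}) \<kappa>" using \<kappa>(1) range[of x] True by (simp add: continuous_on_eq_continuous_within)
        then obtain \<eta> where \<eta>: "0 < \<eta>" "\<And>t. t \<in> {c..d} \<Longrightarrow> \<bar>t - v x\<bar> < \<eta> \<Longrightarrow> \<bar>\<kappa> t - \<kappa> (v x)\<bar> < e / 2"
          using e unfolding continuous_within_eps_delta dist_real_def by (metis half_gt_zero)
        have "continuous (at x within {a..b}) v" using vc True by (simp add: continuous_on_eq_continuous_within)
        then obtain \<delta> where \<delta>: "0 < \<delta>" "\<And>y. y \<in> {a..b} \<Longrightarrow> \<bar>y - x\<bar> < \<delta> \<Longrightarrow> \<bar>v y - v x\<bar> < \<eta>"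
          using \<eta>(1) unfolding continuous_within_eps_delta dist_real_def by metis
        have "\<bar>K (v q) - K (v p)\<bar> \<le> D f p q" if h: "p \<le> x" "x \<le> q" "q - p < \<delta>" "a \<le> p" "q \<le> b" for p q
        proof -
          have near: "\<bar>v y - v x\<bar> < \<eta>" if "p \<le> y" "y \<le> q" for y using \<delta>(2)[of y] that h by auto
          define S where "S = {min (v p) (v q)..max (v p) (v q)}"
          have S: "S \<subseteq> {c..d}" using range[of p] range[of q] h by (auto simp: S_def)
          have Sn: "\<bar>t - v x\<bar> < \<eta>" if "t \<in> S" for t using near[of p] near[of q] h that by (auto simp: S_def)
          \<comment> \<open>By the choice of \<eta>, L is at least \<kappa> at all levels between v
            p and v q, and at most \<kappa> (v y) + e for y between p and q.\<close>
          define L where "L = \<kappa> (v x) + e / 2"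
          have L: "0 \<le> L" using \<kappa>(2)[of "v x"] range[of x] True e by (auto simp: L_def)
          have "norm (K (v q) - K (v p)) \<le> L * norm (v q - v p)"
          proof (rule field_differentiable_bound)
            show "convex S" by (simp add: S_def)
            show "(K has_field_derivative \<kappa> t) (at t within S)" if "t \<in> S" for t
              by (rule DERIV_subset[OF K S]) (use S that in auto)
            show "norm (\<kappa> t) \<le> L" if "t \<in> S" for t
              using \<eta>(2)[of t] Sn[OF that] \<kappa>(2)[of t] S that by (auto simp: L_def abs_if split: if_splits)
          qed (auto simp: S_def)
          also have "v q - v p = cdf_on ?N v' q - cdf_on ?N v' p" using v[of p] v[of q] h by simp
          also have "norm \<dots> \<le> cdf_on ?N (\<lambda>x. \<bar>v' x\<bar>) q - cdf_on ?N (\<lambda>x. \<bar>v' x\<bar>) p"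
            unfolding real_norm_def by (rule cdf_on_abs_le[OF v' id]) (use h absv' in auto)
          also have "L * \<dots> = cdf_on ?N (\<lambda>x. L * \<bar>v' x\<bar>) q - cdf_on ?N (\<lambda>x. L * \<bar>v' x\<bar>) p"
            unfolding cdf_on_def by (simp add: mult.left_commute[of _ L] right_diff_distrib)
          also have "\<dots> \<le> cdf_on ?N f q - cdf_on ?N f p"
          proof (rule cdf_on_mono[OF _ id _ _ fI])
            fix y assume y: "y \<in> space ?N" "p < y" "y \<le> q"
            then have "\<bar>\<kappa> (v y) - \<kappa> (v x)\<bar> < e / 2" using \<eta>(2)[of "v y"] near[of y] range[of y] by auto
            then have "L \<le> \<kappa> (v y) + e" by (simp add: L_def abs_if split: if_splits)
            then have "L * \<bar>v' y\<bar> \<le> (\<kappa> (v y) + e) * \<bar>v' y\<bar>" by (rule mult_right_mono) simp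
            then show "L * \<bar>v' y\<bar> \<le> f y" by (simp add: f_def algebra_simps)
          qed (use h absv' in auto)
          finally show ?thesis using L by (simp add: D_def mult_left_mono)
        qed
        then show ?thesis using \<delta>(1) by blast
      qed
    qed
    moreover have "D f p q = D (\<lambda>x. \<kappa> (v x) * \<bar>v' x\<bar>) p q + e * D (\<lambda>x. \<bar>v' x\<bar>) p q"
      unfolding D_def f_def using int absv' id
      by (subst (1 2) cdf_on_add) (auto simp: cdf_on_def mult.left_commute[of _ e] right_diff_distrib)
    ultimately show ?thesis using pq by simp
  qed
  have "\<bar>K (v q) - K (v p)\<bar> \<le> D (\<lambda>x. \<kappa> (v x) * \<bar>v' x\<bar>) p q"
  proof (rule field_le_epsilon)
    fix \<epsilon> :: real assume \<epsilon>: "0 < \<epsilon>"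
    define M where "M = D (\<lambda>x. \<bar>v' x\<bar>) p q"
    have "0 \<le> M"
      unfolding M_def D_def using cdf_on_abs_le[OF v' id pq(2) _ absv'] by (smt (verit) abs_ge_zero)
    have "\<bar>K (v q) - K (v p)\<bar> \<le> D (\<lambda>x. \<kappa> (v x) * \<bar>v' x\<bar>) p q + \<epsilon> / (M + 1) * M"
      unfolding M_def using \<epsilon> \<open>0 \<le> M\<close> by (intro main) (simp add: M_def)
    also have "\<epsilon> / (M + 1) * M \<le> \<epsilon>" using \<epsilon> \<open>0 \<le> M\<close> by (simp add: field_simps)
    finally show "\<bar>K (v q) - K (v p)\<bar> \<le> D (\<lambda>x. \<kappa> (v x) * \<bar>v' x\<bar>) p q + \<epsilon>" by simp
  qed
  then show "\<bar>K (v q) - K (v p)\<bar> \<le> cdf_on ?N (\<lambda>x. \<kappa> (v x) * \<bar>v' x\<bar>) q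
      - cdf_on ?N (\<lambda>x. \<kappa> (v x) * \<bar>v' x\<bar>) p" by (simp add: D_def)
qed


lemma ennsqrt_ennreal [simp]: "ennsqrt (ennreal x) = ennreal (sqrt x)"
  by (cases "0 \<le> x") (auto simp: ennsqrt_def ennreal_neg)

lemma ennsqrt_0 [simp]: "ennsqrt 0 = 0"
  using ennsqrt_ennreal[of 0] by simp

lemma ennsqrt_top [simp]: "ennsqrt top = top" by (simp add: ennsqrt_def)

lemma ennreal_integral_le:
  fixes f :: "'a \<Rightarrow> real"
  assumes "integrable M f"
  shows "ennreal (\<integral>x. f x \<partial>M) \<le> (\<integral>\<^sup>+x. ennreal (f x) \<partial>M)"
proof -
  have m: "integrable M (\<lambda>x. max (f x) 0)" using assms by simp
  have "(\<integral>x. f x \<partial>M) \<le> (\<integral>x. max (f x) 0 \<partial>M)" by (rule integral_mono[OF assms m]) simp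
  then have "ennreal (\<integral>x. f x \<partial>M) \<le> ennreal (\<integral>x. max (f x) 0 \<partial>M)" by (rule ennreal_leI)
  also have "\<dots> = (\<integral>\<^sup>+x. ennreal (max (f x) 0) \<partial>M)" by (rule nn_integral_eq_integral[symmetric, OF m]) auto
  also have "(\<lambda>x. ennreal (max (f x) 0)) = (\<lambda>x. ennreal (f x))" by (auto simp: fun_eq_iff max_def ennreal_neg)
  finally show ?thesis .
qed

text \<open>The map x \<mapsto> \<bar>2 x - 1\<bar> runs through (0, 1) twice at speed 2; it
  describes the descent of v to its minimum and the way back.\<close>

lemma nn_integral_reflect:
  fixes f :: "real \<Rightarrow> ennreal"
  assumes [measurable]: "f \<in> borel_measurable borel"
  shows "(\<integral>\<^sup>+x. 2 * f \<bar>2 * x - 1\<bar> \<partial>lebesgue_on {0<..<1}) = 2 * (\<integral>\<^sup>+y. f y \<partial>lebesgue_on {0<..<1})"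
proof -
  define F where "F y = f \<bar>y\<bar> * indicator {-1<..<1} y" for y
  have [measurable]: "F \<in> borel_measurable borel" unfolding F_def[abs_def] by measurable
  have "(\<integral>\<^sup>+x. 2 * f \<bar>2 * x - 1\<bar> \<partial>lebesgue_on {0<..<1}) = (\<integral>\<^sup>+x. 2 * F (-1 + 2 * x) \<partial>lborel)"
    unfolding nn_integral_lebesgue_on_Ioo
    by (rule nn_integral_cong) (auto simp: F_def indicator_def algebra_simps)
  also have "\<dots> = 2 * (\<integral>\<^sup>+x. F (-1 + 2 * x) \<partial>lborel)" by (rule nn_integral_cmult) simp
  also have "\<dots> = (\<integral>\<^sup>+x. F x \<partial>lborel)"
    using nn_integral_real_affine[of F 2 "-1"] by simp
  also have "\<dots> = (\<integral>\<^sup>+y. (f y * indicator {0<..<1} y + f (- y) * indicator {-1<..<0} y) \<partial>lborel)"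
  proof (rule nn_integral_cong_AE)
    have "AE y in lborel. y \<noteq> (0::real)" by (rule AE_lborel_singleton)
    then show "AE y in lborel. F y = f y * indicator {0<..<1} y + f (- y) * indicator {-1<..<0} y"
      by eventually_elim (auto simp: F_def indicator_def abs_if)
  qed
  also have "\<dots> = (\<integral>\<^sup>+y. f y * indicator {0<..<1} y \<partial>lborel) + (\<integral>\<^sup>+y. f (- y) * indicator {-1<..<0} y \<partial>lborel)"
    by (rule nn_integral_add) auto
  also have "(\<integral>\<^sup>+y. f (- y) * indicator {-1<..<0} y \<partial>lborel) = (\<integral>\<^sup>+y. f y * indicator {0<..<1} y \<partial>lborel)"
    using nn_integral_real_affine[of "\<lambda>y. f y * indicator {0<..<1} y" "-1" 0]
    by (auto simp: indicator_def intro!: nn_integral_cong)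
  finally show ?thesis unfolding nn_integral_lebesgue_on_Ioo mult_2 .
qed

section \<open>The pointwise inequality and the lower bound\<close>

context cohesive
begin

definition T where "T = theta_ext l Q \<omega> 1"

text \<open>Monotonicity makes the left limit of \<theta> at 1 a supremum, so the \<open>Lim\<close>
  in \<open>theta_ext\<close> is a genuine limit in [0, \<infinity>].\<close>

lemma T_tendsto: "((\<lambda>t. ennreal (\<theta> t)) \<longlongrightarrow> T) (at_left 1)"
  and T_ge: "0 \<le> m \<Longrightarrow> m < 1 \<Longrightarrow> ennreal (\<theta> m) \<le> T"
proof -
  let ?S = "SUP m\<in>{0<..<1}. ennreal (\<theta> m)"
  have ev: "\<forall>\<^sub>F t in at_left 1. t \<in> {0<..<(1::real)}" by (rule eventually_at_left_real) simp
  have lim: "((\<lambda>t. ennreal (\<theta> t)) \<longlongrightarrow> ?S) (at_left 1)"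
  proof (rule order_tendstoI)
    fix y assume "y < ?S"
    then obtain m where m: "m \<in> {0<..<1}" "y < ennreal (\<theta> m)" by (auto simp: less_SUP_iff)
    have "\<forall>\<^sub>F t in at_left 1. t \<in> {m<..<1}" by (rule eventually_at_left_real) (use m in auto)
    then show "\<forall>\<^sub>F t in at_left 1. y < ennreal (\<theta> t)"
    proof eventually_elim
      case (elim t)
      then have "\<theta> m \<le> \<theta> t" using th_mono[of m t] m by auto
      then have "ennreal (\<theta> m) \<le> ennreal (\<theta> t)" by (rule ennreal_leI)
      with m(2) show ?case by (rule less_le_trans)
    qed
  next
    fix y assume y: "?S < y"
    show "\<forall>\<^sub>F t in at_left 1. ennreal (\<theta> t) < y"
      using ev
    proof eventually_elim
      case (elim t)
      then have "ennreal (\<theta> t) \<le> ?S" by (rule SUP_upper)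
      then show ?case using y by (rule le_less_trans)
    qed
  qed
  have "Lim (at_left 1) (\<lambda>t. ennreal (\<theta> t)) = ?S" by (rule tendsto_Lim[OF _ lim]) simp
  then have TS: "T = ?S" unfolding T_def theta_ext_def by simp
  with lim show "((\<lambda>t. ennreal (\<theta> t)) \<longlongrightarrow> T) (at_left 1)" by simp
  show "ennreal (\<theta> m) \<le> T" if "0 \<le> m" "m < 1"
  proof (cases "m = 0")
    case False then show ?thesis unfolding TS using that by (intro SUP_upper) auto
  qed simp
qed

lemma q_le_T: "0 \<le> m \<Longrightarrow> m < 1 \<Longrightarrow> ennreal (sqrt (\<theta> m)) \<le> ennsqrt T"
proof -
  assume m: "0 \<le> m" "m < 1"
  show ?thesis
  proof (cases "T = top")
    case False
    then obtain r where r: "T = ennreal r" "0 \<le> r" by (cases T) auto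
    then show ?thesis using T_ge[OF m] by (simp add: ennreal_leI)
  qed simp
qed

text \<open>\<open>\<theta> (1 - \<tau>) / l (1 - \<tau>)\<close> equals
  \<open>\<omega> \<tau> / Q \<tau>\<close>, and l tends to 1 at 1. The infinite limit is treated
  separately, as divergence of a real function.\<close>

lemma varsigma_eq: "varsigma_bar Q \<omega> = ennsqrt T"
proof -
  have f: "filterlim (\<lambda>\<tau>::real. 1 - \<tau>) (at_left 1) (at_right 0)"
    unfolding filterlim_at
  proof
    have "((\<lambda>\<tau>::real. 1 - \<tau>) \<longlongrightarrow> 1 - 0) (at_right 0)" by (intro tendsto_intros)
    then show "((\<lambda>\<tau>::real. 1 - \<tau>) \<longlongrightarrow> 1) (at_right 0)" by simp
    show "\<forall>\<^sub>F \<tau> in at_right (0::real). 1 - \<tau> \<in> {..<1} \<and> 1 - \<tau> \<noteq> 1"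
      by (auto simp: eventually_at_filter)
  qed
  have "(l \<longlongrightarrow> l 1) (at 1 within {0..1})" using dataD(1) unfolding continuous_on_def by (rule bspec) simp
  then have l1: "(l \<longlongrightarrow> 1) (at_left 1)" by (simp add: at_within_Icc_at_left l_1)
  have lim: "((\<lambda>t. ennreal (sqrt (\<theta> t / l t))) \<longlongrightarrow> ennsqrt T) (at_left 1)"
  proof (cases "T = top")
    case True
    then have "filterlim \<theta> at_top (at_left 1)"
      using T_tendsto ennreal_tendsto_top_eq_at_top[of \<theta>] by simp
    moreover have "((\<lambda>t. 1 / l t) \<longlongrightarrow> 1 / 1) (at_left 1)" by (intro tendsto_intros l1) simp
    ultimately have "filterlim (\<lambda>t. (1 / l t) * \<theta> t) at_top (at_left 1)"
      by (intro filterlim_tendsto_pos_mult_at_top) auto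
    then have "filterlim (\<lambda>t. sqrt (\<theta> t / l t)) at_top (at_left 1)"
      by (intro filterlim_compose[OF sqrt_at_top]) simp
    then have "((\<lambda>t. ennreal (sqrt (\<theta> t / l t))) \<longlongrightarrow> top) (at_left 1)"
      by (rule iffD2[OF ennreal_tendsto_top_eq_at_top])
    then show ?thesis using True by simp
  next
    case False
    then obtain r where r: "T = ennreal r" "0 \<le> r" by (cases T) auto
    have "\<forall>\<^sub>F t in at_left 1. t \<in> {0<..<(1::real)}" by (rule eventually_at_left_real) simp
    then have "\<forall>\<^sub>F t in at_left 1. 0 \<le> \<theta> t" by eventually_elim (auto intro: th_nonneg)
    then have "(\<theta> \<longlongrightarrow> r) (at_left 1)" using T_tendsto r by (simp add: tendsto_ennreal_iff)
    then have "((\<lambda>t. sqrt (\<theta> t / l t)) \<longlongrightarrow> sqrt (r / 1)) (at_left 1)" by (intro tendsto_intros l1) simp_all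
    then show ?thesis using r by simp
  qed
  have "((\<lambda>\<tau>. ennreal (sqrt (\<theta> (1 - \<tau>) / l (1 - \<tau>)))) \<longlongrightarrow> ennsqrt T) (at_right 0)"
    by (rule filterlim_compose[OF lim f])
  moreover have "\<forall>\<^sub>F \<tau> in at_right 0. ennreal (sqrt (\<theta> (1 - \<tau>) / l (1 - \<tau>))) = ennreal (sqrt (\<omega> \<tau> / Q \<tau>))"
  proof -
    have "\<forall>\<^sub>F t in at_right 0. t \<in> {0<..<(1::real)}" by (rule eventually_at_right_real) simp
    then show ?thesis
    proof eventually_elim
      case (elim \<tau>)
      then have "0 < l (1 - \<tau>)" by (intro l_pos) auto
      then show ?case by (simp add: theta_def)
    qed
  qed
  ultimately have "((\<lambda>\<tau>. ennreal (sqrt (\<omega> \<tau> / Q \<tau>))) \<longlongrightarrow> ennsqrt T) (at_right 0)"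
    by (rule Lim_transform_eventually)
  then show ?thesis unfolding varsigma_bar_def by (rule tendsto_Lim[rotated]) simp
qed

text \<open>Cauchy-Schwarz with explicit defect: the squares of the two sides differ by (\<alpha> a
  - \<beta> \<bar>b\<bar>)^2.\<close>

lemma integrand_real_ge:
  assumes "0 \<le> m" "m \<le> v" "v < 1"
  shows "sqrt (\<theta> m) * a + k m v * \<bar>b\<bar> \<le> sqrt (\<theta> v * a\<^sup>2 + W v * b\<^sup>2)"
proof -
  have p: "0 \<le> \<theta> m" "\<theta> m \<le> \<theta> v" "0 \<le> W v" using th_nonneg[of m] th_mono[of m v] W_nonneg[of v] assms by auto
  \<comment> \<open>\<theta> v = 0 happens only for v = 0, which forces m = 0; the quotient is 0 in
    that case.\<close>
  define r where "r = (if \<theta> v = 0 then 0 else \<theta> m / \<theta> v)"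
  have r: "0 \<le> r" "r \<le> 1" "\<theta> m = r * \<theta> v" using p by (auto simp: r_def)
  have "max 0 (1 - \<theta> m / \<theta> v) = 1 - r" using r(2) unfolding r_def by (cases "\<theta> v = 0") (auto simp: max_def)
  then have k: "k m v = sqrt (W v * (1 - r))" by (simp only: k_def)
  define \<alpha> \<beta> where "\<alpha> = sqrt ((1 - r) * \<theta> v)" and "\<beta> = sqrt (r * W v)"
  have nn: "0 \<le> (1 - r) * \<theta> v" "0 \<le> r * W v" "0 \<le> W v * (1 - r)" "0 \<le> r * \<theta> v"
    by (rule mult_nonneg_nonneg; use r p in linarith)+
  have sq: "\<alpha>\<^sup>2 = (1 - r) * \<theta> v" "\<beta>\<^sup>2 = r * W v" "(sqrt (\<theta> m))\<^sup>2 = r * \<theta> v" "(k m v)\<^sup>2 = W v * (1 - r)"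
    unfolding \<alpha>_def \<beta>_def k r(3) by (rule real_sqrt_pow2, rule nn)+
  have pr: "sqrt (\<theta> m) * k m v = \<alpha> * \<beta>"
    unfolding \<alpha>_def \<beta>_def k r(3) real_sqrt_mult[symmetric] by (simp only: ac_simps)
  have "(sqrt (\<theta> m) * a + k m v * \<bar>b\<bar>)\<^sup>2 = (sqrt (\<theta> m))\<^sup>2 * a\<^sup>2 + 2 * (sqrt (\<theta> m) * k m v) * (a * \<bar>b\<bar>) + (k m v)\<^sup>2 * b\<^sup>2"
    by (simp add: power2_sum power_mult_distrib algebra_simps)
  also have "\<dots> = \<theta> v * a\<^sup>2 + W v * b\<^sup>2 - (\<alpha> * a - \<beta> * \<bar>b\<bar>)\<^sup>2"
    unfolding sq pr power2_diff power_mult_distrib by (simp add: algebra_simps)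
  also have "\<dots> \<le> \<theta> v * a\<^sup>2 + W v * b\<^sup>2" by simp
  finally show ?thesis by (rule real_le_rsqrt)
qed

lemma theta_ext_less_1: "t < 1 \<Longrightarrow> theta_ext l Q \<omega> t = ennreal (\<theta> t)"
  by (simp add: theta_ext_def)

text \<open>Extends the inequality to v = 1, where W vanishes and \<theta> may be infinite. For a =
  0 the left side is 0; otherwise the right side is infinite, or it dominates because \<theta> m is
  at most \<theta>(1-).\<close>

lemma integrand_ge:
  assumes "0 \<le> m" "m < 1" "m \<le> v" "v \<le> 1"
  shows "ennreal (sqrt (\<theta> m) * a + k m v * \<bar>b\<bar>) \<le> ennsqrt (theta_ext l Q \<omega> v * ennreal (a\<^sup>2) + ennreal (W v * b\<^sup>2))"
proof (cases "v = 1")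
  case False
  then have v: "v < 1" using assms by simp
  have "theta_ext l Q \<omega> v * ennreal (a\<^sup>2) + ennreal (W v * b\<^sup>2) = ennreal (\<theta> v * a\<^sup>2 + W v * b\<^sup>2)"
    using th_nonneg[of v] W_nonneg[of v] v assms by (simp add: theta_ext_less_1 ennreal_mult ennreal_plus)
  then show ?thesis using integrand_real_ge[of m v a b] assms v by (simp add: ennreal_leI)
next
  case True
  show ?thesis
  proof (cases "a = 0")
    case True then show ?thesis using \<open>v = 1\<close> by simp
  next
    case False
    show ?thesis
    proof (cases "T = top")
      case True
      then show ?thesis using \<open>v = 1\<close> False by (simp add: T_def[symmetric] ennreal_top_mult)
    next
      case T: False
      then obtain r where r: "T = ennreal r" "0 \<le> r" by (cases T) auto
      have "\<theta> m \<le> r" using T_ge[OF assms(1,2)] r by simp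
      have "sqrt (\<theta> m) * a \<le> sqrt (\<theta> m) * \<bar>a\<bar>"
        using th_nonneg[OF assms(1,2)] by (intro mult_left_mono) auto
      also have "\<dots> \<le> sqrt r * \<bar>a\<bar>" using \<open>\<theta> m \<le> r\<close> by (intro mult_right_mono) auto
      also have "\<dots> = sqrt (r * a\<^sup>2)" by (simp add: real_sqrt_mult)
      finally show ?thesis using \<open>v = 1\<close> r by (simp add: T_def[symmetric] ennreal_mult[symmetric] ennreal_leI)
    qed
  qed
qed

lemma k_cont': "0 \<le> m \<Longrightarrow> m < 1 \<Longrightarrow> continuous_on {m..1} (k m)"
  using k_cont[of m m] k_0_cont by (cases "m = 0") auto

text \<open>Before and after x0 the function v has to pass between the levels 1 and v x0. With K a
  primitive of \<open>k m\<close>, \<open>chain_inequality\<close> bounds the cost of each passage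
  from below by K 1 - K (v x0), whatever oscillations v makes. The linear term is exact because u'
  has integral s.\<close>

lemma energy_ge:
  assumes u: "H1 0 1 u u'" "u 0 = 0" "u 1 = s" and v: "H1 0 1 v v'" "v 0 = 1" "v 1 = 1"
    and range: "\<And>x. 0 \<le> x \<Longrightarrow> x \<le> 1 \<Longrightarrow> m \<le> v x \<and> v x \<le> 1" and m: "0 \<le> m" "m < 1" and x0: "0 \<le> x0" "x0 \<le> 1"
  shows "ennreal (sqrt (\<theta> m) * s + 2 * integral {v x0..1} (k m)) \<le> g_energy l Q \<omega> v u' v'"
proof -
  let ?N = "lebesgue_on {0<..<1::real}"
  have ab: "(0::real) < 1" by simp
  note U = H1_FTC[OF ab u(1)] and V = H1_FTC[OF ab v(1)]
  have vc: "continuous_on {0..1} v" using v(1) by (simp add: H1_def)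
  define K where "K t = integral {m..t} (k m)" for t
  have K: "(K has_real_derivative k m t) (at t within {m..1})" if "m \<le> t" "t \<le> 1" for t
    unfolding K_def by (rule integral_has_real_derivative[OF k_cont'[OF m]]) (use that in auto)
  have kn: "0 \<le> k m t" if "m \<le> t" "t \<le> 1" for t using that m by (intro k_nonneg) auto
  let ?f = "\<lambda>x. k m (v x) * \<bar>v' x\<bar>"
  have ch: "integrable ?N ?f" "\<bar>K (v q) - K (v p)\<bar> \<le> cdf_on ?N ?f q - cdf_on ?N ?f p"
    if "0 \<le> p" "p \<le> q" "q \<le> 1" for p q
    by (rule chain_inequality[OF ab V(1) _ vc, where c=m and d=1 and K=K and p=p and q=q],
        (rule V(2) range K k_cont'[OF m] kn that | assumption)+)+
  have int: "integrable ?N ?f" using ch(1)[of 0 0] by simp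
  have tot: "cdf_on ?N ?f 1 = (\<integral>x. ?f x \<partial>?N)" "cdf_on ?N ?f 0 = 0"
    by (rule cdf_on_ge_right[where a=0 and b=1]; simp) (rule cdf_on_le_left[where a=0 and b=1]; simp)
  have i1: "integral {v x0..1} (k m) = K 1 - K (v x0)"
    unfolding K_def using Henstock_Kurzweil_Integration.integral_combine[of m "v x0" 1 "k m"] range[OF x0] k_integrable[OF m] by simp
  have "\<bar>K (v x0) - K (v 0)\<bar> \<le> cdf_on ?N ?f x0 - cdf_on ?N ?f 0"
    by (rule ch(2)) (use x0 in auto)
  moreover have "\<bar>K (v 1) - K (v x0)\<bar> \<le> cdf_on ?N ?f 1 - cdf_on ?N ?f x0"
    by (rule ch(2)) (use x0 in auto)
  ultimately have le: "2 * integral {v x0..1} (k m) \<le> (\<integral>x. ?f x \<partial>?N)"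
    unfolding i1 using v tot by simp
  have us: "(\<integral>x. u' x \<partial>?N) = s"
    using U(2)[of 1] u cdf_on_ge_right[of ?N 0 1 1 u'] by simp
  have "sqrt (\<theta> m) * s + 2 * integral {v x0..1} (k m) \<le> (\<integral>x. sqrt (\<theta> m) * u' x + ?f x \<partial>?N)"
    using le us U(1) int by simp
  then have "ennreal (sqrt (\<theta> m) * s + 2 * integral {v x0..1} (k m)) \<le> ennreal (\<integral>x. sqrt (\<theta> m) * u' x + ?f x \<partial>?N)"
    by (rule ennreal_leI)
  also have "\<dots> \<le> (\<integral>\<^sup>+x. ennreal (sqrt (\<theta> m) * u' x + ?f x) \<partial>?N)"
    by (rule ennreal_integral_le) (use U(1) int in auto)
  also have "\<dots> \<le> g_energy l Q \<omega> v u' v'"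
    unfolding g_energy_def
  proof (rule nn_integral_mono)
    fix x assume "x \<in> space ?N"
    then have "m \<le> v x" "v x \<le> 1" using range[of x] by auto
    from integrand_ge[OF m this] show "ennreal (sqrt (\<theta> m) * u' x + k m (v x) * \<bar>v' x\<bar>)
      \<le> ennsqrt (theta_ext l Q \<omega> (v x) * ennreal ((u' x)\<^sup>2) + ennreal (\<omega> (1 - v x) * (v' x)\<^sup>2))"
      by (simp add: W_def)
  qed
  finally show ?thesis .
qed

lemma th_tendsto_0: "(\<theta> \<longlongrightarrow> 0) (at_right 0)"
proof -
  have "continuous_on {0..1/2} \<theta>" by (rule continuous_on_subset[OF th_cont]) auto
  then have "(\<theta> \<longlongrightarrow> \<theta> 0) (at 0 within {0..1/2})" unfolding continuous_on_def by (rule bspec) simp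
  then show ?thesis by (simp add: at_within_Icc_at_right)
qed

text \<open>\<open>energy_ge\<close> is applied with m the minimum of v. The hypothesis speaks only
  of m in (0, 1), so the minimum 0 is reached through the limit of \<open>H m s\<close> as m tends
  to 0, and the minimum 1 through lower levels m that tend to 1.\<close>

lemma g_ge:
  assumes s: "0 \<le> s" and c: "\<And>m. 0 < m \<Longrightarrow> m < 1 \<Longrightarrow> c \<le> H m s"
  shows "ennreal c \<le> g l Q \<omega> s"
  unfolding g_def
proof (rule Inf_greatest, clarify)
  fix u v u' v'
  assume u: "H1 0 1 u u'" "u 0 = 0" "s = u 1" and v: "H1 0 1 v v'" "v 0 = 1" "v 1 = 1"
    and range: "\<forall>x\<in>{0..1}. 0 \<le> v x \<and> v x \<le> 1"
  have u1: "u 1 = s" using u by simp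
  have "continuous_on {0..1} v" using v(1) by (simp add: H1_def)
  then obtain x0 where x0: "x0 \<in> {0..1}" "\<forall>x\<in>{0..1}. v x0 \<le> v x"
    using continuous_attains_inf[of "{0..1::real}" v] by auto
  have ev: "\<forall>\<^sub>F t in at_left 1. t \<in> {0<..<(1::real)}" by (rule eventually_at_left_real) simp
  note E = energy_ge[OF u(1,2) u1 v]
  consider "v x0 = 0" | "0 < v x0" "v x0 < 1" | "v x0 = 1" using range x0(1) by force
  then show "ennreal c \<le> g_energy l Q \<omega> v u' v'"
  proof cases
    case 1
    have "c \<le> 2 * Psi \<omega> 1"
    proof (rule tendsto_le[of "at_right (0::real)" "\<lambda>m. H m s" "2 * Psi \<omega> 1" "\<lambda>_. c" c])
      have "((\<lambda>m. sqrt (\<theta> m) * s + A m) \<longlongrightarrow> sqrt 0 * s + 2 * Psi \<omega> 1) (at_right 0)"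
        by (intro tendsto_intros A_tendsto_0 th_tendsto_0)
      then show "((\<lambda>m. H m s) \<longlongrightarrow> 2 * Psi \<omega> 1) (at_right 0)" by (simp add: H_def[abs_def])
      have "\<forall>\<^sub>F t in at_right 0. t \<in> {0<..<(1::real)}" by (rule eventually_at_right_real) simp
      then show "\<forall>\<^sub>F m in at_right 0. c \<le> H m s" by eventually_elim (use c in auto)
    qed auto
    moreover have "2 * integral {v x0..1} (k 0) = 2 * Psi \<omega> 1" using 1 A_0 by (simp add: A_def)
    ultimately show ?thesis
      using E[of 0 x0] range x0 by (auto intro: order_trans[OF ennreal_leI])
  next
    case 2
    have "c \<le> sqrt (\<theta> (v x0)) * s + 2 * integral {v x0..1} (k (v x0))"
      using c[OF 2] by (simp add: H_def A_def)
    then show ?thesis using E[of "v x0" x0] range x0 2 by (auto intro: order_trans[OF ennreal_leI])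
  next
    case 3
    \<comment> \<open>Here v is identically 1, so every m < 1 is an admissible level and the passage
      between levels costs nothing. The loss A m vanishes as m tends to 1.\<close>
    have le: "ennreal (c - A m) \<le> g_energy l Q \<omega> v u' v'" if m: "0 < m" "m < 1" for m
    proof -
      have "ennreal (sqrt (\<theta> m) * s) \<le> g_energy l Q \<omega> v u' v'"
      proof -
        have "ennreal (sqrt (\<theta> m) * s + 2 * integral {v x0..1} (k m)) \<le> g_energy l Q \<omega> v u' v'"
        proof (rule E)
          fix x :: real assume "0 \<le> x" "x \<le> 1"
          then have "x \<in> {0..1}" by simp
          then have "v x0 \<le> v x" "v x \<le> 1" using x0(2) range by blast+
          then show "m \<le> v x \<and> v x \<le> 1" using 3 m by linarith
        qed (use m x0 in auto)
        then show ?thesis using 3 by simp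
      qed
      moreover have "c - A m \<le> sqrt (\<theta> m) * s" using c[OF m] by (simp add: H_def)
      ultimately show ?thesis by (auto intro: order_trans[OF ennreal_leI])
    qed
    have "((\<lambda>m. ennreal (c - A m)) \<longlongrightarrow> ennreal (c - 0)) (at_left 1)"
      by (intro tendsto_intros A_tendsto_1)
    moreover have "\<forall>\<^sub>F m in at_left 1. ennreal (c - A m) \<le> g_energy l Q \<omega> v u' v'"
      using ev by eventually_elim (use le in auto)
    ultimately have "ennreal (c - 0) \<le> g_energy l Q \<omega> v u' v'"
      by (rule tendsto_upperbound) simp
    then show ?thesis by simp
  qed
qed

section \<open>Competitors and upper bounds\<close>

lemma g_le:
  assumes "H1 0 1 u u'" "u 0 = 0" "u 1 = s" "H1 0 1 v v'" "v 0 = 1" "v 1 = 1" "\<And>x. 0 \<le> x \<Longrightarrow> x \<le> 1 \<Longrightarrow> 0 \<le> v x \<and> v x \<le> 1"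
  shows "g l Q \<omega> s \<le> g_energy l Q \<omega> v u' v'"
proof -
  have r: "\<forall>x\<in>{0..1}. 0 \<le> v x \<and> v x \<le> 1" using assms(7) by (metis atLeastAtMost_iff)
  show ?thesis unfolding g_def
    by (rule Inf_lower, rule CollectI, rule exI[of _ u], rule exI[of _ v], rule exI[of _ u'], rule exI[of _ v'])
      (intro conjI refl assms(1-6) r)
qed

text \<open>The competitor is v = 1 with u linear; for s = 0 and an infinite coefficient the
  convention on 0 times \<infinity> enters.\<close>

lemma g_le_linear: "0 \<le> s \<Longrightarrow> g l Q \<omega> s \<le> ennsqrt T * ennreal s"
proof -
  assume s: "0 \<le> s"
  have "g l Q \<omega> s \<le> g_energy l Q \<omega> (\<lambda>_. 1) (\<lambda>_. s) (\<lambda>_. 0)"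
    by (rule g_le[where u="\<lambda>x. s * x"]) (auto intro!: H1_C1 derivative_eq_intros)
  also have "\<dots> = (\<integral>\<^sup>+x. ennsqrt (T * ennreal (s\<^sup>2)) \<partial>lebesgue_on {0<..<1::real})"
    by (simp add: g_energy_def T_def)
  also have "\<dots> = ennsqrt (T * ennreal (s\<^sup>2))" by (simp add: emeasure_restrict_space)
  also have "\<dots> = ennsqrt T * ennreal s"
  proof (cases "T = top")
    case True then show ?thesis using s by (cases "s = 0") (auto simp: ennreal_top_mult)
  next
    case False
    then obtain r where r: "T = ennreal r" "0 \<le> r" by (cases T) auto
    then show ?thesis using s by (simp add: ennreal_mult[symmetric] real_sqrt_mult)
  qed
  finally show ?thesis .
qed

text \<open>A parabola from 1 down to m at x = 1/2 and back. In terms of y = \<bar>2 x - 1\<bar> it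
  is m + (1 - m) y^2, the substitution that underlies \<open>J\<close>.\<close>

definition V :: "real \<Rightarrow> real \<Rightarrow> real" where "V m x = m + (1 - m) * (2 * x - 1)\<^sup>2"

definition V' :: "real \<Rightarrow> real \<Rightarrow> real" where "V' m x = 4 * (1 - m) * (2 * x - 1)"

lemma V_H1: "H1 0 1 (V m) (V' m)"
proof (rule H1_C1)
  show "(V m has_real_derivative V' m x) (at x)" for x
    unfolding V_def[abs_def] V'_def by (auto intro!: derivative_eq_intros simp: algebra_simps)
  show "continuous_on UNIV (V' m)" unfolding V'_def[abs_def] by (intro continuous_intros)
qed simp

lemma V_range: "0 \<le> m \<Longrightarrow> m < 1 \<Longrightarrow> 0 \<le> x \<Longrightarrow> x \<le> 1 \<Longrightarrow> 0 \<le> V m x \<and> V m x \<le> 1"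
proof -
  assume a: "0 \<le> m" "m < 1" "0 \<le> x" "x \<le> 1"
  have "(2 * x - 1)\<^sup>2 \<le> 1" using a by (simp add: abs_square_le_1)
  then have "(1 - m) * (2 * x - 1)\<^sup>2 \<le> (1 - m) * 1" by (rule mult_left_mono) (use a in auto)
  then have "V m x \<le> 1" unfolding V_def by (simp only: mult_1_right le_diff_eq add.commute)
  then show ?thesis using a by (simp add: V_def)
qed

lemma k_substitution:
  assumes m: "0 \<le> m" "m < 1"
  shows "(\<integral>\<^sup>+y. ennreal (k m (m + (1 - m) * y\<^sup>2) * (2 * (1 - m) * y)) \<partial>lebesgue_on {0<..<1}) = ennreal (integral {m..1} (k m))"
proof -
  define f where "f t = indicator {m..1} t * k m t" for t
  have fm: "f \<in> borel_measurable borel"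
    using borel_measurable_continuous_on_indicator[OF _ k_cont'[OF m]] by (simp add: f_def[abs_def])
  define G where "G y = m + (1 - m) * y\<^sup>2" for y
  have "ennreal (integral {m..1} (k m)) = (\<integral>\<^sup>+t. ennreal (k m t) * indicator {m..1} t \<partial>lborel)"
    by (rule nn_integral_has_integral_lebesgue'[symmetric])
      (use m k_integrable[OF m] in \<open>auto intro: k_nonneg integrable_integral\<close>)
  also have "\<dots> = (\<integral>\<^sup>+t. ennreal (f t * indicator {G 0..G 1} t) \<partial>lborel)"
    by (rule nn_integral_cong) (auto simp: f_def G_def indicator_def)
  also have "\<dots> = (\<integral>\<^sup>+y. ennreal (f (G y) * (2 * (1 - m) * y) * indicator {0..1} y) \<partial>lborel)"
  proof (rule nn_integral_substitution)
    show "set_borel_measurable borel {G 0..G 1} f"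
      unfolding set_borel_measurable_def using fm by measurable
    show "(G has_real_derivative 2 * (1 - m) * y) (at y)" for y
      unfolding G_def by (auto intro!: derivative_eq_intros)
    show "continuous_on {0..1} (\<lambda>y. 2 * (1 - m) * y)" by (intro continuous_intros)
  qed (use m in auto)
  also have "\<dots> = (\<integral>\<^sup>+y. ennreal (k m (m + (1 - m) * y\<^sup>2) * (2 * (1 - m) * y)) \<partial>lebesgue_on {0<..<1})"
    unfolding nn_integral_lebesgue_on_Ioo
  proof (rule nn_integral_cong)
    fix y :: real
    show "ennreal (f (G y) * (2 * (1 - m) * y) * indicator {0..1} y) =
      ennreal (k m (m + (1 - m) * y\<^sup>2) * (2 * (1 - m) * y)) * indicator {0<..<1} y"
    proof (cases "0 < y \<and> y < 1")
      case True
      then show ?thesis using curve_in[of m y] m by (simp add: f_def G_def)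
    next
      case False
      then consider "y < 0" | "y = 0" | "y = 1" | "y > 1" by linarith
      then show ?thesis by cases (auto simp: f_def G_def)
    qed
  qed
  finally show ?thesis by simp
qed

text \<open>Folding at x = 1/2 turns the two branches into one and produces the factor 2 in
  A.\<close>

lemma V_integral:
  assumes m: "0 \<le> m" "m < 1"
  shows "(\<integral>\<^sup>+x. ennreal (k m (V m x) * \<bar>V' m x\<bar>) \<partial>lebesgue_on {0<..<1}) = ennreal (A m)"
proof -
  define h where "h y = indicator {0..1} y * (k m (m + (1 - m) * y\<^sup>2) * (2 * (1 - m) * y))" for y
  have in01: "m + (1 - m) * y\<^sup>2 \<in> {m..1}" if "y \<in> {0..1}" for y
    using curve_in[of m y] m that by (cases "y = 0 \<or> y = 1") (auto simp: less_imp_le)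
  have "continuous_on {0..1} (\<lambda>y. k m (m + (1 - m) * y\<^sup>2))"
    by (rule continuous_on_compose2[OF k_cont'[OF m]]) (use in01 in \<open>auto intro!: continuous_intros\<close>)
  then have "continuous_on {0..1} (\<lambda>y. k m (m + (1 - m) * y\<^sup>2) * (2 * (1 - m) * y))"
    by (intro continuous_intros)
  from borel_measurable_continuous_on_indicator[OF _ this] have hm: "h \<in> borel_measurable borel" by (simp add: h_def[abs_def])
  have "(\<integral>\<^sup>+x. ennreal (k m (V m x) * \<bar>V' m x\<bar>) \<partial>lebesgue_on {0<..<1}) = (\<integral>\<^sup>+x. 2 * ennreal (h \<bar>2 * x - 1\<bar>) \<partial>lebesgue_on {0<..<1})"
  proof (rule nn_integral_cong)
    fix x :: real assume "x \<in> space (lebesgue_on {0<..<1})"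
    then have y: "\<bar>2 * x - 1\<bar> \<in> {0..1}" by auto
    have "h \<bar>2 * x - 1\<bar> * 2 = k m (V m x) * \<bar>V' m x\<bar>"
      using y m by (simp add: h_def V_def V'_def abs_mult)
    moreover have "0 \<le> h \<bar>2 * x - 1\<bar>"
      using y m in01[OF y] by (auto simp: h_def intro!: mult_nonneg_nonneg k_nonneg)
    ultimately show "ennreal (k m (V m x) * \<bar>V' m x\<bar>) = 2 * ennreal (h \<bar>2 * x - 1\<bar>)"
      by (metis ennreal_mult' ennreal_numeral mult.commute zero_le_numeral)
  qed
  also have "\<dots> = 2 * (\<integral>\<^sup>+y. ennreal (h y) \<partial>lebesgue_on {0<..<1})"
    by (rule nn_integral_reflect) (use hm in measurable)
  also have "(\<integral>\<^sup>+y. ennreal (h y) \<partial>lebesgue_on {0<..<1}) = ennreal (integral {m..1} (k m))"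
    unfolding k_substitution[OF m, symmetric] by (rule nn_integral_cong) (auto simp: h_def)
  finally show ?thesis by (simp add: A_def ennreal_mult')
qed

text \<open>v descends all the way to 0, and u opens only in a window of width \<delta> around x =
  1/2, where v \<le> \<delta>^2. The opening then costs at most sqrt (\<theta> (\<delta>^2)) s,
  which vanishes with \<delta>.\<close>

lemma g_le_Psi:
  assumes s: "0 \<le> s"
  shows "g l Q \<omega> s \<le> ennreal (2 * Psi \<omega> 1)"
proof -
  let ?N = "lebesgue_on {0<..<1::real}"
  have le: "g l Q \<omega> s \<le> ennreal (sqrt (\<theta> (\<delta>\<^sup>2)) * s + 2 * Psi \<omega> 1)" if \<delta>: "0 < \<delta>" "\<delta> < 1" for \<delta>
  proof -
    define I where "I = {(1 - \<delta>) / 2<..<(1 + \<delta>) / 2}"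
    have I: "I \<subseteq> {0<..<1}"
    proof
      fix x assume "x \<in> I"
      then have "(1 - \<delta>) / 2 < x" "x < (1 + \<delta>) / 2" by (simp_all only: I_def greaterThanLessThan_iff)
      moreover have "0 < (1 - \<delta>) / 2" "(1 + \<delta>) / 2 < 1" using \<delta> by simp_all
      ultimately have "0 < x" "x < 1" by linarith+
      then show "x \<in> {0<..<1}" by simp
    qed
    define u' where "u' x = (s / \<delta>) * indicator I x" for x
    define u where "u = cdf_on ?N u'"
    have u'm: "u' \<in> borel_measurable ?N"
    proof -
      have "I \<inter> space ?N \<in> sets ?N" by (auto simp: sets_restrict_space I_def)
      then show ?thesis unfolding u'_def[abs_def]
        by (intro borel_measurable_times borel_measurable_indicator') (auto simp: vimage_def Int_def conj_commute)
    qed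
    have u'0: "0 \<le> u' x" for x using s \<delta> by (simp add: u'_def)
    have uH: "H1 0 1 u u'"
      by (rule H1_primitive[OF _ u'm, where B="s / \<delta>" and c=0]) (use s \<delta> in \<open>auto simp: u_def u'_def indicator_def\<close>)
    have u0: "u 0 = 0" unfolding u_def by (rule cdf_on_le_left[where a=0 and b=1]) auto
    have iu: "(\<integral>x. u' x \<partial>?N) = s"
    proof -
      have "(\<integral>x. indicator I x \<partial>?N) = measure lebesgue (I \<inter> {0<..<1})"
        by (simp add: integral_restrict_space measure_restrict_space)
      also have "I \<inter> {0<..<1} = I" using I by auto
      also have "measure lebesgue I = \<delta>" using \<delta> by (simp add: I_def field_simps)
      finally show ?thesis using \<delta> by (simp add: u'_def)
    qed
    have u1: "u 1 = s" unfolding u_def using cdf_on_ge_right[of ?N 0 1 1 u'] iu by simp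
    have u'I: "integrable ?N u'" by (rule H1_FTC(1)[OF _ uH]) simp
    have nu: "(\<integral>\<^sup>+x. ennreal (u' x) \<partial>?N) = ennreal s"
      using nn_integral_eq_integral[OF u'I] u'0 iu by simp
    have "g l Q \<omega> s \<le> g_energy l Q \<omega> (V 0) u' (V' 0)"
      by (rule g_le[OF uH u0 u1 V_H1]) (use V_range[of 0] in \<open>auto simp: V_def\<close>)
    also have "\<dots> \<le> (\<integral>\<^sup>+x. ennreal (sqrt (\<theta> (\<delta>\<^sup>2))) * ennreal (u' x) + ennreal (k 0 (V 0 x) * \<bar>V' 0 x\<bar>) \<partial>?N)"
      unfolding g_energy_def
    proof (rule nn_integral_mono)
      fix x assume "x \<in> space ?N"
      then have x: "0 < x" "x < 1" by auto
      have V1: "V 0 x < 1"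
      proof -
        have "\<bar>2 * x - 1\<bar> < 1" using x by auto
        then show ?thesis by (simp add: V_def abs_square_less_1)
      qed
      have V0: "0 \<le> V 0 x" by (simp add: V_def)
      have p: "0 \<le> \<theta> (V 0 x)" "0 \<le> W (V 0 x)" using th_nonneg[of "V 0 x"] W_nonneg[of "V 0 x"] V0 V1 by auto
      have "theta_ext l Q \<omega> (V 0 x) * ennreal ((u' x)\<^sup>2) + ennreal (\<omega> (1 - V 0 x) * (V' 0 x)\<^sup>2)
        = ennreal (\<theta> (V 0 x) * (u' x)\<^sup>2 + W (V 0 x) * (V' 0 x)\<^sup>2)"
        using V1 p by (simp add: theta_ext_less_1 ennreal_mult ennreal_plus W_def[symmetric])
      moreover have "sqrt (\<theta> (V 0 x) * (u' x)\<^sup>2 + W (V 0 x) * (V' 0 x)\<^sup>2) \<le> sqrt (\<theta> (V 0 x)) * u' x + k 0 (V 0 x) * \<bar>V' 0 x\<bar>"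
      proof -
        have "sqrt (\<theta> (V 0 x) * (u' x)\<^sup>2 + W (V 0 x) * (V' 0 x)\<^sup>2) \<le> sqrt (\<theta> (V 0 x) * (u' x)\<^sup>2) + sqrt (W (V 0 x) * (V' 0 x)\<^sup>2)"
          by (rule sqrt_add_le_add_sqrt) (use p in auto)
        then show ?thesis using u'0[of x] by (simp add: real_sqrt_mult k_0)
      qed
      moreover have "sqrt (\<theta> (V 0 x)) * u' x \<le> sqrt (\<theta> (\<delta>\<^sup>2)) * u' x"
      proof (cases "x \<in> I")
        case True
        then have "\<bar>2 * x - 1\<bar> < \<delta>" by (auto simp: I_def abs_less_iff field_simps)
        then have "(2 * x - 1)\<^sup>2 \<le> \<delta>\<^sup>2" using \<delta> by (auto simp: abs_le_square_iff[symmetric])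
        then have "\<theta> (V 0 x) \<le> \<theta> (\<delta>\<^sup>2)" using \<delta> by (intro th_mono) (auto simp: V_def power_less_one_iff)
        then show ?thesis using u'0[of x] by (intro mult_right_mono) auto
      qed (simp add: u'_def)
      ultimately show "ennsqrt (theta_ext l Q \<omega> (V 0 x) * ennreal ((u' x)\<^sup>2) + ennreal (\<omega> (1 - V 0 x) * (V' 0 x)\<^sup>2))
        \<le> ennreal (sqrt (\<theta> (\<delta>\<^sup>2))) * ennreal (u' x) + ennreal (k 0 (V 0 x) * \<bar>V' 0 x\<bar>)"
        using u'0[of x] k_nonneg[of "V 0 x" 0] V0 V1 th_nonneg[of "\<delta>\<^sup>2"] \<delta>
        by (simp add: ennreal_mult'[symmetric] ennreal_plus[symmetric] power_less_one_iff ennreal_leI del: ennreal_plus)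
    qed
    also have "\<dots> = ennreal (sqrt (\<theta> (\<delta>\<^sup>2))) * ennreal s + ennreal (A 0)"
    proof -
      have vc: "continuous_on {0..1} (\<lambda>x. k 0 (V 0 x) * \<bar>V' 0 x\<bar>)"
      proof (intro continuous_intros)
        show "continuous_on {0..1} (\<lambda>x. k 0 (V 0 x))"
          by (rule continuous_on_compose2[OF k_0_cont]) (use V_range[of 0] in \<open>auto simp: V_def intro!: continuous_intros\<close>)
        show "continuous_on {0..1} (V' 0)" unfolding V'_def by (intro continuous_intros)
      qed
      have "(\<lambda>x. k 0 (V 0 x) * \<bar>V' 0 x\<bar>) \<in> borel_measurable ?N"
        by (rule continuous_imp_measurable_on_sets_lebesgue[OF continuous_on_subset[OF vc]]) auto
      then show ?thesis using u'm nu V_integral[of 0] by (subst nn_integral_add) (auto simp: nn_integral_cmult)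
    qed
    also have "\<dots> = ennreal (sqrt (\<theta> (\<delta>\<^sup>2)) * s + 2 * Psi \<omega> 1)"
      using s Psi_pos th_nonneg[of "\<delta>\<^sup>2"] \<delta> by (simp add: A_0 ennreal_mult' ennreal_plus power_less_one_iff)
    finally show ?thesis .
  qed
  have f: "filterlim (\<lambda>\<delta>::real. \<delta>\<^sup>2) (at_right 0) (at_right 0)"
    unfolding filterlim_at
  proof
    have "((\<lambda>\<delta>::real. \<delta>\<^sup>2) \<longlongrightarrow> 0\<^sup>2) (at_right 0)" by (intro tendsto_intros)
    then show "((\<lambda>\<delta>::real. \<delta>\<^sup>2) \<longlongrightarrow> 0) (at_right 0)" by simp
    show "\<forall>\<^sub>F \<delta> in at_right (0::real). \<delta>\<^sup>2 \<in> {0<..} \<and> \<delta>\<^sup>2 \<noteq> 0"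
      by (auto simp: eventually_at_filter)
  qed
  have "((\<lambda>\<delta>. ennreal (sqrt (\<theta> (\<delta>\<^sup>2)) * s + 2 * Psi \<omega> 1)) \<longlongrightarrow> ennreal (sqrt 0 * s + 2 * Psi \<omega> 1)) (at_right 0)"
    by (intro tendsto_intros filterlim_compose[OF th_tendsto_0 f])
  then have lim: "((\<lambda>\<delta>. ennreal (sqrt (\<theta> (\<delta>\<^sup>2)) * s + 2 * Psi \<omega> 1)) \<longlongrightarrow> ennreal (2 * Psi \<omega> 1)) (at_right 0)" by simp
  have "\<forall>\<^sub>F \<delta> in at_right 0. \<delta> \<in> {0<..<(1::real)}" by (rule eventually_at_right_real) simp
  then have "\<forall>\<^sub>F \<delta> in at_right 0. g l Q \<omega> s \<le> ennreal (sqrt (\<theta> (\<delta>\<^sup>2)) * s + 2 * Psi \<omega> 1)"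
    by eventually_elim (use le in auto)
  with lim show ?thesis by (rule tendsto_lowerbound) simp
qed

text \<open>With r the square root of W t / (\<theta> t (\<theta> t - \<theta> m)) one has
  \<open>dw m t\<close> = sqrt (\<theta> m) r and \<open>k m t\<close> = (\<theta> t - \<theta> m)
  r, so both sides equal (\<theta> t r)^2.\<close>

lemma optimal_profile:
  assumes m: "0 \<le> m" "m < t" "t < 1"
  shows "\<theta> t * (dw m t)\<^sup>2 + W t = (sqrt (\<theta> m) * dw m t + k m t)\<^sup>2" "0 \<le> dw m t"
proof -
  define r where "r = sqrt (W t / (\<theta> t * (\<theta> t - \<theta> m)))"
  have p: "0 \<le> \<theta> m" "0 < \<theta> t" "0 < \<theta> t - \<theta> m" "0 < W t"
    using th_nonneg[of m] th_pos[of t] th_strict_mono[of m t] W_pos[of t] m by auto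
  have r0: "0 \<le> r" using p by (simp add: r_def)
  have r2: "W t = r * r * \<theta> t * (\<theta> t - \<theta> m)" using p by (simp add: r_def)
  have d: "dw m t = sqrt (\<theta> m) * r" unfolding dw_def r_def real_sqrt_mult[symmetric] by (simp only: times_divide_eq_right)
  have k: "k m t = (\<theta> t - \<theta> m) * r"
  proof -
    have "W t * max 0 (1 - \<theta> m / \<theta> t) = ((\<theta> t - \<theta> m) * r)\<^sup>2"
      using p unfolding r2 by (simp add: max_def power2_eq_square field_simps)
    then show ?thesis using p r0 by (simp add: k_def)
  qed
  have q: "sqrt (\<theta> m) * sqrt (\<theta> m) = \<theta> m" using p by simp
  show "0 \<le> dw m t" unfolding d using p r0 by simp
  have "\<theta> t * (dw m t)\<^sup>2 + W t = \<theta> t * (sqrt (\<theta> m) * sqrt (\<theta> m)) * r * r + r * r * \<theta> t * (\<theta> t - \<theta> m)"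
    unfolding d using r2 by (simp add: power2_eq_square ac_simps)
  also have "\<dots> = (\<theta> t * r)\<^sup>2" unfolding q by (simp add: power2_eq_square algebra_simps)
  also have "\<theta> t * r = sqrt (\<theta> m) * sqrt (\<theta> m) * r + (\<theta> t - \<theta> m) * r" unfolding q by (simp add: algebra_simps)
  finally show "\<theta> t * (dw m t)\<^sup>2 + W t = (sqrt (\<theta> m) * dw m t + k m t)\<^sup>2" unfolding d k by (simp add: ac_simps)
qed

text \<open>The competitor is \<open>V m\<close> together with the slope
  \<open>dw m (V m x) * \<bar>V' m x\<bar>\<close>, for which Cauchy-Schwarz is an equality. In the
  variable y = \<bar>2 x - 1\<bar> the slope is 2 J m y: it is bounded, so u lies in H^1, and it
  integrates to P m.\<close>

lemma g_le_H:
  assumes m: "0 < m" "m < 1"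
  shows "g l Q \<omega> (P m) \<le> ennreal (H m (P m))"
proof -
  let ?N = "lebesgue_on {0<..<1::real}"
  define j where "j y = indicator {0<..<1} y * J m y" for y
  have jm: "j \<in> borel_measurable borel"
    using borel_measurable_continuous_on_indicator[OF _ J_measurable(2)[OF m]] by (simp add: j_def[abs_def])
  obtain B where B: "0 < B" "\<And>y. 0 < y \<Longrightarrow> y < 1 \<Longrightarrow> 0 \<le> J m y \<and> J m y \<le> B"
    using J_bound[of m m] m by (metis order_refl)
  have j0: "0 \<le> j y" "j y \<le> B" for y using B by (auto simp: j_def indicator_def)
  define u' where "u' x = 2 * j \<bar>2 * x - 1\<bar>" for x
  define u where "u = cdf_on ?N u'"
  have "u' \<in> borel_measurable borel" unfolding u'_def[abs_def] using jm by measurable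
  then have u'm: "u' \<in> borel_measurable ?N"
    by (intro measurable_restrict_space1 measurable_completion) simp
  have uH: "H1 0 1 u u'"
    by (rule H1_primitive[OF _ u'm, where B="2 * B" and c=0]) (use j0 in \<open>auto simp: u_def u'_def\<close>)
  have u0: "u 0 = 0" unfolding u_def by (rule cdf_on_le_left[where a=0 and b=1]) auto
  have u'I: "integrable ?N u'" by (rule H1_FTC(1)[OF _ uH]) simp
  have u'0: "0 \<le> u' x" for x using j0 by (simp add: u'_def)
  have nu: "(\<integral>\<^sup>+x. ennreal (u' x) \<partial>?N) = ennreal (P m)"
  proof -
    have "(\<integral>\<^sup>+x. ennreal (u' x) \<partial>?N) = (\<integral>\<^sup>+x. 2 * ennreal (j \<bar>2 * x - 1\<bar>) \<partial>?N)"
      by (simp add: u'_def ennreal_mult')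
    also have "\<dots> = 2 * (\<integral>\<^sup>+y. ennreal (j y) \<partial>?N)" by (rule nn_integral_reflect) (use jm in measurable)
    also have "(\<integral>\<^sup>+y. ennreal (j y) \<partial>?N) = (\<integral>\<^sup>+y. ennreal (J m y) \<partial>?N)"
      by (rule nn_integral_cong) (auto simp: j_def)
    also have "\<dots> = ennreal (\<integral>y. J m y \<partial>?N)"
      by (rule nn_integral_eq_integral[OF J_integrable[OF m]]) (use B in auto)
    finally show ?thesis using P_eq[OF m] by (simp add: ennreal_mult')
  qed
  then have "ennreal (\<integral>x. u' x \<partial>?N) = ennreal (P m)"
    using nn_integral_eq_integral[OF u'I] u'0 by simp
  then have "(\<integral>x. u' x \<partial>?N) = P m"
  proof -
    have "0 \<le> (\<integral>x. u' x \<partial>?N)" by (rule integral_nonneg_AE) (use u'0 in auto)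
    then show ?thesis using \<open>ennreal (\<integral>x. u' x \<partial>?N) = ennreal (P m)\<close> P_nonneg[of m] by (simp add: ennreal_inj)
  qed
  then have u1: "u 1 = P m" unfolding u_def using cdf_on_ge_right[of ?N 0 1 1 u'] by simp
  have "g l Q \<omega> (P m) \<le> g_energy l Q \<omega> (V m) u' (V' m)"
    by (rule g_le[OF uH u0 u1 V_H1]) (use V_range[of m] m in \<open>auto simp: V_def\<close>)
  also have "\<dots> \<le> (\<integral>\<^sup>+x. ennreal (sqrt (\<theta> m)) * ennreal (u' x) + ennreal (k m (V m x) * \<bar>V' m x\<bar>) \<partial>?N)"
    unfolding g_energy_def
  proof (rule nn_integral_mono_AE)
    \<comment> \<open>At x = 1/2 the curve touches the level m, where \<open>dw m\<close> has only a
      default value.\<close>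
    have "AE x in lebesgue. x \<noteq> (1/2::real)" by (intro AE_completion AE_lborel_singleton)
    then have "AE x in ?N. x \<noteq> 1/2" by (subst AE_restrict_space_iff) auto
    with AE_space[of ?N] show "AE x in ?N. ennsqrt (theta_ext l Q \<omega> (V m x) * ennreal ((u' x)\<^sup>2) + ennreal (\<omega> (1 - V m x) * (V' m x)\<^sup>2))
       \<le> ennreal (sqrt (\<theta> m)) * ennreal (u' x) + ennreal (k m (V m x) * \<bar>V' m x\<bar>)"
    proof (eventually_elim, goal_cases)
      case (1 x)
      then have True: "0 < x" "x < 1" by simp_all
      show ?case
      proof -
        define y where "y = \<bar>2 * x - 1\<bar>"
        have y: "0 < y" "y < 1" using True 1 by (auto simp: y_def)
        define t where "t = m + (1 - m) * y\<^sup>2"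
        have t: "m < t" "t < 1" using curve_in[of m y] m y by (auto simp: t_def)
        define z where "z = 4 * (1 - m) * y"
        have z: "0 \<le> z" using m y by (simp add: z_def)
        have Vt: "V m x = t" by (simp add: V_def t_def y_def)
        have Vz: "\<bar>V' m x\<bar> = z" using m by (simp add: V'_def z_def y_def abs_mult)
        then have Vz2: "(V' m x)\<^sup>2 = z\<^sup>2" by (metis power2_abs)
        have uz: "u' x = dw m t * z" using y by (simp add: u'_def j_def y_def[symmetric] J_def t_def[symmetric] z_def)
        have op: "\<theta> t * (dw m t)\<^sup>2 + W t = (sqrt (\<theta> m) * dw m t + k m t)\<^sup>2" "0 \<le> dw m t"
          using optimal_profile[of m t] m t by auto
        have p: "0 \<le> \<theta> m" "0 \<le> \<theta> t" "0 \<le> W t" "0 \<le> k m t"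
          using th_nonneg[of m] th_nonneg[of t] W_nonneg[of t] k_nonneg[of t m] m t by auto
        have "theta_ext l Q \<omega> (V m x) * ennreal ((u' x)\<^sup>2) + ennreal (\<omega> (1 - V m x) * (V' m x)\<^sup>2)
           = ennreal (\<theta> t * (dw m t * z)\<^sup>2 + W t * z\<^sup>2)"
          unfolding Vt uz Vz2 using t p by (simp add: theta_ext_less_1 ennreal_mult ennreal_plus W_def[symmetric])
        also have "\<theta> t * (dw m t * z)\<^sup>2 + W t * z\<^sup>2 = (\<theta> t * (dw m t)\<^sup>2 + W t) * z\<^sup>2"
          by (simp add: power_mult_distrib algebra_simps)
        also have "\<dots> = ((sqrt (\<theta> m) * dw m t + k m t) * z)\<^sup>2" unfolding op by (simp add: power_mult_distrib)
        finally have "ennsqrt (theta_ext l Q \<omega> (V m x) * ennreal ((u' x)\<^sup>2) + ennreal (\<omega> (1 - V m x) * (V' m x)\<^sup>2))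
          = ennreal ((sqrt (\<theta> m) * dw m t + k m t) * z)"
          using op p z by simp
        also have "\<dots> = ennreal (sqrt (\<theta> m) * (dw m t * z) + k m t * z)" by (simp add: algebra_simps)
        also have "\<dots> = ennreal (sqrt (\<theta> m)) * ennreal (dw m t * z) + ennreal (k m t * z)"
          using op p z by (simp add: ennreal_plus ennreal_mult')
        finally show ?thesis unfolding Vt Vz uz by simp
      qed
    qed
  qed
  also have "\<dots> = ennreal (sqrt (\<theta> m)) * ennreal (P m) + ennreal (A m)"
  proof -
    have vc: "continuous_on {0..1} (\<lambda>x. k m (V m x) * \<bar>V' m x\<bar>)"
    proof (intro continuous_intros)
      have "V m x \<in> {m..1}" if "x \<in> {0..1}" for x using V_range[of m x] that m by (auto simp: V_def)
      then show "continuous_on {0..1} (\<lambda>x. k m (V m x))"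
        by (intro continuous_on_compose2[OF k_cont'[of m]]) (use m in \<open>auto simp: V_def intro!: continuous_intros\<close>)
      show "continuous_on {0..1} (V' m)" unfolding V'_def by (intro continuous_intros)
    qed
    have "(\<lambda>x. k m (V m x) * \<bar>V' m x\<bar>) \<in> borel_measurable ?N"
      by (rule continuous_imp_measurable_on_sets_lebesgue[OF continuous_on_subset[OF vc]]) auto
    then show ?thesis using u'm nu V_integral[of m] m by (subst nn_integral_add) (auto simp: nn_integral_cmult)
  qed
  also have "\<dots> = ennreal (H m (P m))"
    using P_nonneg[of m] A_nonneg[of m] th_nonneg[of m] m by (simp add: H_def ennreal_mult' ennreal_plus)
  finally show ?thesis .
qed

end

section \<open>The surface energy as an infimum of affine functions\<close>

text \<open>The supergradient inequalities at s and at y trap the difference quotient between p s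
  and p y, and p y tends to p s.\<close>

lemma has_derivative_of_supergradient:
  fixes f p :: "real \<Rightarrow> real"
  assumes sup: "\<And>x y. x \<in> D \<Longrightarrow> y \<in> D \<Longrightarrow> f y \<le> f x + p x * (y - x)"
    and cont: "continuous_on D p" and s: "s \<in> D"
  shows "(f has_real_derivative p s) (at s within D)"
  unfolding has_field_derivative_iff
proof (rule Lim_transform2[where f="\<lambda>_. p s"])
  have lim: "(p \<longlongrightarrow> p s) (at s within D)" using cont s by (simp add: continuous_on_def)
  have "((\<lambda>y. p y - p s) \<longlongrightarrow> p s - p s) (at s within D)" by (intro tendsto_intros lim)
  then have 0: "((\<lambda>y. p y - p s) \<longlongrightarrow> 0) (at s within D)" by simp
  show "((\<lambda>y. p s - (f y - f s) / (y - s)) \<longlongrightarrow> 0) (at s within D)"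
  proof (rule Lim_null_comparison[OF _ tendsto_rabs_zero[OF 0]])
    show "\<forall>\<^sub>F y in at s within D. norm (p s - (f y - f s) / (y - s)) \<le> \<bar>p y - p s\<bar>"
      unfolding eventually_at_filter
    proof (intro always_eventually allI impI)
      fix y assume y: "y \<noteq> s" "y \<in> D"
      have a: "f y - f s \<le> p s * (y - s)" "p y * (y - s) \<le> f y - f s"
        using sup[OF s y(2)] sup[OF y(2) s] by (auto simp: algebra_simps)
      consider "s < y" | "y < s" using y by linarith
      then show "norm (p s - (f y - f s) / (y - s)) \<le> \<bar>p y - p s\<bar>"
      proof cases
        case 1
        then have "(f y - f s) / (y - s) \<le> p s" "p y \<le> (f y - f s) / (y - s)"
          using a by (simp_all add: pos_divide_le_eq pos_le_divide_eq)
        then show ?thesis by auto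
      next
        case 2
        then have "p s \<le> (f y - f s) / (y - s)" "(f y - f s) / (y - s) \<le> p y"
          using a by (simp_all add: neg_divide_le_eq neg_le_divide_eq)
        then show ?thesis by auto
      qed
    qed
  qed
qed (rule tendsto_const)

locale cohesive_decreasing = cohesive +
  assumes Phi_decr: "strict_antimono_on {0<..<1} (Phi l Q \<omega>)"
begin

lemma P_less: "0 < x \<Longrightarrow> x < y \<Longrightarrow> y < 1 \<Longrightarrow> P y < P x"
proof -
  assume a: "0 < x" "x < y" "y < 1"
  have "Phi l Q \<omega> y < Phi l Q \<omega> x"
    using monotone_onD[OF Phi_decr, of x y] a by simp
  then show "P y < P x" using Phi_P[of x] Phi_P[of y] a P_nonneg[of y] by (simp add: ennreal_less_iff)
qed

lemma P_pos: "0 < x \<Longrightarrow> x < 1 \<Longrightarrow> 0 < P x"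
  using P_less[of x "(x + 1) / 2"] P_nonneg[of "(x + 1) / 2"] by auto

lemma q_less: "0 \<le> x \<Longrightarrow> x < y \<Longrightarrow> y < 1 \<Longrightarrow> sqrt (\<theta> x) < sqrt (\<theta> y)"
  using th_strict_mono by simp

section \<open>Monotonicity of H in m\<close>

text \<open>In \<open>Phi_integral\<close> the factor \<Phi> lies between P m2 and P m1, and the
  remaining factor is the derivative of sqrt \<theta>.\<close>

lemma A_diff_weak:
  assumes m: "0 < m1" "m1 < m2" "m2 < 1"
  shows "(sqrt (\<theta> m2) - sqrt (\<theta> m1)) * P m2 \<le> A m1 - A m2"
    and "A m1 - A m2 \<le> (sqrt (\<theta> m2) - sqrt (\<theta> m1)) * P m1"
proof -
  let ?q = "\<lambda>x. deriv \<theta> x / (2 * sqrt (\<theta> x))"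
  have q0: "0 \<le> ?q x" if "m1 < x" "x < m2" for x
    using th_deriv_pos[of x] th_pos[of x] that m by simp
  have qc: "(\<integral>\<^sup>+x. ennreal c * ennreal (?q x) \<partial>lebesgue_on {m1<..<m2}) = ennreal ((sqrt (\<theta> m2) - sqrt (\<theta> m1)) * c)" if "0 \<le> c" for c
  proof -
    have "((\<lambda>x. c * ?q x) has_integral c * (sqrt (\<theta> m2) - sqrt (\<theta> m1))) {m1..m2}"
      by (intro has_integral_mult_right q_has_integral) (use m in auto)
    from nn_integral_lebesgue_on_has_integral[OF this] show ?thesis
      unfolding ennreal_mult'[OF that, symmetric] using mult_nonneg_nonneg[OF that q0] by (simp only: mult.commute)
  qed
  have "ennreal ((sqrt (\<theta> m2) - sqrt (\<theta> m1)) * P m2) \<le> ennreal (A m1 - A m2)"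
    unfolding Phi_integral[OF m, symmetric] qc[OF P_nonneg, symmetric]
  proof (rule nn_integral_mono)
    fix x assume "x \<in> space (lebesgue_on {m1<..<m2})"
    then have x: "m1 < x" "x < m2" by auto
    then have "Phi l Q \<omega> x = ennreal (P x)" "P m2 \<le> P x" using Phi_P[of x] P_less[of x m2] m by auto
    then show "ennreal (P m2) * ennreal (?q x) \<le> Phi l Q \<omega> x * ennreal (?q x)"
      by (auto intro!: mult_right_mono ennreal_leI)
  qed
  \<comment> \<open>The sign of A m1 - A m2 is not known at this point; positivity of the lower
    bound is what allows the inequality to be read off in the reals.\<close>
  moreover have "0 < (sqrt (\<theta> m2) - sqrt (\<theta> m1)) * P m2" using q_less[of m1 m2] P_pos[of m2] m by simp
  ultimately show "(sqrt (\<theta> m2) - sqrt (\<theta> m1)) * P m2 \<le> A m1 - A m2"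
    by (metis ennreal_le_iff2 leD less_imp_le)
  have "ennreal (A m1 - A m2) \<le> ennreal ((sqrt (\<theta> m2) - sqrt (\<theta> m1)) * P m1)"
    unfolding Phi_integral[OF m, symmetric] qc[OF P_nonneg, symmetric]
  proof (rule nn_integral_mono)
    fix x assume "x \<in> space (lebesgue_on {m1<..<m2})"
    then have x: "m1 < x" "x < m2" by auto
    then have "Phi l Q \<omega> x = ennreal (P x)" "P x \<le> P m1" using Phi_P[of x] P_less[of m1 x] m by auto
    then show "Phi l Q \<omega> x * ennreal (?q x) \<le> ennreal (P m1) * ennreal (?q x)"
      by (auto intro!: mult_right_mono ennreal_leI)
  qed
  moreover have "0 \<le> (sqrt (\<theta> m2) - sqrt (\<theta> m1)) * P m1" using q_less[of m1 m2] P_pos[of m1] m by simp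
  ultimately show "A m1 - A m2 \<le> (sqrt (\<theta> m2) - sqrt (\<theta> m1)) * P m1"
    using ennreal_le_iff by blast
qed

text \<open>Strictness comes from splitting at the midpoint, where P already differs from its values
  at both ends.\<close>

lemma A_diff:
  assumes m: "0 < m1" "m1 < m2" "m2 < 1"
  shows "(sqrt (\<theta> m2) - sqrt (\<theta> m1)) * P m2 < A m1 - A m2"
    and "A m1 - A m2 < (sqrt (\<theta> m2) - sqrt (\<theta> m1)) * P m1"
proof -
  define m where "m = (m1 + m2) / 2"
  have mm: "m1 < m" "m < m2" using assms by (auto simp: m_def)
  have q: "sqrt (\<theta> m1) < sqrt (\<theta> m)" "sqrt (\<theta> m) < sqrt (\<theta> m2)" using q_less[of m1 m] q_less[of m m2] mm assms by auto
  have p: "P m < P m1" "P m2 < P m" using P_less[of m1 m] P_less[of m m2] mm assms by auto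
  have "(sqrt (\<theta> m) - sqrt (\<theta> m1)) * P m2 < (sqrt (\<theta> m) - sqrt (\<theta> m1)) * P m"
    by (rule mult_strict_left_mono) (use q p in auto)
  then show "(sqrt (\<theta> m2) - sqrt (\<theta> m1)) * P m2 < A m1 - A m2"
    using A_diff_weak(1)[of m1 m] A_diff_weak(1)[of m m2] mm assms by (simp add: algebra_simps)
  have "(sqrt (\<theta> m2) - sqrt (\<theta> m)) * P m < (sqrt (\<theta> m2) - sqrt (\<theta> m)) * P m1"
    by (rule mult_strict_left_mono) (use q p in auto)
  then show "A m1 - A m2 < (sqrt (\<theta> m2) - sqrt (\<theta> m1)) * P m1"
    using A_diff_weak(2)[of m1 m] A_diff_weak(2)[of m m2] mm assms by (simp add: algebra_simps)
qed

text \<open>Formally the m-derivative of \<open>H m s\<close> is (s - P m) times that of sqrt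
  \<theta>, which is negative while P m > s. As P decreases, it is enough to compare s with the
  value at the right end m2.\<close>

lemma H_decreasing:
  assumes m: "0 < m1" "m1 < m2" "m2 < 1" and s: "s \<le> P m2"
  shows "H m2 s < H m1 s"
proof -
  have "(sqrt (\<theta> m2) - sqrt (\<theta> m1)) * s \<le> (sqrt (\<theta> m2) - sqrt (\<theta> m1)) * P m2"
    using q_less[of m1 m2] m s by (intro mult_left_mono) auto
  then show ?thesis using A_diff(1)[OF m] by (simp add: H_def algebra_simps)
qed

lemma H_increasing:
  assumes m: "0 < m1" "m1 < m2" "m2 < 1" and s: "P m1 \<le> s"
  shows "H m1 s < H m2 s"
proof -
  have "(sqrt (\<theta> m2) - sqrt (\<theta> m1)) * P m1 \<le> (sqrt (\<theta> m2) - sqrt (\<theta> m1)) * s"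
    using q_less[of m1 m2] m s by (intro mult_left_mono) auto
  then show ?thesis using A_diff(2)[OF m] by (simp add: H_def algebra_simps)
qed

lemma H_min:
  assumes m: "0 < m" "m < 1" "0 < m'" "m' < 1" "m' \<noteq> m"
  shows "H m (P m) < H m' (P m)"
  using H_decreasing[of m' m "P m"] H_increasing[of m m' "P m"] m by (cases "m' < m") auto

lemma ev_left_1: "\<forall>\<^sub>F m in at_left 1. 0 < m \<and> m < (1::real)"
  using eventually_at_left_real[of 0 1] by auto

lemma ev_right_0: "0 < d \<Longrightarrow> \<forall>\<^sub>F m in at_right 0. 0 < m \<and> m < (d::real)"
  using eventually_at_right_real[of 0 d] by auto

lemma H_tendsto_0: "((\<lambda>m. H m s) \<longlongrightarrow> 2 * Psi \<omega> 1) (at_right 0)"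
proof -
  have "((\<lambda>m. sqrt (\<theta> m) * s + A m) \<longlongrightarrow> sqrt 0 * s + 2 * Psi \<omega> 1) (at_right 0)"
    by (intro tendsto_intros A_tendsto_0 th_tendsto_0)
  then show ?thesis by (simp add: H_def[abs_def])
qed

lemma q_tendsto_1: "((\<lambda>m. ennreal (sqrt (\<theta> m))) \<longlongrightarrow> ennsqrt T) (at_left 1)"
proof (cases "T = top")
  case True
  then have "filterlim \<theta> at_top (at_left 1)"
    using T_tendsto by (simp add: ennreal_tendsto_top_eq_at_top)
  then have "filterlim (\<lambda>t. sqrt (\<theta> t)) at_top (at_left 1)"
    by (rule filterlim_compose[OF sqrt_at_top])
  then have "((\<lambda>t. ennreal (sqrt (\<theta> t))) \<longlongrightarrow> top) (at_left 1)"
    by (rule iffD2[OF ennreal_tendsto_top_eq_at_top])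
  then show ?thesis using True by simp
next
  case False
  then obtain r where r: "T = ennreal r" "0 \<le> r" by (cases T) auto
  have "\<forall>\<^sub>F t in at_left 1. 0 \<le> \<theta> t" using ev_left_1 by eventually_elim (auto intro: th_nonneg)
  then have "(\<theta> \<longlongrightarrow> r) (at_left 1)" using T_tendsto r by (simp add: tendsto_ennreal_iff)
  then have "((\<lambda>t. ennreal (sqrt (\<theta> t))) \<longlongrightarrow> ennreal (sqrt r)) (at_left 1)" by (intro tendsto_intros)
  then show ?thesis using r by simp
qed

lemma q_mult_tendsto_1:
  "((\<lambda>m. ennreal (sqrt (\<theta> m)) * ennreal s) \<longlongrightarrow> ennsqrt T * ennreal s) (at_left 1)"
proof (cases "s \<le> 0")
  case False
  then show ?thesis by (intro tendsto_mult_ennreal q_tendsto_1 tendsto_const) auto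
qed (simp add: ennreal_neg)

lemma inf_less_Phi: "0 < m \<Longrightarrow> m < 1 \<Longrightarrow> inf_Phi l Q \<omega> < ennreal (P m)"
  and Phi_less_sup: "0 < m \<Longrightarrow> m < 1 \<Longrightarrow> ennreal (P m) < sup_Phi l Q \<omega>"
proof -
  assume m: "0 < m" "m < 1"
  have "inf_Phi l Q \<omega> \<le> Phi l Q \<omega> ((m + 1) / 2)" unfolding inf_Phi_def by (rule INF_lower) (use m in auto)
  also have "\<dots> = ennreal (P ((m + 1) / 2))" by (rule Phi_P) (use m in auto)
  also have "\<dots> < ennreal (P m)" using P_less[of m "(m + 1) / 2"] m P_nonneg by (simp add: ennreal_less_iff)
  finally show "inf_Phi l Q \<omega> < ennreal (P m)" .
  have "ennreal (P m) < ennreal (P (m / 2))" using P_less[of "m / 2" m] m P_nonneg by (simp add: ennreal_less_iff)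
  also have "\<dots> = Phi l Q \<omega> (m / 2)" by (rule Phi_P[symmetric]) (use m in auto)
  also have "\<dots> \<le> sup_Phi l Q \<omega>" unfolding sup_Phi_def by (rule SUP_upper) (use m in auto)
  finally show "ennreal (P m) < sup_Phi l Q \<omega>" .
qed

lemma inf_less_iff: "inf_Phi l Q \<omega> < ennreal s \<longleftrightarrow> (\<exists>m. 0 < m \<and> m < 1 \<and> ennreal (P m) < ennreal s)"
  unfolding inf_Phi_def INF_less_iff by (metis Phi_P greaterThanLessThan_iff)

lemma less_sup_iff: "ennreal s < sup_Phi l Q \<omega> \<longleftrightarrow> (\<exists>m. 0 < m \<and> m < 1 \<and> ennreal s < ennreal (P m))"
  unfolding sup_Phi_def less_SUP_iff by (metis Phi_P greaterThanLessThan_iff)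

lemma inf_less_sup: "inf_Phi l Q \<omega> < sup_Phi l Q \<omega>"
  using inf_less_Phi[of "1/2"] Phi_less_sup[of "1/2"] by auto

lemma P_surj:
  assumes s: "0 \<le> s" "inf_Phi l Q \<omega> < ennreal s" "ennreal s < sup_Phi l Q \<omega>"
  shows "\<exists>m. 0 < m \<and> m < 1 \<and> P m = s"
proof -
  obtain m1 where m1: "0 < m1" "m1 < 1" "ennreal (P m1) < ennreal s" using s(2) inf_less_iff by auto
  obtain m2 where m2: "0 < m2" "m2 < 1" "ennreal s < ennreal (P m2)" using s(3) less_sup_iff by auto
  have le: "P m1 \<le> s" "s \<le> P m2" using m1 m2 s P_nonneg by (auto simp: ennreal_less_iff)
  have lt: "P m1 < P m2" using m1 m2 s P_nonneg by (auto simp: ennreal_less_iff)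
  have "m2 \<le> m1"
  proof (rule ccontr)
    assume "\<not> m2 \<le> m1"
    then have "P m2 < P m1" using P_less[of m1 m2] m1 m2 by auto
    then show False using lt by simp
  qed
  then have "\<exists>m. m2 \<le> m \<and> m \<le> m1 \<and> P m = s"
    by (intro IVT2' le P_cont_Icc) (use m1 m2 in auto)
  then obtain m where "m2 \<le> m" "m \<le> m1" "P m = s" by blast
  then show ?thesis using m1 m2 by (intro exI[of _ m]) linarith
qed

text \<open>The inverse of P, meaningful strictly between inf \<Phi> and sup \<Phi>; it is free of
  the end point conventions built into \<open>m_of\<close>.\<close>

definition M where "M s = (THE m. 0 < m \<and> m < 1 \<and> P m = s)"

lemma M_P: "0 < m \<Longrightarrow> m < 1 \<Longrightarrow> M (P m) = m"
  unfolding M_def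
proof (rule the_equality)
  fix m' assume m: "0 < m" "m < 1" and m': "0 < m' \<and> m' < 1 \<and> P m' = P m"
  show "m' = m"
  proof (rule ccontr)
    assume "m' \<noteq> m"
    then consider "m' < m" | "m < m'" by linarith
    then show False using P_less[of m m'] P_less[of m' m] m m' by cases simp_all
  qed
qed auto

lemma M_props:
  assumes "0 \<le> s" "inf_Phi l Q \<omega> < ennreal s" "ennreal s < sup_Phi l Q \<omega>"
  shows "0 < M s" "M s < 1" "P (M s) = s"
  using P_surj[OF assms] M_P by auto

lemma g_P: "0 < m \<Longrightarrow> m < 1 \<Longrightarrow> g l Q \<omega> (P m) = ennreal (H m (P m))"
proof (rule antisym)
  assume m: "0 < m" "m < 1"
  show "g l Q \<omega> (P m) \<le> ennreal (H m (P m))" by (rule g_le_H[OF m])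
  show "ennreal (H m (P m)) \<le> g l Q \<omega> (P m)"
  proof (rule g_ge[OF P_nonneg])
    fix m' :: real assume "0 < m'" "m' < 1"
    then show "H m (P m) \<le> H m' (P m)" using H_min[of m m'] m by (cases "m' = m") (auto intro: less_imp_le)
  qed
qed

lemma le_inf_iff: "ennreal s \<le> inf_Phi l Q \<omega> \<Longrightarrow> 0 < m \<Longrightarrow> m < 1 \<Longrightarrow> s \<le> P m"
  using inf_less_Phi[of m] P_nonneg[of m] by (metis ennreal_less_iff le_less_trans less_imp_le not_le ennreal_neg)

lemma ge_sup_iff: "sup_Phi l Q \<omega> \<le> ennreal s \<Longrightarrow> 0 < m \<Longrightarrow> m < 1 \<Longrightarrow> P m \<le> s"
  using Phi_less_sup[of m] P_nonneg[of m] by (metis ennreal_less_iff less_le_trans less_imp_le)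

section \<open>The three regimes of the surface energy\<close>

text \<open>For s \<le> inf \<Phi> the function m \<mapsto> H m s decreases on all of (0, 1), so its
  infimum sits at m = 1, where A vanishes. Proving the lower bound sqrt (\<theta> m) s for each m
  first, and then letting m tend to 1, also covers an infinite slope.\<close>

lemma g_inf:
  assumes s: "0 \<le> s" "ennreal s \<le> inf_Phi l Q \<omega>"
  shows "g l Q \<omega> s = ennsqrt T * ennreal s"
proof (rule antisym)
  show "g l Q \<omega> s \<le> ennsqrt T * ennreal s" by (rule g_le_linear[OF s(1)])
  have le: "ennreal (sqrt (\<theta> m)) * ennreal s \<le> g l Q \<omega> s" if m: "0 < m" "m < 1" for m
  proof -
    have "ennreal (sqrt (\<theta> m) * s) \<le> g l Q \<omega> s"
    proof (rule g_ge[OF s(1)])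
      fix m' :: real assume m': "0 < m'" "m' < 1"
      show "sqrt (\<theta> m) * s \<le> H m' s"
      proof (cases "m \<le> m'")
        case True
        then have "sqrt (\<theta> m) * s \<le> sqrt (\<theta> m') * s" using th_mono[of m m'] m m' s by (intro mult_right_mono) auto
        then show ?thesis using A_nonneg[of m'] m' by (simp add: H_def)
      next
        case False
        then have "H m s < H m' s" using H_decreasing[of m' m s] le_inf_iff[OF s(2) m] m m' by auto
        then show ?thesis using A_nonneg[of m] m by (simp add: H_def)
      qed
    qed
    then show ?thesis using s th_nonneg[of m] m by (simp add: ennreal_mult')
  qed
  show "ennsqrt T * ennreal s \<le> g l Q \<omega> s"
  proof (rule tendsto_upperbound)
    show "((\<lambda>m. ennreal (sqrt (\<theta> m)) * ennreal s) \<longlongrightarrow> ennsqrt T * ennreal s) (at_left 1)" by (rule q_mult_tendsto_1)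
    show "\<forall>\<^sub>F m in at_left 1. ennreal (sqrt (\<theta> m)) * ennreal s \<le> g l Q \<omega> s"
      using ev_left_1 by eventually_elim (use le in auto)
  qed simp
qed

text \<open>For s \<ge> sup \<Phi> the function m \<mapsto> H m s increases throughout (0, 1), so it
  stays above its limit at m = 0.\<close>

lemma H_ge_Psi:
  assumes s: "sup_Phi l Q \<omega> \<le> ennreal s" and m: "0 < m" "m < 1"
  shows "2 * Psi \<omega> 1 \<le> H m s"
proof (rule tendsto_upperbound[OF H_tendsto_0])
  show "\<forall>\<^sub>F m' in at_right 0. H m' s \<le> H m s"
    using ev_right_0[OF m(1)]
  proof eventually_elim
    case (elim m')
    then show ?case using H_increasing[of m' m s] ge_sup_iff[OF s, of m'] m by auto
  qed
qed simp

lemma g_sup: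
  assumes s: "0 \<le> s" "sup_Phi l Q \<omega> \<le> ennreal s"
  shows "g l Q \<omega> s = ennreal (2 * Psi \<omega> 1)"
  by (intro antisym g_le_Psi g_ge H_ge_Psi s)

lemma Phi_tendsto_0: "(Phi l Q \<omega> \<longlongrightarrow> sup_Phi l Q \<omega>) (at_right 0)"
proof (rule order_tendstoI)
  fix y assume "y < sup_Phi l Q \<omega>"
  then obtain m where m: "0 < m" "m < 1" "y < Phi l Q \<omega> m" by (auto simp: sup_Phi_def less_SUP_iff)
  show "\<forall>\<^sub>F t in at_right 0. y < Phi l Q \<omega> t"
    using ev_right_0[OF m(1)]
  proof eventually_elim
    case (elim t)
    have "Phi l Q \<omega> m \<le> Phi l Q \<omega> t" using P_less[of t m] Phi_P[of t] Phi_P[of m] m elim by (simp add: ennreal_leI)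
    with m(3) show ?case by (rule less_le_trans)
  qed
next
  fix y assume y: "sup_Phi l Q \<omega> < y"
  show "\<forall>\<^sub>F t in at_right 0. Phi l Q \<omega> t < y"
    using ev_right_0[OF zero_less_one]
  proof eventually_elim
    case (elim t)
    then have "Phi l Q \<omega> t \<le> sup_Phi l Q \<omega>" unfolding sup_Phi_def by (intro SUP_upper) auto
    then show ?case using y by (rule le_less_trans)
  qed
qed

lemma g_finite: "0 \<le> s \<Longrightarrow> g l Q \<omega> s < top"
  using g_le_Psi[of s] by (auto simp: less_top[symmetric] top_unique)

lemma g_real: "0 \<le> s \<Longrightarrow> ennreal (g_real l Q \<omega> s) = g l Q \<omega> s"
  using g_finite[of s] by (simp add: g_real_def)

text \<open>The explicit competitor gives this bound only at s = P m. Going through the three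
  regimes extends it to all openings, which makes each \<open>H m\<close> a global majorant of g and
  its slope a supergradient wherever the two touch.\<close>

lemma g_le_H_all:
  assumes s: "0 \<le> s" and m: "0 < m" "m < 1"
  shows "g l Q \<omega> s \<le> ennreal (H m s)"
proof -
  consider "ennreal s \<le> inf_Phi l Q \<omega>" | "inf_Phi l Q \<omega> < ennreal s" "ennreal s < sup_Phi l Q \<omega>" | "sup_Phi l Q \<omega> \<le> ennreal s"
    by (meson not_le)
  then show ?thesis
  proof cases
    case 1
    show ?thesis unfolding g_inf[OF s 1]
    proof (rule tendsto_upperbound)
      show "((\<lambda>m. ennreal (sqrt (\<theta> m)) * ennreal s) \<longlongrightarrow> ennsqrt T * ennreal s) (at_left 1)" by (rule q_mult_tendsto_1)
      have "\<forall>\<^sub>F t in at_left 1. t \<in> {m<..<1}" by (rule eventually_at_left_real) (use m in simp)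
      then show "\<forall>\<^sub>F t in at_left 1. ennreal (sqrt (\<theta> t)) * ennreal s \<le> ennreal (H m s)"
      proof eventually_elim
        case (elim t)
        then have t: "m < t" "t < 1" "0 < t" using m by auto
        have "sqrt (\<theta> t) * s \<le> H t s" using A_nonneg[of t] t by (simp add: H_def)
        also have "\<dots> \<le> H m s" using H_decreasing[of m t s] le_inf_iff[OF 1, of t] m t by auto
        finally show ?case using th_nonneg[of t] t s by (simp add: ennreal_mult'[symmetric] ennreal_leI)
      qed
    qed simp
  next
    case 2
    note Ms = M_props[OF s 2]
    have "H (M s) s \<le> H m s" using H_min[of "M s" m] Ms m by (cases "m = M s") auto
    then show ?thesis using g_P[of "M s"] Ms by (simp add: ennreal_leI)
  next
    case 3
    then show ?thesis using g_sup[OF s 3] H_ge_Psi[OF 3 m] by (simp add: ennreal_leI)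
  qed
qed

text \<open>Below sup \<Phi> the function m \<mapsto> H m s still decreases near m = 0, so it falls
  strictly below its limit there. The intermediate point m / 2 turns the comparison with the limit
  into a strict one.\<close>

lemma g_less_Psi:
  assumes s: "0 \<le> s" "ennreal s < sup_Phi l Q \<omega>"
  shows "g l Q \<omega> s < ennreal (2 * Psi \<omega> 1)"
proof -
  obtain m where m: "0 < m" "m < 1" "s < P m" using s less_sup_iff by (auto simp: ennreal_less_iff)
  have "H m s < H (m / 2) s" by (rule H_decreasing) (use m in auto)
  also have "H (m / 2) s \<le> 2 * Psi \<omega> 1"
  proof (rule tendsto_lowerbound[OF H_tendsto_0])
    show "\<forall>\<^sub>F m' in at_right 0. H (m / 2) s \<le> H m' s"
      using ev_right_0[OF half_gt_zero[OF m(1)]]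
    proof eventually_elim
      case (elim m')
      then show ?case using H_decreasing[of m' "m / 2" s] P_less[of "m / 2" m] m by auto
    qed
  qed simp
  finally have "ennreal (H m s) < ennreal (2 * Psi \<omega> 1)" using Psi_pos by (simp add: ennreal_lessI)
  then show ?thesis using g_le_H_all[OF s(1) m(1,2)] by (rule le_less_trans[rotated])
qed

lemma s_frac_eq: "s_frac l Q \<omega> = sup_Phi l Q \<omega>"
proof (rule antisym)
  show "s_frac l Q \<omega> \<le> sup_Phi l Q \<omega>"
    unfolding s_frac_def
  proof (rule Sup_least, clarify)
    fix s :: real assume s: "0 \<le> s" "g l Q \<omega> s < ennreal (2 * Psi \<omega> 1)"
    show "ennreal s \<le> sup_Phi l Q \<omega>"
      using g_sup[OF s(1)] s(2) by (cases "sup_Phi l Q \<omega> \<le> ennreal s") auto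
  qed
  show "sup_Phi l Q \<omega> \<le> s_frac l Q \<omega>"
    unfolding sup_Phi_def
  proof (rule SUP_least)
    fix m :: real assume "m \<in> {0<..<1}"
    then have m: "0 < m" "m < 1" by auto
    show "Phi l Q \<omega> m \<le> s_frac l Q \<omega>"
      unfolding Phi_P[OF m] s_frac_def
      by (rule Sup_upper) (use g_less_Psi[OF P_nonneg Phi_less_sup[OF m]] P_nonneg in auto)
  qed
qed

lemma H_nonneg: "0 < m \<Longrightarrow> m < 1 \<Longrightarrow> 0 \<le> s \<Longrightarrow> 0 \<le> H m s"
  using A_nonneg[of m] th_nonneg[of m] by (simp add: H_def)

lemma g_real_le_H: "0 \<le> s \<Longrightarrow> 0 < m \<Longrightarrow> m < 1 \<Longrightarrow> g_real l Q \<omega> s \<le> H m s"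
  using g_le_H_all[of s m] g_real[of s] H_nonneg[of m s] by (metis ennreal_le_iff)

lemma g_real_M:
  assumes "0 \<le> s" "inf_Phi l Q \<omega> < ennreal s" "ennreal s < sup_Phi l Q \<omega>"
  shows "g_real l Q \<omega> s = H (M s) s"
  using g_P[of "M s"] M_props[OF assms] H_nonneg[of "M s" s] assms by (simp add: g_real_def)

section \<open>Derivative and concavity of the surface energy\<close>

text \<open>Otherwise the linear regime would contain positive openings and have infinite slope,
  against the bound by 2 \<Psi>(1).\<close>

lemma T_top_inf: "T = top \<Longrightarrow> inf_Phi l Q \<omega> = 0"
proof (rule ccontr)
  assume T: "T = top" and ne: "inf_Phi l Q \<omega> \<noteq> 0"
  then have "0 < inf_Phi l Q \<omega>" by (simp add: zero_less_iff_neq_zero)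
  then obtain s where s: "0 < s" "s < inf_Phi l Q \<omega>" using dense by blast
  then obtain r where r: "s = ennreal r" "0 < r" by (cases s) auto
  have "g l Q \<omega> r = top" using g_inf[of r] r s T by (simp add: ennreal_top_mult)
  then show False using g_finite[of r] r by simp
qed

text \<open>The derivative of the surface energy: \<open>p s\<close> is the slope of the affine function \<open>H (m\<^sub>s)\<close> that touches it at \<open>s\<close>.\<close>

definition p where
  "p s = (if ennreal s \<le> inf_Phi l Q \<omega> then enn2real (ennsqrt T)
     else if sup_Phi l Q \<omega> \<le> ennreal s then 0 else sqrt (\<theta> (M s)))"

text \<open>The openings at which the slope is a real number: 0 is left out if \<theta>(1-) is
  infinite.\<close>

definition D where "D = (if T = top then {0<..} else {0::real..})"

lemma D_cases [consumes 1, case_names inf mid sup]: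
  assumes "s \<in> D"
  obtains "0 \<le> s" "ennreal s \<le> inf_Phi l Q \<omega>" "T < top"
    | "0 \<le> s" "inf_Phi l Q \<omega> < ennreal s" "ennreal s < sup_Phi l Q \<omega>"
    | "0 \<le> s" "sup_Phi l Q \<omega> \<le> ennreal s"
proof -
  have s: "0 \<le> s" using assms by (auto simp: D_def split: if_splits)
  have "T < top" if "ennreal s \<le> inf_Phi l Q \<omega>"
    using that assms T_top_inf by (auto simp: D_def less_top split: if_splits)
  then show ?thesis using that s by (meson not_le)
qed

lemma p_inf: "ennreal s \<le> inf_Phi l Q \<omega> \<Longrightarrow> p s = enn2real (ennsqrt T)"
  and p_mid: "inf_Phi l Q \<omega> < ennreal s \<Longrightarrow> ennreal s < sup_Phi l Q \<omega> \<Longrightarrow> p s = sqrt (\<theta> (M s))"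
  and p_sup: "sup_Phi l Q \<omega> \<le> ennreal s \<Longrightarrow> p s = 0"
  using inf_less_sup by (auto simp: p_def not_le not_less)

lemma ennsqrt_T_finite: "T < top \<Longrightarrow> ennsqrt T = ennreal (enn2real (ennsqrt T))"
  by (cases T) auto

lemma q_le_real: "T < top \<Longrightarrow> 0 \<le> m \<Longrightarrow> m < 1 \<Longrightarrow> sqrt (\<theta> m) \<le> enn2real (ennsqrt T)"
  using q_le_T[of m] ennsqrt_T_finite by (metis enn2real_nonneg ennreal_le_iff)

lemma p_nonneg: "s \<in> D \<Longrightarrow> 0 \<le> p s"
  by (cases s rule: D_cases) (auto simp: p_inf p_mid p_sup M_props th_nonneg less_imp_le)

text \<open>Together with \<open>p_le_q\<close> this orders p s and sqrt (\<theta> m) according to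
  the order of s and P m, uniformly over the three regimes. These two comparisons carry the
  continuity proof, in place of continuity of the inverse M.\<close>

lemma q_le_p:
  assumes s: "s \<in> D" and m: "0 < m" "m < 1" "s \<le> P m"
  shows "sqrt (\<theta> m) \<le> p s"
  using s
proof (cases s rule: D_cases)
  case inf then show ?thesis using q_le_real[of m] m by (simp add: p_inf)
next
  case mid
  note Ms = M_props[OF mid]
  have "m \<le> M s" using P_less[of "M s" m] Ms m by (cases "M s < m") auto
  then show ?thesis using th_mono[of m "M s"] Ms m mid by (simp add: p_mid)
next
  case sup
  have "ennreal s \<le> ennreal (P m)" using m by (simp add: ennreal_leI)
  from le_less_trans[OF order_trans[OF sup(2) this] Phi_less_sup[OF m(1,2)]] show ?thesis by simp
qed

lemma p_le_q:
  assumes s: "s \<in> D" and m: "0 < m" "m < 1" "P m \<le> s"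
  shows "p s \<le> sqrt (\<theta> m)"
  using s
proof (cases s rule: D_cases)
  case inf
  have "ennreal (P m) \<le> ennreal s" using m by (simp add: ennreal_leI)
  from less_le_trans[OF inf_less_Phi[OF m(1,2)] order_trans[OF this inf(2)]] show ?thesis by simp
next
  case mid
  note Ms = M_props[OF mid]
  have "M s \<le> m" using P_less[of m "M s"] Ms m by (cases "m < M s") auto
  then show ?thesis using th_mono[of "M s" m] Ms m mid by (simp add: p_mid)
next
  case sup then show ?thesis using th_nonneg[of m] m by (simp add: p_sup)
qed

lemma q_IVT:
  assumes "0 < c" "0 < m1" "m1 < 1" "c \<le> sqrt (\<theta> m1)"
  obtains m where "0 < m" "m < 1" "sqrt (\<theta> m) = c"
proof -
  have "\<exists>m. 0 \<le> m \<and> m \<le> m1 \<and> sqrt (\<theta> m) = c"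
    by (rule IVT') (use assms in \<open>auto intro!: continuous_intros continuous_on_subset[OF th_cont]\<close>)
  then obtain m where m: "0 \<le> m" "m \<le> m1" "sqrt (\<theta> m) = c" by blast
  then have "m \<noteq> 0" using assms(1) by auto
  then show ?thesis using that[of m] m assms by auto
qed

text \<open>In the linear regime the slope is the supremum of sqrt \<theta> without being one of its
  values, so nearby values are obtained from the limit at m = 1. In the last regime p s = 0, so y is
  negative and any m serves.\<close>

lemma less_p_obtains:
  assumes s: "s \<in> D" and y: "y < p s"
  obtains m where "0 < m" "m < 1" "y < sqrt (\<theta> m)"
  using s
proof (cases s rule: D_cases)
  case inf
  have "ennreal y < ennsqrt T \<or> y < 0"
    using y inf ennsqrt_T_finite by (metis ennreal_less_iff not_less p_inf)
  then show ?thesis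
  proof
    assume "ennreal y < ennsqrt T"
    from order_tendstoD(1)[OF q_tendsto_1 this] ev_left_1
    have "\<forall>\<^sub>F m in at_left 1. 0 < m \<and> m < 1 \<and> ennreal y < ennreal (sqrt (\<theta> m))" by eventually_elim auto
    then obtain m where m: "0 < m" "m < 1" "ennreal y < ennreal (sqrt (\<theta> m))"
      using eventually_happens'[of "at_left (1::real)"] by force
    then have "y < sqrt (\<theta> m)" using th_nonneg[of m] by (metis ennreal_leI less_imp_le not_le)
    then show ?thesis using that m by blast
  next
    assume "y < 0"
    moreover have "0 < sqrt (\<theta> (1/2))" using th_pos[of "1/2"] by simp
    ultimately have "y < sqrt (\<theta> (1/2))" by linarith
    then show ?thesis by (intro that[of "1/2"]) auto
  qed
next
  case mid
  then show ?thesis using that[of "M s"] M_props[OF mid] y by (simp add: p_mid)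
next
  case sup
  then have "y < 0" using y by (simp add: p_sup)
  moreover have "0 < sqrt (\<theta> (1/2))" using th_pos[of "1/2"] by simp
  ultimately have "y < sqrt (\<theta> (1/2))" by linarith
  then show ?thesis by (intro that[of "1/2"]) auto
qed

text \<open>Strictly between y and p s there is a value of sqrt \<theta>, at some m;
  \<open>q_le_p\<close> and \<open>p_le_q\<close> then place s strictly on one side of P m. Nearby
  openings lie on the same side, and the same comparisons keep their slopes on the proper side of
  y.\<close>

lemma p_cont: "continuous_on D p"
  unfolding continuous_on_def
proof
  fix s assume s: "s \<in> D"
  show "(p \<longlongrightarrow> p s) (at s within D)"
  proof (rule order_tendstoI)
    fix y assume y: "y < p s"
    show "\<forall>\<^sub>F s' in at s within D. y < p s'"
    proof (cases "y < 0")
      case True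
      then show ?thesis unfolding eventually_at_filter
        by (intro always_eventually) (use p_nonneg in \<open>auto intro: less_le_trans\<close>)
    next
      case False
      define c where "c = (y + p s) / 2"
      have c: "y < c" "c < p s" "0 < c" using y False by (auto simp: c_def)
      obtain m1 where m1: "0 < m1" "m1 < 1" "c < sqrt (\<theta> m1)" using less_p_obtains[OF s c(2)] .
      obtain m where m: "0 < m" "m < 1" "sqrt (\<theta> m) = c" using q_IVT[OF c(3) m1(1,2)] m1(3) by auto
      have "s < P m" using p_le_q[OF s m(1,2)] c m by (cases "P m \<le> s") auto
      then have "\<forall>\<^sub>F s' in at s within D. s' < P m"
        by (intro order_tendstoD(2)[OF tendsto_ident_at])
      moreover have "\<forall>\<^sub>F s' in at s within D. s' \<in> D" by (auto simp: eventually_at_filter)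
      ultimately show ?thesis
      proof eventually_elim
        case (elim s')
        then show ?case using q_le_p[of s' m] m c by auto
      qed
    qed
  next
    fix y assume y: "p s < y"
    show "\<forall>\<^sub>F s' in at s within D. p s' < y"
    proof (cases "\<exists>m. 0 < m \<and> m < 1 \<and> p s < sqrt (\<theta> m)")
      case True
      then obtain m1 where m1: "0 < m1" "m1 < 1" "p s < sqrt (\<theta> m1)" by blast
      \<comment> \<open>The minimum keeps c in the range of sqrt \<theta>, the mean with p s keeps
        it below y.\<close>
      define c where "c = min (sqrt (\<theta> m1)) ((y + p s) / 2)"
      have c1: "p s < c" "c \<le> sqrt (\<theta> m1)" using y m1 by (auto simp: c_def)
      have "c \<le> (y + p s) / 2" by (simp only: c_def min.cobounded2)
      then have c2: "c < y" using y by (simp add: field_simps)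
      have c3: "0 < c" using c1(1) p_nonneg[OF s] by (rule le_less_trans[rotated])
      note c = c1(1) c2 c3 c1(2)
      obtain m where m: "0 < m" "m < 1" "sqrt (\<theta> m) = c" using q_IVT[OF c(3) m1(1,2) c(4)] .
      have "P m < s" using q_le_p[OF s m(1,2)] c m by (cases "s \<le> P m") auto
      then have "\<forall>\<^sub>F s' in at s within D. P m < s'"
        by (intro order_tendstoD(1)[OF tendsto_ident_at])
      moreover have "\<forall>\<^sub>F s' in at s within D. s' \<in> D" by (auto simp: eventually_at_filter)
      ultimately show ?thesis
      proof eventually_elim
        case (elim s')
        then show ?case using p_le_q[of s' m] m c by auto
      qed
    next
      \<comment> \<open>No value of sqrt \<theta> exceeds p s, so p s is the maximum of p on D and
        there is nothing to localise.\<close>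
      case False
      have "p s' < y" if "s' \<in> D" for s'
      proof (rule ccontr)
        assume "\<not> p s' < y"
        then have "p s < p s'" using y by simp
        from less_p_obtains[OF that this] show False using False by metis
      qed
      then show ?thesis unfolding eventually_at_filter by (intro always_eventually) auto
    qed
  qed
qed

text \<open>The affine majorant touching g at s is the linear function, \<open>H (M s)\<close> or
  the constant 2 \<Psi>(1), according to the regime of s.\<close>

lemma supergradient:
  assumes s: "s \<in> D" and s': "0 \<le> s'"
  shows "g_real l Q \<omega> s' \<le> g_real l Q \<omega> s + p s * (s' - s)"
  using s
proof (cases s rule: D_cases)
  case inf
  have "g_real l Q \<omega> s = enn2real (ennsqrt T) * s"
    using g_inf[OF inf(1,2)] inf by (simp add: g_real_def enn2real_mult)
  moreover have "ennreal (g_real l Q \<omega> s') \<le> ennreal (enn2real (ennsqrt T) * s')"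
    using g_le_linear[OF s'] ennsqrt_T_finite[OF inf(3)] s' g_real[OF s'] by (simp add: ennreal_mult)
  then have "g_real l Q \<omega> s' \<le> enn2real (ennsqrt T) * s'"
    using s' by (subst (asm) ennreal_le_iff) auto
  ultimately show ?thesis using inf by (simp add: p_inf algebra_simps)
next
  case mid
  note Ms = M_props[OF mid]
  show ?thesis using g_real_M[OF mid] g_real_le_H[OF s' Ms(1,2)] mid
    by (simp add: p_mid H_def algebra_simps)
next
  case sup
  have "g_real l Q \<omega> s = 2 * Psi \<omega> 1" using g_sup[OF sup] Psi_pos by (simp add: g_real_def)
  moreover have "ennreal (g_real l Q \<omega> s') \<le> ennreal (2 * Psi \<omega> 1)" using g_le_Psi[OF s'] g_real[OF s'] by simp
  then have "g_real l Q \<omega> s' \<le> 2 * Psi \<omega> 1" using Psi_pos by (subst (asm) ennreal_le_iff) auto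
  ultimately show ?thesis using sup by (simp add: p_sup)
qed

lemma D_nonneg: "s \<in> D \<Longrightarrow> 0 \<le> s" and D_pos: "0 < s \<Longrightarrow> s \<in> D"
  by (auto simp: D_def split: if_splits)

lemma g_derivative: "s \<in> D \<Longrightarrow> (g_real l Q \<omega> has_real_derivative p s) (at s within D)"
  by (rule has_derivative_of_supergradient[OF _ p_cont]) (auto intro: supergradient D_nonneg)

lemma g_derivative_pos: "0 < s \<Longrightarrow> (g_real l Q \<omega> has_real_derivative p s) (at s)"
proof -
  assume s: "0 < s"
  have "(g_real l Q \<omega> has_real_derivative p s) (at s within {0<..})"
    by (rule DERIV_subset[OF g_derivative[OF D_pos[OF s]]]) (auto intro: D_pos)
  then show ?thesis using s by (simp add: at_within_open[of s "{0<..}"])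
qed

lemma g_concave: "concave_on {0..} (g_real l Q \<omega>)"
  unfolding concave_on_def
proof (rule convex_onI)
  fix t x y :: real assume t: "0 < t" "t < 1" and xy: "x \<in> {0..}" "y \<in> {0..}"
  let ?G = "g_real l Q \<omega>"
  define z where "z = (1 - t) * x + t * y"
  have z0: "0 \<le> (1 - t) * x" "0 \<le> t * y" using t xy by auto
  have "(1 - t) * ?G x + t * ?G y \<le> ?G z"
  \<comment> \<open>0 need not belong to D; but z = 0 forces x = y = 0, where the inequality is
    trivial.\<close>
  proof (cases "z = 0")
    case True
    then have "(1 - t) * x = 0" "t * y = 0" using z0 unfolding z_def by linarith+
    then have "x = 0" "y = 0" using t by auto
    then show ?thesis using True by (simp add: algebra_simps)
  next
    case False
    then have z: "z \<in> D" using z0 by (intro D_pos) (simp add: z_def)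
    have "?G x \<le> ?G z + p z * (x - z)" "?G y \<le> ?G z + p z * (y - z)"
      using supergradient[OF z] xy by auto
    then have "(1 - t) * ?G x + t * ?G y \<le> (1 - t) * (?G z + p z * (x - z)) + t * (?G z + p z * (y - z))"
      using t by (intro add_mono mult_left_mono) auto
    also have "\<dots> = ?G z + p z * ((1 - t) * x + t * y - z)" by (simp add: algebra_simps)
    finally show ?thesis by (simp add: z_def)
  qed
  then show "- ?G ((1 - t) *\<^sub>R x + t *\<^sub>R y) \<le> (1 - t) * - ?G x + t * - ?G y" by (simp add: z_def)
qed simp

text \<open>For c strictly between w and z, \<open>H (M c)\<close> is a smaller majorant at w than
  \<open>H (M z)\<close>, because m \<mapsto> H m w is strictly monotone between \<open>M z\<close>
  and \<open>M c\<close>. The point c also avoids evaluating M at w, which may be an end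
  point.\<close>

lemma g_less_H:
  assumes z: "0 \<le> z" "inf_Phi l Q \<omega> < ennreal z" "ennreal z < sup_Phi l Q \<omega>"
    and w: "0 \<le> w" "inf_Phi l Q \<omega> \<le> ennreal w" "ennreal w \<le> sup_Phi l Q \<omega>" and ne: "w \<noteq> z"
  shows "g_real l Q \<omega> w < H (M z) w"
proof -
  define c where "c = (w + z) / 2"
  note Mz = M_props[OF z]
  consider "w < z" | "z < w" using ne by linarith
  then show ?thesis
  proof cases
    case 1
    then have c: "w < c" "c < z" "0 \<le> c" using w by (auto simp: c_def)
    have c': "ennreal w < ennreal c" "ennreal c < ennreal z" using c w z by (auto simp: ennreal_less_iff)
    note Mc = M_props[OF c(3) le_less_trans[OF w(2) c'(1)] less_trans[OF c'(2) z(3)]]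
    have "M z < M c" using P_less[of "M c" "M z"] Mc Mz c by (cases "M z" "M c" rule: linorder_cases) auto
    then have "H (M c) w < H (M z) w" by (intro H_decreasing) (use Mc Mz c in auto)
    then show ?thesis using g_real_le_H[OF w(1) Mc(1,2)] by simp
  next
    case 2
    then have c: "z < c" "c < w" "0 \<le> c" using z by (auto simp: c_def)
    have c': "ennreal z < ennreal c" "ennreal c < ennreal w" using c w z by (auto simp: ennreal_less_iff)
    note Mc = M_props[OF c(3) less_trans[OF z(2) c'(1)] less_le_trans[OF c'(2) w(3)]]
    have "M c < M z" using P_less[of "M z" "M c"] Mc Mz c by (cases "M z" "M c" rule: linorder_cases) auto
    then have "H (M c) w < H (M z) w" by (intro H_increasing) (use Mc Mz c in auto)
    then show ?thesis using g_real_le_H[OF w(1) Mc(1,2)] by simp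
  qed
qed

text \<open>\<open>H (M z)\<close> is affine, touches g at z and lies strictly above it at x and at
  y.\<close>

lemma g_strictly_concave:
  "strictly_concave_on {s. 0 \<le> s \<and> inf_Phi l Q \<omega> \<le> ennreal s \<and> ennreal s \<le> s_frac l Q \<omega>} (g_real l Q \<omega>)"
  unfolding strictly_concave_on_def s_frac_eq
proof (intro ballI allI impI, elim conjE)
  let ?G = "g_real l Q \<omega>"
  fix x y t assume x: "x \<in> {s. 0 \<le> s \<and> inf_Phi l Q \<omega> \<le> ennreal s \<and> ennreal s \<le> sup_Phi l Q \<omega>}"
    and y: "y \<in> {s. 0 \<le> s \<and> inf_Phi l Q \<omega> \<le> ennreal s \<and> ennreal s \<le> sup_Phi l Q \<omega>}"
    and t: "x \<noteq> y" "0 < t" "t < (1::real)"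
  define z where "z = (1 - t) * x + t * y"
  have bet: "min x y < z \<and> z < max x y"
  proof (cases "x < y")
    case True
    have "0 < t * (y - x)" "0 < (1 - t) * (y - x)" using True t by auto
    then show ?thesis using True by (auto simp: z_def algebra_simps)
  next
    case False
    then have "0 < t * (x - y)" "0 < (1 - t) * (x - y)" using t by auto
    then show ?thesis using False by (auto simp: z_def algebra_simps)
  qed
  have z0: "0 \<le> z" using bet x y by auto
  have "inf_Phi l Q \<omega> \<le> ennreal (min x y)" "ennreal (max x y) \<le> sup_Phi l Q \<omega>"
    using x y by (auto simp: min_def max_def)
  moreover have "ennreal (min x y) < ennreal z" "ennreal z < ennreal (max x y)"
    using bet x y z0 by (auto intro!: ennreal_lessI simp: ennreal_less_iff)
  ultimately have z: "inf_Phi l Q \<omega> < ennreal z" "ennreal z < sup_Phi l Q \<omega>" by auto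
  have ne: "x \<noteq> z" "y \<noteq> z" using bet t by auto
  have "?G x < H (M z) x" "?G y < H (M z) y"
    using g_less_H[OF z0 z] x y ne by auto
  then have "(1 - t) * ?G x + t * ?G y < (1 - t) * H (M z) x + t * H (M z) y"
    using t by (intro add_strict_mono mult_strict_left_mono) auto
  also have "\<dots> = H (M z) z" by (simp add: H_def z_def algebra_simps)
  also have "\<dots> = ?G z" using g_real_M[OF z0 z] by simp
  finally show "(1 - t) * ?G x + t * ?G y < ?G ((1 - t) * x + t * y)" by (simp add: z_def)
qed

lemma m_of_mid:
  assumes "0 \<le> s" "inf_Phi l Q \<omega> < ennreal s" "ennreal s < sup_Phi l Q \<omega>"
  shows "m_of l Q \<omega> s = M s"
proof -
  note Ms = M_props[OF assms]
  have inj: "inj_on (Phi l Q \<omega>) {0<..<1}"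
  proof (rule inj_onI)
    fix x y :: real assume a: "x \<in> {0<..<1}" "y \<in> {0<..<1}" "Phi l Q \<omega> x = Phi l Q \<omega> y"
    then have "P x = P y" by (simp add: P_def)
    then show "x = y" using P_less[of x y] P_less[of y x] a by (cases x y rule: linorder_cases) auto
  qed
  have "Phi l Q \<omega> (M s) = ennreal s" using Phi_P[OF Ms(1,2)] Ms(3) by simp
  then have "the_inv_into {0<..<1} (Phi l Q \<omega>) (ennreal s) = M s"
    using Ms by (intro the_inv_into_f_eq[OF inj]) auto
  then show ?thesis using assms by (auto simp: m_of_def s_frac_eq)
qed

lemma g_deriv_values_p:
  assumes s: "s \<in> D"
  shows "g_deriv_values l Q \<omega> p s"
  unfolding g_deriv_values_def s_frac_eq
proof (intro conjI impI)
  assume a: "ennreal s \<le> inf_Phi l Q \<omega>"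
  show "ereal (p s) = enn2ereal (varsigma_bar Q \<omega>)"
    using s
  proof (cases s rule: D_cases)
    case inf
    have "ereal (p s) = enn2ereal (ennreal (enn2real (ennsqrt T)))" using inf by (simp add: p_inf enn2ereal_ennreal)
    then show ?thesis using ennsqrt_T_finite[OF inf(3)] by (simp add: varsigma_eq)
  qed (use a inf_less_sup in auto)
next
  assume "sup_Phi l Q \<omega> \<le> ennreal s" then show "p s = 0" by (rule p_sup)
next
  assume b: "inf_Phi l Q \<omega> \<le> ennreal s \<and> ennreal s \<le> sup_Phi l Q \<omega>"
  show "ereal (p s) = enn2ereal (ennsqrt (theta_ext l Q \<omega> (m_of l Q \<omega> s)))"
    using s
  proof (cases s rule: D_cases)
    case inf
    then have "m_of l Q \<omega> s = 1" using b by (auto simp: m_of_def)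
    moreover have "ereal (p s) = enn2ereal (ennreal (enn2real (ennsqrt T)))" using inf by (simp add: p_inf enn2ereal_ennreal)
    ultimately show ?thesis by (simp only: ennsqrt_T_finite[OF inf(3), symmetric] T_def[symmetric])
  next
    case mid
    then show ?thesis using M_props[OF mid] th_nonneg[of "M s"]
      by (simp add: m_of_mid p_mid theta_ext_less_1 enn2ereal_ennreal)
  next
    case sup
    then have "m_of l Q \<omega> s = 0" using b inf_less_sup by (auto simp: m_of_def s_frac_eq)
    then show ?thesis using sup by (simp add: p_sup theta_ext_less_1 zero_ennreal.rep_eq)
  qed
qed

lemma q_unbounded: "T = top \<Longrightarrow> \<exists>m. 0 < m \<and> m < 1 \<and> Z < sqrt (\<theta> m)"
proof -
  assume "T = top"
  then have "((\<lambda>m. ennreal (sqrt (\<theta> m))) \<longlongrightarrow> top) (at_left 1)" using q_tendsto_1 by simp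
  then have "filterlim (\<lambda>m. sqrt (\<theta> m)) at_top (at_left 1)" by (rule iffD1[OF ennreal_tendsto_top_eq_at_top])
  then have "\<forall>\<^sub>F m in at_left 1. Z < sqrt (\<theta> m)" by (simp add: filterlim_at_top_dense)
  with ev_left_1 have "\<forall>\<^sub>F m in at_left 1. 0 < m \<and> m < 1 \<and> Z < sqrt (\<theta> m)" by eventually_elim auto
  then show ?thesis using eventually_happens'[of "at_left (1::real)"] by force
qed

lemma p_at_top: "T = top \<Longrightarrow> filterlim p at_top (at_right 0)"
  unfolding filterlim_at_top_dense
proof
  fix Z assume "T = top"
  then obtain m where m: "0 < m" "m < 1" "Z < sqrt (\<theta> m)" using q_unbounded by blast
  show "\<forall>\<^sub>F s in at_right 0. Z < p s"
    using ev_right_0[OF P_pos[OF m(1,2)]]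
  proof eventually_elim
    case (elim s)
    then show ?case using q_le_p[of s m] D_pos[of s] m by auto
  qed
qed

lemma g_real_0 [simp]: "g_real l Q \<omega> 0 = 0"
  using g_inf[of 0] by (simp add: g_real_def)

text \<open>The supergradient inequality at s, evaluated at the opening 0, bounds the difference
  quotient from below by p s.\<close>

lemma g_quotient_at_top: "T = top \<Longrightarrow> filterlim (\<lambda>s. (g_real l Q \<omega> s - g_real l Q \<omega> 0) / s) at_top (at_right 0)"
proof (rule filterlim_at_top_mono[OF p_at_top])
  show "\<forall>\<^sub>F s in at_right 0. p s \<le> (g_real l Q \<omega> s - g_real l Q \<omega> 0) / s"
    using ev_right_0[OF zero_less_one]
  proof eventually_elim
    case (elim s)
    then show ?case using supergradient[OF D_pos[of s], of 0] by (simp add: pos_le_divide_eq)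
  qed
qed

text \<open>Only s = 0 is not covered by differentiability. There g lies between 0 and
  \<open>H m\<close>, and H m 0 = A m is small for m close to 1.\<close>

lemma g_continuous: "continuous_on {0..} (g_real l Q \<omega>)"
  unfolding continuous_on_eq_continuous_within
proof
  fix s :: real assume "s \<in> {0..}"
  then consider "0 < s" | "s = 0" by force
  then show "continuous (at s within {0..}) (g_real l Q \<omega>)"
  proof cases
    case 1
    then show ?thesis by (rule continuous_at_imp_continuous_within[OF DERIV_isCont[OF g_derivative_pos]])
  next
    case 2
    have G0: "0 \<le> g_real l Q \<omega> s" for s by (simp add: g_real_def)
    have "(g_real l Q \<omega> \<longlongrightarrow> 0) (at 0 within {0..})"
    proof (rule order_tendstoI)
      fix y :: real assume "y < 0"
      then show "\<forall>\<^sub>F s in at 0 within {0..}. y < g_real l Q \<omega> s"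
        using G0 by (auto intro!: always_eventually intro: less_le_trans)
    next
      fix y :: real assume y: "0 < y"
      from order_tendstoD(2)[OF A_tendsto_1 y] ev_left_1
      have "\<forall>\<^sub>F m in at_left 1. 0 < m \<and> m < 1 \<and> A m < y" by eventually_elim auto
      then obtain m where m: "0 < m" "m < 1" "A m < y"
        using eventually_happens'[of "at_left (1::real)"] by force
      have "((\<lambda>s. H m s) \<longlongrightarrow> H m 0) (at 0 within {0..})" unfolding H_def by (intro tendsto_intros)
      then have "((\<lambda>s. H m s) \<longlongrightarrow> A m) (at 0 within {0..})" by (simp add: H_def)
      from order_tendstoD(2)[OF this m(3)] have "\<forall>\<^sub>F s in at 0 within {0..}. H m s < y" .
      moreover have "\<forall>\<^sub>F s in at 0 within {0..}. s \<in> {0::real..}" by (auto simp: eventually_at_filter)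
      ultimately show "\<forall>\<^sub>F s in at 0 within {0..}. g_real l Q \<omega> s < y"
      proof eventually_elim
        case (elim s)
        then show ?case using g_real_le_H[of s m] m by auto
      qed
    qed
    then show ?thesis using 2 by (simp add: continuous_within)
  qed
qed

text \<open>At s = sup \<Phi> the energy has reached 2 \<Psi>(1), while the linear upper bound holds
  for every opening. If sup \<Phi> is infinite, the product is infinite because the coefficient is
  positive.\<close>

lemma Psi_le_varsigma:
  "ennreal (2 * Psi \<omega> 1) \<le> varsigma_bar Q \<omega> * s_frac l Q \<omega>"
proof (cases "sup_Phi l Q \<omega> = top")
  case True
  have "ennsqrt T \<noteq> 0" using q_le_T[of "1/2"] th_pos[of "1/2"] by auto
  then show ?thesis using True by (simp add: varsigma_eq s_frac_eq ennreal_mult_top)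
next
  case False
  then obtain s where s: "sup_Phi l Q \<omega> = ennreal s" "0 \<le> s" by (cases "sup_Phi l Q \<omega>") auto
  then show ?thesis using g_sup[of s] g_le_linear[of s] by (simp add: varsigma_eq s_frac_eq)
qed

end

section \<open>The auxiliary one-dimensional problem\<close>

lemma nn_integral_fold:
  fixes h :: "real \<Rightarrow> ennreal"
  assumes [measurable]: "h \<in> borel_measurable borel"
  shows "(\<integral>\<^sup>+t. h (m + \<bar>t - m\<bar>) \<partial>lebesgue_on {2 * m - 1<..<1}) = 2 * (\<integral>\<^sup>+t. h t \<partial>lebesgue_on {m<..<1})"
proof -
  define F where "F t = h t * indicator {m<..<1} t" for t
  have [measurable]: "F \<in> borel_measurable borel" unfolding F_def[abs_def] by measurable
  have "(\<integral>\<^sup>+t. h (m + \<bar>t - m\<bar>) \<partial>lebesgue_on {2 * m - 1<..<1}) = (\<integral>\<^sup>+t. F t + F (2 * m + (-1) * t) \<partial>lborel)"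
    unfolding nn_integral_lebesgue_on_Ioo
  proof (rule nn_integral_cong_AE)
    have "AE t in lborel. t \<noteq> m" by (rule AE_lborel_singleton)
    then show "AE t in lborel. h (m + \<bar>t - m\<bar>) * indicator {2 * m - 1<..<1} t = F t + F (2 * m + (-1) * t)"
    proof eventually_elim
      case (elim t)
      then consider "t < m" | "m < t" by linarith
      then show ?case
      proof cases
        case 1
        then have "m + \<bar>t - m\<bar> = 2 * m - t" by simp
        then show ?thesis using 1 by (simp add: F_def indicator_def)
      next
        case 2
        then have "m + \<bar>t - m\<bar> = t" by simp
        then show ?thesis using 2 by (simp add: F_def indicator_def)
      qed
    qed
  qed
  also have "\<dots> = (\<integral>\<^sup>+t. F t \<partial>lborel) + (\<integral>\<^sup>+t. F (2 * m + (-1) * t) \<partial>lborel)"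
    by (rule nn_integral_add) auto
  also have "(\<integral>\<^sup>+t. F (2 * m + (-1) * t) \<partial>lborel) = (\<integral>\<^sup>+t. F t \<partial>lborel)"
    using nn_integral_real_affine[of F "-1" "2 * m"] by simp
  finally show ?thesis unfolding mult_2 nn_integral_lebesgue_on_Ioo F_def .
qed

lemma ennreal_add_le: "ennreal (x + y) \<le> ennreal x + ennreal y"
proof -
  have "ennreal (x + y) \<le> ennreal (max x 0 + max y 0)" by (intro ennreal_leI) auto
  also have "\<dots> = ennreal (max x 0) + ennreal (max y 0)" by (intro ennreal_plus) auto
  also have "\<dots> = ennreal x + ennreal y" by (simp add: max_def ennreal_neg)
  finally show ?thesis .
qed

lemma AE_eq_of_integral_le:
  fixes f h :: "'a \<Rightarrow> real"
  assumes f: "integrable M f" and h: "h \<in> borel_measurable M" "AE x in M. f x \<le> h x"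
    and le: "(\<integral>\<^sup>+x. ennreal (h x) \<partial>M) \<le> ennreal (\<integral>x. f x \<partial>M)" and h0: "AE x in M. 0 \<le> h x"
    and f0: "0 \<le> (\<integral>x. f x \<partial>M)"
  shows "AE x in M. f x = h x"
proof -
  have hI: "integrable M h"
    by (rule integrableI_nonneg[OF h(1) h0]) (use le in \<open>auto intro: le_less_trans\<close>)
  have "ennreal (\<integral>x. h x \<partial>M) \<le> ennreal (\<integral>x. f x \<partial>M)"
    using le nn_integral_eq_integral[OF hI h0] by simp
  then have "(\<integral>x. h x \<partial>M) \<le> (\<integral>x. f x \<partial>M)" using f0 by (simp add: ennreal_le_iff)
  then have "(\<integral>x. h x - f x \<partial>M) \<le> 0" using hI f by simp
  moreover have nn: "AE x in M. 0 \<le> h x - f x" using h(2) by eventually_elim simp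
  then have "0 \<le> (\<integral>x. h x - f x \<partial>M)" by (rule integral_nonneg_AE)
  ultimately have "(\<integral>x. h x - f x \<partial>M) = 0" by simp
  then have "AE x in M. h x - f x = 0"
    by (subst (asm) integral_nonneg_eq_0_iff_AE) (use hI f nn in auto)
  then show ?thesis by eventually_elim simp
qed

context cohesive
begin

lemma fold_range:
  fixes m t :: real
  assumes "0 < m" "m < 1" "2 * m - 1 < t" "t < 1"
  shows "m \<le> m + \<bar>t - m\<bar>" "m + \<bar>t - m\<bar> < 1" "t \<noteq> m \<Longrightarrow> m < m + \<bar>t - m\<bar>"
  using assms by auto

lemma theta_m_eq: "theta_m l Q \<omega> m t = \<theta> (m + \<bar>t - m\<bar>)" and omega_m_eq: "omega_m \<omega> m t = W (m + \<bar>t - m\<bar>)"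
  by (simp_all add: theta_m_def omega_m_def W_def diff_diff_eq)

lemma fold_cont:
  fixes m :: real and h :: "real \<Rightarrow> real"
  assumes m: "0 < m" "m < 1" and h: "continuous_on {m..<1} h"
  shows "continuous_on {2 * m - 1<..<1} (\<lambda>t. h (m + \<bar>t - m\<bar>) :: real)"
  by (rule continuous_on_compose2[OF h]) (use m in \<open>auto intro!: continuous_intros\<close>)

lemma fold_measurable:
  fixes m :: real and h :: "real \<Rightarrow> real"
  assumes m: "0 < m" "m < 1" and h: "continuous_on {m..<1} h"
  shows "(\<lambda>t. h (m + \<bar>t - m\<bar>) :: real) \<in> borel_measurable (lebesgue_on {2 * m - 1<..<1})"
  by (rule continuous_imp_measurable_on_sets_lebesgue[OF fold_cont[OF m h]]) simp

text \<open>Folding at m turns an integral over (2 m - 1, 1) into twice an integral over (m, 1). The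
  indicator cuts out the fold point, where h may be singular, and makes the folded function
  Borel.\<close>

lemma fold_has_bochner:
  fixes m :: real and h :: "real \<Rightarrow> real"
  assumes m: "0 < m" "m < 1" and h: "continuous_on {m<..<1} h" "\<And>t. m < t \<Longrightarrow> t < 1 \<Longrightarrow> 0 \<le> h t"
    and I: "(\<integral>\<^sup>+t. ennreal (h t) \<partial>lebesgue_on {m<..<1}) = ennreal I" "0 \<le> I" and hm: "h m = 0 \<or> continuous_on {m..<1} h"
  shows "integrable (lebesgue_on {2 * m - 1<..<1}) (\<lambda>t. indicator {m<..<1} (m + \<bar>t - m\<bar>) * h (m + \<bar>t - m\<bar>))"
    and "(\<integral>t. indicator {m<..<1} (m + \<bar>t - m\<bar>) * h (m + \<bar>t - m\<bar>) \<partial>lebesgue_on {2 * m - 1<..<1}) = 2 * I"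
proof -
  let ?N = "lebesgue_on {2 * m - 1<..<1}"
  define G where "G t = indicator {m<..<1} t * h t" for t
  have Gm: "G \<in> borel_measurable borel"
    using borel_measurable_continuous_on_indicator[OF _ h(1)] by (simp add: G_def[abs_def])
  have "(\<integral>\<^sup>+t. ennreal (G (m + \<bar>t - m\<bar>)) \<partial>?N) = 2 * (\<integral>\<^sup>+t. ennreal (G t) \<partial>lebesgue_on {m<..<1})"
    by (rule nn_integral_fold) (use Gm in measurable)
  also have "(\<integral>\<^sup>+t. ennreal (G t) \<partial>lebesgue_on {m<..<1}) = ennreal I"
    unfolding I(1)[symmetric] by (rule nn_integral_cong) (auto simp: G_def)
  finally have e: "(\<integral>\<^sup>+t. ennreal (G (m + \<bar>t - m\<bar>)) \<partial>?N) = ennreal (2 * I)" by (simp add: ennreal_mult')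
  have G0: "0 \<le> G t" for t using h(2) by (auto simp: G_def indicator_def)
  have "(\<lambda>t. G (m + \<bar>t - m\<bar>)) \<in> borel_measurable borel" using Gm by measurable
  then have GN: "(\<lambda>t. G (m + \<bar>t - m\<bar>)) \<in> borel_measurable ?N"
    by (intro measurable_restrict_space1 measurable_completion) simp
  have i: "integrable ?N (\<lambda>t. G (m + \<bar>t - m\<bar>))"
    by (rule integrableI_nonneg[OF GN]) (use G0 e in auto)
  then show "integrable ?N (\<lambda>t. indicator {m<..<1} (m + \<bar>t - m\<bar>) * h (m + \<bar>t - m\<bar>))" by (simp add: G_def)
  have "ennreal (\<integral>t. G (m + \<bar>t - m\<bar>) \<partial>?N) = ennreal (2 * I)"
    using e nn_integral_eq_integral[OF i] G0 by simp
  moreover have "0 \<le> (\<integral>t. G (m + \<bar>t - m\<bar>) \<partial>?N)" by (rule integral_nonneg_AE) (use G0 in auto)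
  ultimately show "(\<integral>t. indicator {m<..<1} (m + \<bar>t - m\<bar>) * h (m + \<bar>t - m\<bar>) \<partial>?N) = 2 * I"
    using I(2) by (simp add: G_def ennreal_inj)
qed

lemma AE_fold_indicator:
  fixes m :: real
  assumes m: "0 < m" "m < 1"
  shows "AE t in lebesgue_on {2 * m - 1<..<1}. indicator {m<..<1} (m + \<bar>t - m\<bar>) = (1::real) \<and> t \<noteq> m"
proof -
  have "AE t in lebesgue. t \<noteq> m" by (intro AE_completion AE_lborel_singleton)
  then have "AE t in lebesgue_on {2 * m - 1<..<1}. t \<noteq> m" by (subst AE_restrict_space_iff) auto
  with AE_space[of "lebesgue_on {2 * m - 1<..<1}"] show ?thesis
    by eventually_elim (use m in auto)
qed

lemma k_fold:
  assumes m: "0 < m" "m < 1"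
  shows "integrable (lebesgue_on {2 * m - 1<..<1}) (\<lambda>t. k m (m + \<bar>t - m\<bar>))"
    and "(\<integral>t. k m (m + \<bar>t - m\<bar>) \<partial>lebesgue_on {2 * m - 1<..<1}) = A m"
proof -
  let ?N = "lebesgue_on {2 * m - 1<..<1}"
  have kc: "continuous_on {m..1} (k m)" using k_cont'[of m] m by simp
  have c: "continuous_on {m..<1} (k m)" "continuous_on {m<..<1} (k m)"
    by (rule continuous_on_subset[OF kc]; auto)+
  have hi: "(k m has_integral integral {m..1} (k m)) {m..1}" by (rule integrable_integral) (use k_integrable[of m] m in auto)
  have I: "(\<integral>\<^sup>+t. ennreal (k m t) \<partial>lebesgue_on {m<..<1}) = ennreal (integral {m..1} (k m))"
    by (rule nn_integral_lebesgue_on_has_integral[OF hi]) (use m in \<open>auto intro: k_nonneg\<close>)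
  have I0: "0 \<le> integral {m..1} (k m)" using A_nonneg[of m] m by (simp add: A_def)
  have k0: "0 \<le> k m t" if "m < t" "t < 1" for t by (rule k_nonneg) (use m that in auto)
  note B = fold_has_bochner[OF m c(2) k0 I I0 disjI2[OF c(1)]]
  have km: "(\<lambda>t. k m (m + \<bar>t - m\<bar>)) \<in> borel_measurable ?N" by (rule fold_measurable[OF m c(1)])
  show "integrable ?N (\<lambda>t. k m (m + \<bar>t - m\<bar>))"
  proof (rule Bochner_Integration.integrable_bound[OF B(1) km])
    show "AE t in ?N. norm (k m (m + \<bar>t - m\<bar>)) \<le> norm (indicator {m<..<1} (m + \<bar>t - m\<bar>) * k m (m + \<bar>t - m\<bar>))"
      using AE_fold_indicator[OF m] by eventually_elim simp
  qed
  have "(\<integral>t. k m (m + \<bar>t - m\<bar>) \<partial>?N) = (\<integral>t. indicator {m<..<1} (m + \<bar>t - m\<bar>) * k m (m + \<bar>t - m\<bar>) \<partial>?N)"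
  proof (rule integral_cong_AE[OF km borel_measurable_integrable[OF B(1)]])
    show "AE t in ?N. k m (m + \<bar>t - m\<bar>) = indicator {m<..<1} (m + \<bar>t - m\<bar>) * k m (m + \<bar>t - m\<bar>)"
      using AE_fold_indicator[OF m] by eventually_elim simp
  qed
  then show "(\<integral>t. k m (m + \<bar>t - m\<bar>) \<partial>?N) = A m" using B(2) by (simp add: A_def)
qed

text \<open>The derivative of the optimal profile on both branches. The indicator gives it the value
  0 at the fold point and outside the interval, and makes it Borel on the whole line.\<close>

definition wd where "wd m t = indicator {m<..<1} (m + \<bar>t - m\<bar>) * dw m (m + \<bar>t - m\<bar>)"

lemma wd_integral:
  assumes m: "0 < m" "m < 1"
  shows "integrable (lebesgue_on {2 * m - 1<..<1}) (wd m)"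
    and "(\<integral>t. wd m t \<partial>lebesgue_on {2 * m - 1<..<1}) = P m"
    and "wd m \<in> borel_measurable borel" and "0 \<le> wd m t"
proof -
  have dw0: "0 \<le> dw m t" if "m < t" "t < 1" for t using optimal_profile(2)[of m t] m that by simp
  have "2 * (\<integral>\<^sup>+t. ennreal (dw m t) \<partial>lebesgue_on {m<..<1}) = ennreal (P m)" using Phi_P[OF m] Phi_dw by simp
  also have "\<dots> = 2 * ennreal (P m / 2)" using P_nonneg[of m] by (subst ennreal_numeral[symmetric], subst ennreal_mult'[symmetric]) auto
  finally have I: "(\<integral>\<^sup>+t. ennreal (dw m t) \<partial>lebesgue_on {m<..<1}) = ennreal (P m / 2)"
    by (simp add: ennreal_mult_cancel_left)
  have dwm: "dw m m = 0" by (simp add: dw_def)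
  note B = fold_has_bochner[OF m dw_cont[OF m(1)] dw0 I _ disjI1[OF dwm]]
  show "integrable (lebesgue_on {2 * m - 1<..<1}) (wd m)"
    "(\<integral>t. wd m t \<partial>lebesgue_on {2 * m - 1<..<1}) = P m"
    using B P_nonneg[of m] unfolding wd_def[abs_def] by simp_all
  show "0 \<le> wd m t" using dw0 by (auto simp: wd_def indicator_def)
  define G where "G t = indicator {m<..<1} t * dw m t" for t
  have "G \<in> borel_measurable borel"
    using borel_measurable_continuous_on_indicator[OF _ dw_cont[OF m(1)]] by (simp add: G_def[abs_def])
  then have "(\<lambda>t. G (m + \<bar>t - m\<bar>)) \<in> borel_measurable borel" by measurable
  then show "wd m \<in> borel_measurable borel" by (simp add: G_def wd_def[abs_def])
qed

text \<open>Squaring the equality leaves the positive factor \<theta> t - \<theta> m times the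
  square of a - dw m t.\<close>

lemma optimal_profile_unique:
  assumes m: "0 \<le> m" "m < t" "t < 1" and eq: "sqrt (\<theta> m) * a + k m t = sqrt (\<theta> t * a\<^sup>2 + W t)"
  shows "a = dw m t"
proof -
  define r where "r = sqrt (W t / (\<theta> t * (\<theta> t - \<theta> m)))"
  define q where "q = sqrt (\<theta> m)"
  define b where "b = \<theta> t"
  have p: "0 \<le> \<theta> m" "0 < \<theta> t" "0 < \<theta> t - \<theta> m" "0 < W t"
    using th_nonneg[of m] th_pos[of t] th_strict_mono[of m t] W_pos[of t] m by auto
  have r0: "0 \<le> r" using p by (simp add: r_def)
  have r2: "W t = r\<^sup>2 * b * (b - q\<^sup>2)" using p by (simp add: r_def q_def b_def)
  have d: "dw m t = q * r" unfolding dw_def r_def q_def real_sqrt_mult[symmetric] by (simp only: times_divide_eq_right)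
  have q2: "\<theta> m = q\<^sup>2" using p by (simp add: q_def)
  have b: "0 < b - q\<^sup>2" "0 < b" using p q2 by (auto simp: b_def)
  have k: "k m t = (b - q\<^sup>2) * r"
  proof -
    have "W t * max 0 (1 - \<theta> m / \<theta> t) = ((b - q\<^sup>2) * r)\<^sup>2"
      using b unfolding r2 q2 b_def[symmetric] by (simp add: max_def power2_eq_square field_simps)
    then show ?thesis using b r0 by (simp add: k_def)
  qed
  have "(q * a + (b - q\<^sup>2) * r)\<^sup>2 = b * a\<^sup>2 + r\<^sup>2 * b * (b - q\<^sup>2)"
    using arg_cong[OF eq, of "\<lambda>x. x\<^sup>2"] p unfolding q_def[symmetric] k b_def[symmetric] r2
    using b by (simp add: add_nonneg_nonneg)
  then have "(b - q\<^sup>2) * (a - q * r)\<^sup>2 = 0" by (simp add: power2_eq_square algebra_simps)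
  then show ?thesis using b d by simp
qed

text \<open>The ingredients of the lower bound, kept apart for the discussion of equality: the
  balance between traces and derivative, and bounds for the absolutely continuous and the singular
  part with the common slope sqrt (\<theta> m), which is the least value of the root of
  \<open>theta_m\<close>.\<close>

lemma scG_bounds:
  fixes z :: "real \<Rightarrow> real"
  assumes m: "0 < m" "m < 1" and z: "BV (2 * m - 1) 1 z"
  defines "a \<equiv> 2 * m - 1"
  defines "f \<equiv> bv_density a 1 z"
  defines "\<sigma> \<equiv> bv_sing_pos a 1 z" and "\<tau> \<equiv> bv_sing_neg a 1 z"
  shows "trace_left z 1 - trace_right z a = (\<integral>t. f t \<partial>lebesgue_on {a<..<1}) + measure \<sigma> {a<..<1} - measure \<tau> {a<..<1}"
    and "integrable (lebesgue_on {a<..<1}) f"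
    and "ennreal (sqrt (\<theta> m) * (\<integral>t. f t \<partial>lebesgue_on {a<..<1}) + A m)
      \<le> (\<integral>\<^sup>+ t. ennreal (sqrt (theta_m l Q \<omega> m t * (f t)\<^sup>2 + omega_m \<omega> m t)) \<partial>lebesgue_on {a<..<1})"
    and "ennreal (sqrt (\<theta> m) * (measure \<sigma> {a<..<1} + measure \<tau> {a<..<1})) \<le> sing_integral a 1 z (\<lambda>t. ennreal (sqrt (theta_m l Q \<omega> m t)))"
    and "AE t in lebesgue_on {a<..<1}. sqrt (\<theta> m) * f t + k m (m + \<bar>t - m\<bar>) \<le> sqrt (theta_m l Q \<omega> m t * (f t)\<^sup>2 + omega_m \<omega> m t)"
    and "integrable (lebesgue_on {a<..<1}) (\<lambda>t. sqrt (\<theta> m) * f t + k m (m + \<bar>t - m\<bar>))"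
    and "(\<integral>t. sqrt (\<theta> m) * f t + k m (m + \<bar>t - m\<bar>) \<partial>lebesgue_on {a<..<1}) = sqrt (\<theta> m) * (\<integral>t. f t \<partial>lebesgue_on {a<..<1}) + A m"
proof -
  let ?N = "lebesgue_on {a<..<1}"
  have ab: "a < 1" using m by (simp add: a_def)
  have d: "bv_decomp a 1 z f \<sigma> \<tau>"
    unfolding f_def \<sigma>_def \<tau>_def by (rule bv_decomp_canonical) (use ab z in \<open>auto simp: a_def\<close>)
  have zL: "L1_on a 1 z" using z by (simp add: BV_def a_def)
  obtain c where c: "AE y in ?N. z y = c + bv_cdf a 1 f \<sigma> \<tau> y" using bv_decomp_repr[OF ab zL d] .
  from bv_traces[OF ab zL d c]
  show "trace_left z 1 - trace_right z a = (\<integral>t. f t \<partial>?N) + measure \<sigma> {a<..<1} - measure \<tau> {a<..<1}" by simp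
  have fs: "finite_borel_measure_on a 1 \<sigma>" and ft: "finite_borel_measure_on a 1 \<tau>"
    and fI: "integrable ?N f" using d by (auto simp: bv_decomp_def L1_on_def)
  show "integrable ?N f" by (rule fI)
  note k = k_fold[OF m, folded a_def]
  show int: "integrable ?N (\<lambda>t. sqrt (\<theta> m) * f t + k m (m + \<bar>t - m\<bar>))" using fI k(1) by simp
  show val: "(\<integral>t. sqrt (\<theta> m) * f t + k m (m + \<bar>t - m\<bar>) \<partial>?N) = sqrt (\<theta> m) * (\<integral>t. f t \<partial>?N) + A m"
    using fI k by simp
  have pt: "sqrt (\<theta> m) * f t + k m (m + \<bar>t - m\<bar>) \<le> sqrt (theta_m l Q \<omega> m t * (f t)\<^sup>2 + omega_m \<omega> m t)"
    if "t \<in> space ?N" for t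
    using integrand_real_ge[of m "m + \<bar>t - m\<bar>" "f t" 1] fold_range[of m t] that m by (simp add: theta_m_eq omega_m_eq a_def)
  then show "AE t in ?N. sqrt (\<theta> m) * f t + k m (m + \<bar>t - m\<bar>) \<le> sqrt (theta_m l Q \<omega> m t * (f t)\<^sup>2 + omega_m \<omega> m t)"
    by (rule AE_I2)
  have "ennreal (sqrt (\<theta> m) * (\<integral>t. f t \<partial>?N) + A m) \<le> (\<integral>\<^sup>+t. ennreal (sqrt (\<theta> m) * f t + k m (m + \<bar>t - m\<bar>)) \<partial>?N)"
    unfolding val[symmetric] by (rule ennreal_integral_le[OF int])
  also have "\<dots> \<le> (\<integral>\<^sup>+ t. ennreal (sqrt (theta_m l Q \<omega> m t * (f t)\<^sup>2 + omega_m \<omega> m t)) \<partial>?N)"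
    by (rule nn_integral_mono) (use pt in \<open>auto intro: ennreal_leI\<close>)
  finally show "ennreal (sqrt (\<theta> m) * (\<integral>t. f t \<partial>?N) + A m)
      \<le> (\<integral>\<^sup>+ t. ennreal (sqrt (theta_m l Q \<omega> m t * (f t)\<^sup>2 + omega_m \<omega> m t)) \<partial>?N)" .
  have sg: "ennreal (sqrt (\<theta> m) * measure \<mu> {a<..<1}) \<le> (\<integral>\<^sup>+t. ennreal (sqrt (theta_m l Q \<omega> m t)) \<partial>\<mu>)"
    if mu: "finite_borel_measure_on a 1 \<mu>" for \<mu>
  proof -
    interpret finite_measure \<mu> by (rule finite_borel_measure_onD[OF mu])
    have "ennreal (sqrt (\<theta> m) * measure \<mu> {a<..<1}) = (\<integral>\<^sup>+t. ennreal (sqrt (\<theta> m)) \<partial>\<mu>)"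
      using finite_borel_measure_onD(2)[OF mu] th_nonneg[of m] m by (simp add: emeasure_eq_measure ennreal_mult')
    also have "\<dots> \<le> (\<integral>\<^sup>+t. ennreal (sqrt (theta_m l Q \<omega> m t)) \<partial>\<mu>)"
    proof (rule nn_integral_mono)
      fix t assume "t \<in> space \<mu>"
      then have "a < t" "t < 1" using finite_borel_measure_onD(2)[OF mu] by auto
      then show "ennreal (sqrt (\<theta> m)) \<le> ennreal (sqrt (theta_m l Q \<omega> m t))"
        using th_mono[of m "m + \<bar>t - m\<bar>"] m by (auto simp: theta_m_eq a_def intro!: ennreal_leI)
    qed
    finally show ?thesis .
  qed
  have "ennreal (sqrt (\<theta> m) * (measure \<sigma> {a<..<1} + measure \<tau> {a<..<1}))
      \<le> ennreal (sqrt (\<theta> m) * measure \<sigma> {a<..<1}) + ennreal (sqrt (\<theta> m) * measure \<tau> {a<..<1})"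
    unfolding distrib_left by (rule ennreal_add_le)
  also have "\<dots> \<le> sing_integral a 1 z (\<lambda>t. ennreal (sqrt (theta_m l Q \<omega> m t)))"
    unfolding sing_integral_def \<sigma>_def[symmetric] \<tau>_def[symmetric] by (intro add_mono sg fs ft)
  finally show "ennreal (sqrt (\<theta> m) * (measure \<sigma> {a<..<1} + measure \<tau> {a<..<1})) \<le> sing_integral a 1 z (\<lambda>t. ennreal (sqrt (theta_m l Q \<omega> m t)))" .
qed

lemma boundary_ge: "0 \<le> m \<Longrightarrow> m < 1 \<Longrightarrow> ennreal (sqrt (\<theta> m) * \<bar>x\<bar>) \<le> ennsqrt T * ennreal \<bar>x\<bar>"
  using q_le_T[of m] th_nonneg[of m] by (simp add: ennreal_mult' mult_right_mono)

text \<open>The opening s has to be bridged by the two boundary jumps and the variation of z. Each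
  of these costs at least sqrt (\<theta> m) per unit, and the absolutely continuous part costs A m
  in addition.\<close>

lemma scG_ge:
  assumes m: "0 < m" "m < 1"
  shows "ennreal (H m s) \<le> scG l Q \<omega> m s z"
proof (cases "BV (2 * m - 1) 1 z")
  case True
  note B = scG_bounds[OF m True]
  let ?N = "lebesgue_on {2 * m - 1<..<1}"
  define I where "I = (\<integral>t. bv_density (2 * m - 1) 1 z t \<partial>?N)"
  define S1 where "S1 = measure (bv_sing_pos (2 * m - 1) 1 z) {2 * m - 1<..<1}"
  define S2 where "S2 = measure (bv_sing_neg (2 * m - 1) 1 z) {2 * m - 1<..<1}"
  define c where "c = trace_right z (2 * m - 1)"
  define e where "e = trace_left z 1"
  define q where "q = sqrt (\<theta> m)"
  have q: "0 \<le> q" using th_nonneg[of m] m by (simp add: q_def)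
  have ec: "e - c = I + S1 - S2" using B(1) by (simp add: e_def c_def I_def S1_def S2_def)
  have S: "0 \<le> S1" "0 \<le> S2" by (simp_all add: S1_def S2_def)
  have "s \<le> I + (S1 + S2) + \<bar>c\<bar> + \<bar>e - s\<bar>" using ec S by linarith
  then have "q * s \<le> q * (I + (S1 + S2) + \<bar>c\<bar> + \<bar>e - s\<bar>)" using q by (rule mult_left_mono)
  then have "H m s \<le> (q * I + A m) + q * (S1 + S2) + q * \<bar>c\<bar> + q * \<bar>e - s\<bar>"
    by (simp add: H_def q_def[symmetric] algebra_simps)
  then have "ennreal (H m s) \<le> ennreal ((q * I + A m) + q * (S1 + S2) + q * \<bar>c\<bar> + q * \<bar>e - s\<bar>)" by (rule ennreal_leI)
  also have "\<dots> \<le> ennreal (q * I + A m) + ennreal (q * (S1 + S2)) + ennreal (q * \<bar>c\<bar>) + ennreal (q * \<bar>e - s\<bar>)"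
    by (intro order_trans[OF ennreal_add_le] add_mono order_refl)
  also have "\<dots> \<le> scG l Q \<omega> m s z"
    unfolding scG_def if_P[OF True] T_def[symmetric] c_def[symmetric] e_def[symmetric]
    by (intro add_mono B(3)[folded I_def q_def] B(4)[folded S1_def S2_def q_def])
       (use boundary_ge[of m] m in \<open>auto simp: q_def\<close>)
  finally show ?thesis .
qed (simp add: scG_def)

end

context cohesive_decreasing
begin

text \<open>Equality leaves no slack in any term. This excludes boundary jumps and the negative
  singular part, and equality in Cauchy-Schwarz fixes the density. The positive singular part has to
  be excluded afterwards: the density already integrates to P m, so nothing is left for it.\<close>

lemma scG_equality:
  assumes m: "0 < m" "m < 1" and eq: "scG l Q \<omega> m (P m) z \<le> ennreal (H m (P m))"
  shows "W11 (2 * m - 1) 1 z"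
    and "AE t in lebesgue_on {2 * m - 1<..<1}. bv_density (2 * m - 1) 1 z t = dw m (m + \<bar>t - m\<bar>)"
proof -
  let ?N = "lebesgue_on {2 * m - 1<..<1}"
  let ?s = "P m"
  have True: "BV (2 * m - 1) 1 z"
    using eq by (auto simp: scG_def top_unique split: if_splits)
  note B = scG_bounds[OF m True]
  define f where "f = bv_density (2 * m - 1) 1 z"
  define I where "I = (\<integral>t. f t \<partial>?N)"
  define S1 where "S1 = measure (bv_sing_pos (2 * m - 1) 1 z) {2 * m - 1<..<1}"
  define S2 where "S2 = measure (bv_sing_neg (2 * m - 1) 1 z) {2 * m - 1<..<1}"
  define c where "c = trace_right z (2 * m - 1)"
  define e where "e = trace_left z 1"
  define q where "q = sqrt (\<theta> m)"
  \<comment> \<open>A level above m: boundary jumps cost at least sqrt (\<theta> m2) per unit,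
    strictly more than sqrt (\<theta> m). A finite comparison value is used because the true
    coefficient may be infinite.\<close>
  define m2 where "m2 = (m + 1) / 2"
  define q2 where "q2 = sqrt (\<theta> m2)"
  have m2: "m < m2" "m2 < 1" using m by (auto simp: m2_def)
  have q: "0 < q" "q < q2" using th_pos[of m] q_less[of m m2] m m2 by (auto simp: q_def q2_def)
  have ec: "e - c = I + S1 - S2" using B(1) by (simp add: e_def c_def I_def S1_def S2_def f_def)
  have S: "0 \<le> S1" "0 \<le> S2" by (simp_all add: S1_def S2_def)
  define E1 where "E1 = (\<integral>\<^sup>+ t. ennreal (sqrt (theta_m l Q \<omega> m t * (f t)\<^sup>2 + omega_m \<omega> m t)) \<partial>?N)"
  define E2 where "E2 = sing_integral (2 * m - 1) 1 z (\<lambda>t. ennreal (sqrt (theta_m l Q \<omega> m t)))"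
  define E3 where "E3 = ennsqrt T * ennreal \<bar>c\<bar>"
  define E4 where "E4 = ennsqrt T * ennreal \<bar>e - ?s\<bar>"
  have sum: "E1 + E2 + E3 + E4 \<le> ennreal (H m ?s)"
    using eq unfolding scG_def if_P[OF True] T_def[symmetric] c_def[symmetric] e_def[symmetric] f_def[symmetric]
      E1_def E2_def E3_def E4_def .
  have b1: "ennreal (q * I + A m) \<le> E1" using B(3) by (simp add: E1_def I_def q_def f_def)
  have b2: "ennreal (q * (S1 + S2)) \<le> E2" using B(4) by (simp add: E2_def S1_def S2_def q_def)
  have b3: "ennreal (q2 * \<bar>c\<bar>) \<le> E3" "ennreal (q2 * \<bar>e - ?s\<bar>) \<le> E4"
    using boundary_ge[of m2] m m2 by (simp_all add: E3_def E4_def q2_def)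
  have H0: "0 \<le> H m ?s" using H_nonneg[OF m P_nonneg] .
  have fin: "E1 < top" "E2 < top" "E3 < top" "E4 < top"
    using le_less_trans[OF sum ennreal_less_top] by auto
  obtain e1 where e1: "E1 = ennreal e1" "0 \<le> e1" using fin(1) by (cases E1) auto
  obtain e2 where e2: "E2 = ennreal e2" "0 \<le> e2" using fin(2) by (cases E2) auto
  obtain e3 where e3: "E3 = ennreal e3" "0 \<le> e3" using fin(3) by (cases E3) auto
  obtain e4 where e4: "E4 = ennreal e4" "0 \<le> e4" using fin(4) by (cases E4) auto
  have r: "q * I + A m \<le> e1" "q * (S1 + S2) \<le> e2" "q2 * \<bar>c\<bar> \<le> e3" "q2 * \<bar>e - ?s\<bar> \<le> e4"
    using b1 b2 b3 e1 e2 e3 e4 by (simp_all add: ennreal_le_iff)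
  have "ennreal (e1 + e2 + e3 + e4) \<le> ennreal (H m ?s)"
    using sum e1 e2 e3 e4 by (simp add: ennreal_plus)
  then have tot: "e1 + e2 + e3 + e4 \<le> q * ?s + A m" using H0 by (simp add: ennreal_le_iff H_def q_def)
  \<comment> \<open>S2 counts twice: it is paid for as variation, and it moves away from s, so the
    other terms have to make up for it.\<close>
  have "q * ?s + q * S2 + q * S2 \<le> q * I + q * (S1 + S2) + q * \<bar>c\<bar> + q * \<bar>e - ?s\<bar>"
  proof -
    have "?s + S2 + S2 \<le> I + (S1 + S2) + \<bar>c\<bar> + \<bar>e - ?s\<bar>" using ec by linarith
    then have "q * (?s + S2 + S2) \<le> q * (I + (S1 + S2) + \<bar>c\<bar> + \<bar>e - ?s\<bar>)" using q by (intro mult_left_mono) auto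
    then show ?thesis by (simp add: algebra_simps)
  qed
  moreover have "0 \<le> q * S2" using q S by simp
  ultimately have main: "(q2 - q) * \<bar>c\<bar> + (q2 - q) * \<bar>e - ?s\<bar> + 2 * (q * S2) + (e1 - (q * I + A m)) \<le> 0"
    using r tot by (simp add: algebra_simps)
  have nn: "0 \<le> (q2 - q) * \<bar>c\<bar>" "0 \<le> (q2 - q) * \<bar>e - ?s\<bar>" "0 \<le> q * S2" "0 \<le> e1 - (q * I + A m)"
    using q S r by auto
  have "(q2 - q) * \<bar>c\<bar> = 0" "(q2 - q) * \<bar>e - ?s\<bar> = 0" "q * S2 = 0" and e1eq: "e1 = q * I + A m"
    using main nn by linarith+
  then have ce: "c = 0" "e = ?s" "S2 = 0" using q by auto
  have fI: "integrable ?N f" using B(2) by (simp add: f_def)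
  have ae: "AE t in ?N. sqrt (\<theta> m) * f t + k m (m + \<bar>t - m\<bar>) = sqrt (theta_m l Q \<omega> m t * (f t)\<^sup>2 + omega_m \<omega> m t)"
  proof (rule AE_eq_of_integral_le)
    show "integrable ?N (\<lambda>t. sqrt (\<theta> m) * f t + k m (m + \<bar>t - m\<bar>))" using B(6) by (simp add: f_def)
    have c1: "continuous_on {m..<1} \<theta>" by (rule continuous_on_subset[OF th_cont]) (use m in auto)
    have c2: "continuous_on {m..<1} W" by (rule continuous_on_subset[OF W_cont]) (use m in auto)
    have "f \<in> borel_measurable ?N" using fI by auto
    then show "(\<lambda>t. sqrt (theta_m l Q \<omega> m t * (f t)\<^sup>2 + omega_m \<omega> m t)) \<in> borel_measurable ?N"
      unfolding theta_m_eq omega_m_eq using fold_measurable[OF m c1] fold_measurable[OF m c2] by measurable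
    show "AE t in ?N. sqrt (\<theta> m) * f t + k m (m + \<bar>t - m\<bar>) \<le> sqrt (theta_m l Q \<omega> m t * (f t)\<^sup>2 + omega_m \<omega> m t)"
      using B(5) by (simp add: f_def)
    have v: "(\<integral>t. sqrt (\<theta> m) * f t + k m (m + \<bar>t - m\<bar>) \<partial>?N) = e1"
      using B(7) e1eq by (simp add: f_def I_def q_def)
    show "(\<integral>\<^sup>+t. ennreal (sqrt (theta_m l Q \<omega> m t * (f t)\<^sup>2 + omega_m \<omega> m t)) \<partial>?N)
        \<le> ennreal (\<integral>t. sqrt (\<theta> m) * f t + k m (m + \<bar>t - m\<bar>) \<partial>?N)"
      unfolding v using e1 by (simp add: E1_def)
    show "0 \<le> (\<integral>t. sqrt (\<theta> m) * f t + k m (m + \<bar>t - m\<bar>) \<partial>?N)" unfolding v by (rule e1)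
    show "AE t in ?N. 0 \<le> sqrt (theta_m l Q \<omega> m t * (f t)\<^sup>2 + omega_m \<omega> m t)"
    proof (rule AE_I2)
      fix t assume "t \<in> space ?N"
      then show "0 \<le> sqrt (theta_m l Q \<omega> m t * (f t)\<^sup>2 + omega_m \<omega> m t)"
        unfolding theta_m_eq omega_m_eq
        using fold_range[of m t] m th_nonneg[of "m + \<bar>t - m\<bar>"] W_nonneg[of "m + \<bar>t - m\<bar>"] by auto
    qed
  qed
  have fae: "AE t in ?N. f t = dw m (m + \<bar>t - m\<bar>)"
    using ae AE_fold_indicator[OF m] AE_space[of ?N]
  proof eventually_elim
    case (elim t)
    have "m < m + \<bar>t - m\<bar>" "m + \<bar>t - m\<bar> < 1" using fold_range[of m t] m elim by auto
    then show ?case using elim m by (intro optimal_profile_unique) (auto simp: theta_m_eq omega_m_eq)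
  qed
  then show "AE t in ?N. bv_density (2 * m - 1) 1 z t = dw m (m + \<bar>t - m\<bar>)" by (simp add: f_def)
  have "I = (\<integral>t. wd m t \<partial>?N)"
    unfolding I_def
  proof (rule integral_cong_AE)
    show "AE t in ?N. f t = wd m t"
      using fae AE_fold_indicator[OF m] by eventually_elim (auto simp: wd_def)
  qed (use fI wd_integral[OF m] in auto)
  then have "I = ?s" using wd_integral[OF m] by simp
  then have S1: "S1 = 0" using ec ce by simp
  have ab: "2 * m - 1 < 1" using m by simp
  have d: "bv_decomp (2 * m - 1) 1 z f (bv_sing_pos (2 * m - 1) 1 z) (bv_sing_neg (2 * m - 1) 1 z)"
    unfolding f_def by (rule bv_decomp_canonical[OF ab True])
  have zero: "(\<integral>x. \<psi> x \<partial>\<mu>) = 0" if mu: "finite_borel_measure_on (2 * m - 1) 1 \<mu>" "measure \<mu> {2 * m - 1<..<1} = 0"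
    for \<mu> and \<psi> :: "real \<Rightarrow> real"
  proof -
    interpret finite_measure \<mu> by (rule finite_borel_measure_onD[OF mu(1)])
    have sp: "space \<mu> = {2 * m - 1<..<1}" by (rule finite_borel_measure_onD[OF mu(1)])
    have "emeasure \<mu> (space \<mu>) = 0" using mu(2) sp by (simp add: emeasure_eq_measure)
    then have "space \<mu> \<in> null_sets \<mu>" by (intro null_setsI) auto
    then have "AE x in \<mu>. x \<notin> space \<mu>" by (rule AE_not_in)
    with AE_space[of \<mu>] have "AE x in \<mu>. \<psi> x = 0" by eventually_elim auto
    then show ?thesis by (rule integral_eq_zero_AE)
  qed
  have "weak_deriv (2 * m - 1) 1 z f"
    unfolding weak_deriv_def
    using d zero[of "bv_sing_pos (2 * m - 1) 1 z"] zero[of "bv_sing_neg (2 * m - 1) 1 z"] S1 ce(3)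
    by (simp add: bv_decomp_def S1_def S2_def)
  then show "W11 (2 * m - 1) 1 z"
    unfolding W11_def using True fI by (auto simp: BV_def L1_on_def)
qed

text \<open>The profile is the primitive of \<open>wd m\<close> that starts at 0. It ends at P m, so
  there are no boundary jumps; it has no singular part, and Cauchy-Schwarz is an equality.\<close>

lemma optimal_bv_profile:
  assumes m: "0 < m" "m < 1"
  obtains z where "L1_on (2 * m - 1) 1 z" "scG l Q \<omega> m (P m) z \<le> ennreal (H m (P m))"
proof -
  define a where "a = 2 * m - 1"
  have ab: "a < 1" using m by (simp add: a_def)
  let ?N = "lebesgue_on {a<..<1}" and ?L = "restrict_space lborel {a<..<1}"
  note wI = wd_integral[OF m, folded a_def]
  note id = id_borel_measurable_lebesgue_on[of "{a<..<1}"]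
  define z where "z = cdf_on ?N (wd m)"
  have zI: "integrable ?N z" unfolding z_def by (rule integrable_cdf_on[OF sigma_finite_lebesgue_on_Ioo id wI(1)])
  have zd: "(\<integral>x. z x * deriv \<psi> x \<partial>?N) = - (\<integral>x. wd m x * \<psi> x \<partial>?N)" if "test_fun a 1 \<psi>" for \<psi>
    unfolding z_def by (rule integral_cdf_test_fun[OF that sigma_finite_lebesgue_on_Ioo _ id wI(1)]) simp
  have sL: "sets ?L = sets (restrict_space borel {a<..<1})" by (rule sets_restrict_space_cong) simp
  have wL: "wd m \<in> borel_measurable ?L" by (rule measurable_restrict_space1) (use wI(3) in simp)
  define \<mu> where "\<mu> = density ?L (\<lambda>t. ennreal (wd m t))"
  \<comment> \<open>The zero measure, used for both singular parts and for the negative part of the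
    derivative.\<close>
  define \<nu> where "\<nu> = null_measure ?L"
  have wLI: "integrable ?L (wd m)" using wI(1) lebesgue_on_Ioo_borel_eq[OF wL] by simp
  have spL: "space ?L = {a<..<1}" by (simp add: space_restrict_space)
  have fmu: "finite_borel_measure_on a 1 \<mu>"
  proof -
    have "(\<integral>\<^sup>+ x. ennreal (wd m x) \<partial>?L) < \<infinity>" using wLI wI(4) by (simp add: nn_integral_eq_integral)
    moreover have "emeasure \<mu> (space \<mu>) = (\<integral>\<^sup>+ x. ennreal (wd m x) \<partial>?L)"
    proof -
      have "emeasure \<mu> (space ?L) = (\<integral>\<^sup>+ x. ennreal (wd m x) * indicator (space ?L) x \<partial>?L)"
        unfolding \<mu>_def
      proof (rule emeasure_density)
        show "(\<lambda>t. ennreal (wd m t)) \<in> borel_measurable ?L" using wL by simp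
      qed (rule sets.top)
      also have "\<dots> = (\<integral>\<^sup>+ x. ennreal (wd m x) \<partial>?L)" by (rule nn_integral_cong) simp
      finally show ?thesis by (simp add: \<mu>_def)
    qed
    ultimately have "finite_measure \<mu>" by (intro finite_measureI) auto
    then show ?thesis using sL by (simp add: finite_borel_measure_on_def \<mu>_def)
  qed
  have fnu: "finite_borel_measure_on a 1 \<nu>"
    unfolding finite_borel_measure_on_def \<nu>_def using sL by (auto intro!: finite_measureI)
  have nu0: "(\<integral>x. \<psi> x \<partial>\<nu>) = 0" for \<psi> :: "real \<Rightarrow> real"
    by (rule integral_eq_zero_AE) (auto simp: \<nu>_def eventually_ae_filter null_sets_def intro!: exI[of _ "{a<..<1}"] simp: spL sets_restrict_space)
  have "(\<integral>x. \<psi> x \<partial>\<mu>) = (\<integral>x. wd m x * \<psi> x \<partial>?N)" if "test_fun a 1 \<psi>" for \<psi>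
  proof -
    have "\<psi> \<in> borel_measurable \<mu>" using test_fun_integrable[OF that fmu] by auto
    then have pm: "\<psi> \<in> borel_measurable ?L" by (simp add: \<mu>_def)
    have "(\<integral>x. \<psi> x \<partial>\<mu>) = (\<integral>x. wd m x * \<psi> x \<partial>?L)"
      unfolding \<mu>_def using wL pm wI(4) by (subst integral_density) auto
    also have "\<dots> = (\<integral>x. wd m x * \<psi> x \<partial>?N)"
      by (rule lebesgue_on_Ioo_borel_eq(2)[symmetric]) (intro borel_measurable_times wL pm)
    finally show ?thesis .
  qed
  then have BVz: "BV a 1 z" unfolding BV_def L1_on_def using zI zd fmu fnu nu0
    by (intro conjI exI[of _ \<mu>] exI[of _ \<nu>]) auto
  have ms: "mutually_singular \<nu> ?L" "mutually_singular \<nu> \<nu>"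
    unfolding mutually_singular_def by (rule bexI[of _ "{a<..<1}"]; use spL in \<open>auto simp: \<nu>_def sets_restrict_space\<close>)+
  have dec: "bv_decomp a 1 z (wd m) \<nu> \<nu>"
    unfolding bv_decomp_def L1_on_def using wI(1) fnu ms zd nu0 by simp
  have zL: "L1_on a 1 z" using zI by (simp add: L1_on_def)
  note can = bv_decomp_canonical[OF ab BVz]
  have sing: "bv_sing_pos a 1 z = \<nu>" "bv_sing_neg a 1 z = \<nu>"
    and dens: "AE t in ?N. bv_density a 1 z t = wd m t"
    using bv_decomp_unique[OF ab zL can dec] by auto
  have cdf: "bv_cdf a 1 (wd m) \<nu> \<nu> y = z y" for y by (simp add: bv_cdf_def z_def)
  have "AE y in ?N. z y = 0 + bv_cdf a 1 (wd m) \<nu> \<nu> y" unfolding cdf by simp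
  from bv_traces[OF ab zL dec this] have tr: "trace_right z a = 0" "trace_left z 1 = P m"
    using wI(2) by simp_all
  have "(\<integral>\<^sup>+ t. ennreal (sqrt (theta_m l Q \<omega> m t * (bv_density a 1 z t)\<^sup>2 + omega_m \<omega> m t)) \<partial>?N)
     = (\<integral>\<^sup>+ t. ennreal (sqrt (\<theta> m) * wd m t + k m (m + \<bar>t - m\<bar>)) \<partial>?N)"
  proof (rule nn_integral_cong_AE)
    show "AE t in ?N. ennreal (sqrt (theta_m l Q \<omega> m t * (bv_density a 1 z t)\<^sup>2 + omega_m \<omega> m t))
       = ennreal (sqrt (\<theta> m) * wd m t + k m (m + \<bar>t - m\<bar>))"
      using dens AE_fold_indicator[OF m, folded a_def] AE_space[of ?N]
    proof eventually_elim
      case (elim t)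
      define v where "v = m + \<bar>t - m\<bar>"
      have v: "m < v" "v < 1" using fold_range[of m t] m elim by (auto simp: v_def a_def)
      have w: "wd m t = dw m v" using elim by (simp add: wd_def v_def)
      have op: "\<theta> v * (dw m v)\<^sup>2 + W v = (sqrt (\<theta> m) * dw m v + k m v)\<^sup>2" "0 \<le> dw m v"
        using optimal_profile[of m v] m v by auto
      have "0 \<le> sqrt (\<theta> m) * dw m v + k m v"
        using op(2) th_nonneg[of m] k_nonneg[of v m] m v by auto
      then show ?case using elim(1) unfolding theta_m_eq omega_m_eq v_def[symmetric] w by (simp add: op(1))
    qed
  qed
  also have "\<dots> = ennreal (\<integral>t. sqrt (\<theta> m) * wd m t + k m (m + \<bar>t - m\<bar>) \<partial>?N)"
  proof (rule nn_integral_eq_integral)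
    show "integrable ?N (\<lambda>t. sqrt (\<theta> m) * wd m t + k m (m + \<bar>t - m\<bar>))"
      using wI(1) k_fold(1)[OF m, folded a_def] by simp
    show "AE t in ?N. 0 \<le> sqrt (\<theta> m) * wd m t + k m (m + \<bar>t - m\<bar>)"
    proof (rule AE_I2)
      fix t assume "t \<in> space ?N"
      then have "0 \<le> k m (m + \<bar>t - m\<bar>)" using fold_range[of m t] m by (intro k_nonneg) (auto simp: a_def)
      then show "0 \<le> sqrt (\<theta> m) * wd m t + k m (m + \<bar>t - m\<bar>)" using wI(4)[of t] th_nonneg[of m] m by simp
    qed
  qed
  also have "(\<integral>t. sqrt (\<theta> m) * wd m t + k m (m + \<bar>t - m\<bar>) \<partial>?N) = H m (P m)"
    using wI k_fold[OF m, folded a_def] by (simp add: H_def)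
  finally have "scG l Q \<omega> m (P m) z = ennreal (H m (P m))"
    unfolding scG_def a_def[symmetric] if_P[OF BVz] sing_integral_def sing tr
    by (simp add: \<nu>_def nn_integral_null_measure)
  then show ?thesis using that[of z] zL by (simp add: a_def)
qed

text \<open>The explicit profile attains the lower bound of \<open>scG_ge\<close>, so a minimiser
  exists, the choice in \<open>w_min\<close> is meaningful and its value is forced.\<close>

lemma w_min_props:
  assumes m: "0 < m" "m < 1"
  shows "scG l Q \<omega> m (P m) (w_min l Q \<omega> m (P m)) = ennreal (H m (P m))"
proof -
  obtain z where z: "L1_on (2 * m - 1) 1 z" "scG l Q \<omega> m (P m) z \<le> ennreal (H m (P m))"
    using optimal_bv_profile[OF m] .
  have "\<exists>w. L1_on (2 * m - 1) 1 w \<and> (\<forall>z. L1_on (2 * m - 1) 1 z \<longrightarrow> scG l Q \<omega> m (P m) w \<le> scG l Q \<omega> m (P m) z)"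
    using z scG_ge[OF m] by (blast intro: order_trans)
  from someI_ex[OF this, folded w_min_def] z scG_ge[OF m] show ?thesis
    by (blast intro: antisym order_trans)
qed

text \<open>The density determines \<lambda>: a formula valid almost everywhere is valid at some
  single t > m, and there it can be solved for the square of \<lambda>.\<close>

lemma lambda_min_eq:
  assumes m: "0 < m" "m < 1"
  shows "lambda_min l Q \<omega> m (P m) = sqrt (\<theta> m)"
proof -
  let ?N = "lebesgue_on {2 * m - 1<..<1}"
  define w where "w = w_min l Q \<omega> m (P m)"
  have ae: "AE t in ?N. bv_density (2 * m - 1) 1 w t = dw m (m + \<bar>t - m\<bar>)"
    by (rule scG_equality[OF m]) (simp add: w_def w_min_props[OF m])
  have q: "(sqrt (\<theta> m))\<^sup>2 = \<theta> m" using th_nonneg[of m] m by simp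
  show ?thesis
    unfolding lambda_min_def w_def[symmetric]
  proof (rule the_equality)
    show "0 < sqrt (\<theta> m) \<and> sqrt (\<theta> m) \<le> sqrt (\<theta> m) \<and>
      (AE t in ?N. bv_density (2 * m - 1) 1 w t =
         sqrt ((sqrt (\<theta> m))\<^sup>2 * omega_m \<omega> m t / (theta_m l Q \<omega> m t * (theta_m l Q \<omega> m t - (sqrt (\<theta> m))\<^sup>2))))"
      using th_pos[of m] m ae unfolding q theta_m_eq omega_m_eq dw_def by simp
    fix r assume r: "0 < r \<and> r \<le> sqrt (\<theta> m) \<and>
      (AE t in ?N. bv_density (2 * m - 1) 1 w t =
         sqrt (r\<^sup>2 * omega_m \<omega> m t / (theta_m l Q \<omega> m t * (theta_m l Q \<omega> m t - r\<^sup>2))))"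
    then have "AE t in ?N. dw m (m + \<bar>t - m\<bar>) = sqrt (r\<^sup>2 * omega_m \<omega> m t / (theta_m l Q \<omega> m t * (theta_m l Q \<omega> m t - r\<^sup>2)))"
      (is "AE t in ?N. ?P t")
    proof -
      have "AE t in ?N. bv_density (2 * m - 1) 1 w t =
         sqrt (r\<^sup>2 * omega_m \<omega> m t / (theta_m l Q \<omega> m t * (theta_m l Q \<omega> m t - r\<^sup>2)))" using r by blast
      with ae show ?thesis by eventually_elim simp
    qed
    from frequently_ae_at_right[OF this, of m]
    have fr: "\<exists>\<^sub>F t in at_right m. dw m (m + \<bar>t - m\<bar>) = sqrt (r\<^sup>2 * omega_m \<omega> m t / (theta_m l Q \<omega> m t * (theta_m l Q \<omega> m t - r\<^sup>2)))"
      using m by simp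
    have "\<forall>\<^sub>F t in at_right m. t \<in> {m<..<1}" by (rule eventually_at_right_real) (use m in simp)
    from frequently_ex[OF frequently_eventually_frequently[OF fr this]]
    obtain t where t: "m < t" "t < 1"
      and e: "dw m (m + \<bar>t - m\<bar>) = sqrt (r\<^sup>2 * omega_m \<omega> m t / (theta_m l Q \<omega> m t * (theta_m l Q \<omega> m t - r\<^sup>2)))"
      by auto
    define b where "b = \<theta> t"
    define c where "c = \<theta> m"
    define u where "u = W t"
    have p: "0 < c" "c < b" "0 < u"
      using th_pos[of m] th_strict_mono[of m t] W_pos[of t] m t by (auto simp: b_def c_def u_def)
    have rc: "r\<^sup>2 \<le> c" using r th_nonneg[of m] m power_mono[of r "sqrt (\<theta> m)" 2] by (simp add: c_def)
    have "m + \<bar>t - m\<bar> = t" using t by simp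
    with e have "sqrt (c * u / (b * (b - c))) = sqrt (r\<^sup>2 * u / (b * (b - r\<^sup>2)))"
      unfolding theta_m_eq omega_m_eq dw_def b_def c_def u_def by (simp only:)
    then have "c * u / (b * (b - c)) = r\<^sup>2 * u / (b * (b - r\<^sup>2))" by (simp only: real_sqrt_eq_iff)
    moreover have nz: "b * (b - c) \<noteq> 0" "b * (b - r\<^sup>2) \<noteq> 0" using p rc by auto
    ultimately have "c * u * (b * (b - r\<^sup>2)) = r\<^sup>2 * u * (b * (b - c))" by (simp only: frac_eq_eq[OF nz])
    then have "(u * b * b) * (c - r\<^sup>2) = 0" by (simp add: algebra_simps)
    then have "r\<^sup>2 = c" using p by simp
    then have "sqrt (r\<^sup>2) = sqrt c" by simp
    then show "r = sqrt (\<theta> m)" using r by (simp add: c_def)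
  qed
qed

lemma part_ii:
  assumes s: "0 \<le> s" "inf_Phi l Q \<omega> < ennreal s" "ennreal s < s_frac l Q \<omega>"
  shows "m_of l Q \<omega> s \<in> {0<..<1} \<and> Phi l Q \<omega> (m_of l Q \<omega> s) = ennreal s \<and>
        W11 (2 * m_of l Q \<omega> s - 1) 1 (w_min l Q \<omega> (m_of l Q \<omega> s) s) \<and>
        lambda_min l Q \<omega> (m_of l Q \<omega> s) s = sqrt (theta l Q \<omega> (m_of l Q \<omega> s)) \<and>
        g l Q \<omega> s = G_min l Q \<omega> s (m_of l Q \<omega> s) \<and>
        (\<forall>m\<in>{0<..<1}. g l Q \<omega> s = G_min l Q \<omega> s m \<longrightarrow> m = m_of l Q \<omega> s)"
proof -
  have s': "ennreal s < sup_Phi l Q \<omega>" using s(3) by (simp add: s_frac_eq)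
  define m where "m = M s"
  have m: "0 < m" "m < 1" and Pm: "P m = s" using M_props[OF s(1,2) s'] by (auto simp: m_def)
  have mo: "m_of l Q \<omega> s = m" using m_of_mid[OF s(1,2) s'] by (simp add: m_def)
  note wp = w_min_props[OF m, unfolded Pm] and lm = lambda_min_eq[OF m, unfolded Pm] and gp = g_P[OF m, unfolded Pm]
  have "W11 (2 * m - 1) 1 (w_min l Q \<omega> m s)"
    by (rule scG_equality[OF m]) (simp add: wp Pm)
  \<comment> \<open>For any other m' the auxiliary problem has a value of at least H m' s, which
    exceeds H m s, the value of g at s, by strict minimality.\<close>
  moreover have "m' = m" if m': "m' \<in> {0<..<1}" and e: "g l Q \<omega> s = G_min l Q \<omega> s m'" for m'
  proof (rule ccontr)
    assume "m' \<noteq> m"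
    then have lt: "H m s < H m' s" using H_min[of m m'] m m' Pm by auto
    have "ennreal (H m' s) \<le> ennreal (H m s)"
      using scG_ge[of m' s] m' e gp unfolding G_min_def by auto
    then have "H m' s \<le> H m s" using H_nonneg[OF m s(1)] by (simp add: ennreal_le_iff)
    then show False using lt by simp
  qed
  moreover have "m \<in> {0<..<1}" "Phi l Q \<omega> m = ennreal s" "g l Q \<omega> s = G_min l Q \<omega> s m"
    using m Phi_P[OF m] Pm gp wp by (simp_all add: G_min_def)
  ultimately show ?thesis unfolding mo using lm by blast
qed

end

theorem theorem2p15:
  fixes l Q \<omega> \<phi> :: "real \<Rightarrow> real"
  assumes data: "regular_data l Q \<omega> \<phi>"
    and Phi_range: "\<forall>x\<in>{0<..<1}. 0 < Phi l Q \<omega> x \<and> Phi l Q \<omega> x < top"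
    and Phi_decr: "strict_antimono_on {0<..<1} (Phi l Q \<omega>)"
  shows
    "(s_frac l Q \<omega> = sup_Phi l Q \<omega> \<and> (Phi l Q \<omega> \<longlongrightarrow> s_frac l Q \<omega>) (at_right 0))
     \<and>
     (\<forall>s\<ge>0. ennreal s \<le> inf_Phi l Q \<omega> \<longrightarrow> g l Q \<omega> s = varsigma_bar Q \<omega> * ennreal s) \<and>
     (\<forall>s\<ge>0. inf_Phi l Q \<omega> < ennreal s \<and> ennreal s < s_frac l Q \<omega> \<longrightarrow>
        m_of l Q \<omega> s \<in> {0<..<1} \<and> Phi l Q \<omega> (m_of l Q \<omega> s) = ennreal s \<and>
        W11 (2 * m_of l Q \<omega> s - 1) 1 (w_min l Q \<omega> (m_of l Q \<omega> s) s) \<and>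
        lambda_min l Q \<omega> (m_of l Q \<omega> s) s = sqrt (theta l Q \<omega> (m_of l Q \<omega> s)) \<and>
        g l Q \<omega> s = G_min l Q \<omega> s (m_of l Q \<omega> s) \<and>
        (\<forall>m\<in>{0<..<1}. g l Q \<omega> s = G_min l Q \<omega> s m \<longrightarrow> m = m_of l Q \<omega> s))
     \<and>
     (\<forall>s\<ge>0. g l Q \<omega> s < top) \<and>
     (theta_ext l Q \<omega> 1 < top \<longrightarrow>
        (\<exists>g'. continuous_on {0..} g' \<and>
           (\<forall>s\<ge>0. (g_real l Q \<omega> has_real_derivative g' s) (at s within {0..}) \<and>
              g_deriv_values l Q \<omega> g' s))) \<and>
     (theta_ext l Q \<omega> 1 = top \<longrightarrow>
        continuous_on {0..} (g_real l Q \<omega>) \<and>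
        (\<exists>g'. continuous_on {0<..} g' \<and>
           (\<forall>s>0. (g_real l Q \<omega> has_real_derivative g' s) (at s) \<and> g_deriv_values l Q \<omega> g' s) \<and>
           filterlim g' at_top (at_right 0)) \<and>
        filterlim (\<lambda>s. (g_real l Q \<omega> s - g_real l Q \<omega> 0) / s) at_top (at_right 0)) \<and>
     concave_on {0..} (g_real l Q \<omega>) \<and>
     strictly_concave_on {s. 0 \<le> s \<and> inf_Phi l Q \<omega> \<le> ennreal s \<and> ennreal s \<le> s_frac l Q \<omega>}
       (g_real l Q \<omega>) \<and>
     (theta_ext l Q \<omega> 1 < top \<longrightarrow> ennreal (2 * Psi \<omega> 1) \<le> varsigma_bar Q \<omega> * s_frac l Q \<omega>)"
proof -
  interpret cohesive_decreasing l Q \<omega> \<phi>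
    by unfold_locales (rule data Phi_decr)+
  have i: "s_frac l Q \<omega> = sup_Phi l Q \<omega> \<and> (Phi l Q \<omega> \<longlongrightarrow> s_frac l Q \<omega>) (at_right 0)"
    using s_frac_eq Phi_tendsto_0 by simp
  have ii: "\<forall>s\<ge>0. ennreal s \<le> inf_Phi l Q \<omega> \<longrightarrow> g l Q \<omega> s = varsigma_bar Q \<omega> * ennreal s"
    using g_inf varsigma_eq by simp
  have mid: "\<forall>s\<ge>0. inf_Phi l Q \<omega> < ennreal s \<and> ennreal s < s_frac l Q \<omega> \<longrightarrow>
        m_of l Q \<omega> s \<in> {0<..<1} \<and> Phi l Q \<omega> (m_of l Q \<omega> s) = ennreal s \<and>
        W11 (2 * m_of l Q \<omega> s - 1) 1 (w_min l Q \<omega> (m_of l Q \<omega> s) s) \<and>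
        lambda_min l Q \<omega> (m_of l Q \<omega> s) s = sqrt (theta l Q \<omega> (m_of l Q \<omega> s)) \<and>
        g l Q \<omega> s = G_min l Q \<omega> s (m_of l Q \<omega> s) \<and>
        (\<forall>m\<in>{0<..<1}. g l Q \<omega> s = G_min l Q \<omega> s m \<longrightarrow> m = m_of l Q \<omega> s)"
    by (intro allI impI, elim conjE) (rule part_ii)
  have fin: "\<exists>g'. continuous_on {0..} g' \<and>
           (\<forall>s\<ge>0. (g_real l Q \<omega> has_real_derivative g' s) (at s within {0..}) \<and> g_deriv_values l Q \<omega> g' s)"
    if T: "theta_ext l Q \<omega> 1 < top"
  proof -
    have D: "D = {0..}" using T by (auto simp: D_def T_def)
    show ?thesis
    proof (intro exI[of _ p] conjI allI impI)
      show "continuous_on {0..} p" using p_cont D by simp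
      fix s :: real assume "0 \<le> s"
      then have s: "s \<in> D" using D by simp
      show "(g_real l Q \<omega> has_real_derivative p s) (at s within {0..})" using g_derivative[OF s] D by simp
      show "g_deriv_values l Q \<omega> p s" by (rule g_deriv_values_p[OF s])
    qed
  qed
  have inf: "continuous_on {0..} (g_real l Q \<omega>) \<and>
        (\<exists>g'. continuous_on {0<..} g' \<and>
           (\<forall>s>0. (g_real l Q \<omega> has_real_derivative g' s) (at s) \<and> g_deriv_values l Q \<omega> g' s) \<and>
           filterlim g' at_top (at_right 0)) \<and>
        filterlim (\<lambda>s. (g_real l Q \<omega> s - g_real l Q \<omega> 0) / s) at_top (at_right 0)"
    if T: "theta_ext l Q \<omega> 1 = top"
  proof -
    have T': "T = top" using T by (simp add: T_def)
    then have D: "D = {0<..}" by (simp add: D_def)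
    have "continuous_on {0<..} p \<and>
           (\<forall>s>0. (g_real l Q \<omega> has_real_derivative p s) (at s) \<and> g_deriv_values l Q \<omega> p s) \<and>
           filterlim p at_top (at_right 0)"
    proof (intro conjI allI impI)
      show "continuous_on {0<..} p" using p_cont D by simp
      show "filterlim p at_top (at_right 0)" by (rule p_at_top[OF T'])
      fix s :: real assume "0 < s"
      then show "(g_real l Q \<omega> has_real_derivative p s) (at s)" "g_deriv_values l Q \<omega> p s"
        by (rule g_derivative_pos, intro g_deriv_values_p D_pos)
    qed
    then have ex: "\<exists>g'. continuous_on {0<..} g' \<and>
           (\<forall>s>0. (g_real l Q \<omega> has_real_derivative g' s) (at s) \<and> g_deriv_values l Q \<omega> g' s) \<and>
           filterlim g' at_top (at_right 0)" by (rule exI[where x=p])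
    show ?thesis by (intro conjI ex g_continuous g_quotient_at_top[OF T'])
  qed
  have finite: "\<forall>s\<ge>0. g l Q \<omega> s < top" using g_finite by simp
  show ?thesis
    by (intro conjI i[THEN conjunct1] i[THEN conjunct2] ii mid finite impI[OF fin] impI[OF inf]
        g_concave g_strictly_concave impI[OF Psi_le_varsigma])
qed

end
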